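(* Let $-B_c\in\mathcal B(\mathcal H)$ be semi-dissipative, and let $m_{HC}\in\mathbb N_0$ be the hypocoercivity index of $B_c$. Let $B_d(\tau):=M_\tau(-B_c)$, $\tau>0$, be the corresponding family of scaled Cayley transforms. Then $$\frac{\left[\Delta^{2m_{HC}+1}\phi(\tau)\right]_{k=0}}{\tau^{2m_{HC}+1}}=\frac{\phi_{m_{HC}+1}(\tau)-1}{\tau^{2m_{HC}+1}}\ \xrightarrow{\ \tau\to0\ }\ \Phi_{(2m_{HC}+1)}(0)=-(2m_{HC}+1)!\,c,$$ where $$c=\frac{1}{(2m_{HC}+1)!\,\binom{2m_{HC}}{m_{HC}}}\ \lim_{\delta\to0}\ \inf_{\substack{\|\sqrt{B_H}B_c^p y\|\le\delta,\ 0\le p<m_{HC}\\ \|y\|=1}}\left\|\sqrt{B_H}\,B_c^{m_{HC}}y\right\|^2 .$$ Moreover, $\left[\Delta^{j}\phi(\tau)\right]_{k=0}=\Phi_{(j)}(0)=\delta_0^j$ (Kronecker delta) for $j=0,\dots,2m_{HC}$.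
   Context: $\mathcal H$ is a nonzero separable complex Hilbert space, $\mathcal B(\mathcal H)$ the bounded linear operators on it. $B_H:=\frac{B_c+B_c^*}2$; $-B_c$ is semi-dissipative if $B_H\ge0$; $\sqrt{B_H}$ is the positive semidefinite square root. The hypocoercivity index of $B_c$ is the smallest $m\in\mathbb N_0$ (assumed to exist here) such that $\sum_{j=0}^m(B_c^* )^jB_HB_c^j\ge\kappa I$ for some $\kappa>0$. For $m_{HC}=0$ the infimum defining $c$ is over all unit vectors $y\in\mathcal H$. Scaled Cayley transform: $B_d(\tau)=M_\tau(-B_c)=(I+\frac\tau2B_c)^{-1}(I-\frac\tau2B_c)$. Propagator norm: $\Phi(t):=\|e^{-B_ct}\|$ for $t\ge0$. $\Phi_{(j)}(0)$ denotes the (one-sided) Peano derivative of order $j$ at $0$: the coefficients such that $\Phi(t)=\sum_{j=0}^{n}\frac{\Phi_{(j)}(0)}{j!}t^j+o(t^{n})$ for $t\to0+$, here with $n=2m_{HC}+1$. Grid function: $\phi(\tau)=(\phi_k(\tau))_{k\in\mathbb Z}$ with $\phi_k(\tau):=\|B_d(\tau)^k\|$ for $k\in\mathbb N_0$ and $\phi_k(\tau):=2-\phi_{-k}(\tau)$ for $k\in-\mathbb N$. $\Delta^j$ is the symmetric (central) finite difference of order $j$ on the integer grid, with the standard second-order accurate stencil: for even order, $[\Delta^{2q}\phi]_k=\sum_{i=0}^{2q}(-1)^i\binom{2q}{i}\phi_{k+q-i}$; for odd order, $[\Delta^{2q+1}\phi]_k=\frac12\left([\Delta^{2q}\phi]_{k+1}-[\Delta^{2q}\phi]_{k-1}\right)$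 (e.g. coefficients $-\frac12,0,\frac12$ for $j=1$ and $-\frac12,1,0,-1,\frac12$ for $j=3$). *)

theory Defs
  imports "HOL-Analysis.Analysis"
begin

text \<open>The norm axiom (inherited norm squared = inner product of a vector with itself)
  makes \<open>cinner\<close> positive definite; completeness comes from \<^class>\<open>banach\<close>.
  The inner product is conjugate-linear in its first argument.\<close>

class complex_hilbert = banach +
  fixes scaleC :: "complex \<Rightarrow> 'a \<Rightarrow> 'a" (infixr "*\<^sub>C" 75)
    and cinner :: "'a \<Rightarrow> 'a \<Rightarrow> complex"
  assumes scaleC_of_real: "of_real r *\<^sub>C x = r *\<^sub>R x"
    and scaleC_add_right: "a *\<^sub>C (x + y) = a *\<^sub>C x + a *\<^sub>C y"
    and scaleC_add_left: "(a + b) *\<^sub>C x = a *\<^sub>C x + b *\<^sub>C x"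
    and scaleC_scaleC: "a *\<^sub>C b *\<^sub>C x = (a * b) *\<^sub>C x"
    and cinner_commute: "cinner x y = cnj (cinner y x)"
    and cinner_add_right: "cinner x (y + z) = cinner x y + cinner x z"
    and cinner_scaleC_right: "cinner x (a *\<^sub>C y) = a * cinner x y"
    and cinner_self: "cinner x x = of_real ((norm x)\<^sup>2)"
    and nontrivial: "\<exists>x. x \<noteq> 0"

typedef (overloaded) 'a bop =
  "{A :: 'a::complex_hilbert \<Rightarrow>\<^sub>L 'a. \<forall>a x. blinfun_apply A (a *\<^sub>C x) = a *\<^sub>C blinfun_apply A x}"
  morphisms blinfun_of_bop Bop
proof
  have "a *\<^sub>C (0::'a) = 0" for a
    using scaleC_add_right[of a 0 0] by simp
  then show "0 \<in> {A :: 'a \<Rightarrow>\<^sub>L 'a. \<forall>a x. blinfun_apply A (a *\<^sub>C x) = a *\<^sub>C blinfun_apply A x}"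
    by simp
qed

setup_lifting type_definition_bop

lift_definition bop_apply :: "'a::complex_hilbert bop \<Rightarrow> 'a \<Rightarrow> 'a" is blinfun_apply .

declare [[coercion bop_apply]]

lemma scaleC_zero_right [simp]: "a *\<^sub>C (0::'a::complex_hilbert) = 0"
  using scaleC_add_right[of a 0 0] by simp

lemma scaleC_minus_right: "a *\<^sub>C (- x) = - (a *\<^sub>C (x::'a::complex_hilbert))"
  using scaleC_add_right[of a x "- x"] by (simp add: add_eq_0_iff)

lemma scaleC_diff_right: "a *\<^sub>C (x - y) = a *\<^sub>C x - a *\<^sub>C (y::'a::complex_hilbert)"
  using scaleC_add_right[of a x "- y"] by (simp add: scaleC_minus_right)

lemma scaleC_scaleR: "a *\<^sub>C r *\<^sub>R x = r *\<^sub>R a *\<^sub>C (x::'a::complex_hilbert)"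
  by (metis scaleC_of_real scaleC_scaleC mult.commute)

lemma cinner_scaleC_left: "cinner (a *\<^sub>C x) y = cnj a * cinner x (y::'a::complex_hilbert)"
  by (metis cinner_commute cinner_scaleC_right complex_cnj_mult)

lemma norm_scaleC: "norm (a *\<^sub>C x) = cmod a * norm (x::'a::complex_hilbert)"
proof -
  have "complex_of_real ((norm (a *\<^sub>C x))\<^sup>2) = cnj a * (a * cinner x x)"
    by (simp only: cinner_self[symmetric] cinner_scaleC_left cinner_scaleC_right mult.left_commute)
  also have "\<dots> = complex_of_real ((cmod a)\<^sup>2) * complex_of_real ((norm x)\<^sup>2)"
    by (simp only: cinner_self complex_norm_square mult_ac)
  finally have "(norm (a *\<^sub>C x))\<^sup>2 = (cmod a * norm x)\<^sup>2"
    by (metis of_real_eq_iff of_real_mult power_mult_distrib)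
  then show ?thesis
    by (simp add: power2_eq_iff_nonneg)
qed

lemma continuous_on_scaleC: "continuous_on UNIV (\<lambda>x::'a::complex_hilbert. a *\<^sub>C x)"
proof -
  have "bounded_linear (\<lambda>x::'a. a *\<^sub>C x)"
    by (rule bounded_linear_intro[where K = "cmod a"])
      (simp_all add: scaleC_add_right scaleC_scaleR norm_scaleC mult.commute)
  then show ?thesis
    by (rule linear_continuous_on)
qed

instantiation bop :: (complex_hilbert) real_normed_vector
begin

lift_definition zero_bop :: "'a bop" is 0 by simp
lift_definition plus_bop :: "'a bop \<Rightarrow> 'a bop \<Rightarrow> 'a bop" is "(+)"
  by (simp add: blinfun.add_left scaleC_add_right)
lift_definition minus_bop :: "'a bop \<Rightarrow> 'a bop \<Rightarrow> 'a bop" is "(-)"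
  by (simp add: blinfun.diff_left scaleC_diff_right)
lift_definition uminus_bop :: "'a bop \<Rightarrow> 'a bop" is uminus
  by (simp add: blinfun.minus_left scaleC_minus_right)
lift_definition scaleR_bop :: "real \<Rightarrow> 'a bop \<Rightarrow> 'a bop" is scaleR
  by (simp add: blinfun.scaleR_left scaleC_scaleR)
lift_definition norm_bop :: "'a bop \<Rightarrow> real" is norm .

definition dist_bop :: "'a bop \<Rightarrow> 'a bop \<Rightarrow> real"
  where "dist_bop A B = norm (A - B)"
definition [code del]:
  "(uniformity :: ('a bop \<times> 'a bop) filter) = (INF e\<in>{0 <..}. principal {(x, y). dist x y < e})"
definition open_bop :: "'a bop set \<Rightarrow> bool"
  where [code del]: "open_bop S = (\<forall>x\<in>S. \<forall>\<^sub>F (x', y) in uniformity. x' = x \<longrightarrow> y \<in> S)"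
definition sgn_bop :: "'a bop \<Rightarrow> 'a bop"
  where "sgn_bop A = inverse (norm A) *\<^sub>R A"

instance
proof
  fix A B C :: "'a bop" and r s :: real
  show "A + B + C = A + (B + C)" by transfer simp
  show "A + B = B + A" by transfer simp
  show "0 + A = A" by transfer simp
  show "- A + A = 0" by transfer simp
  show "A - B = A + - B" by transfer simp
  show "r *\<^sub>R (A + B) = r *\<^sub>R A + r *\<^sub>R B" by transfer (simp add: scaleR_add_right)
  show "(r + s) *\<^sub>R A = r *\<^sub>R A + s *\<^sub>R A" by transfer (simp add: scaleR_add_left)
  show "r *\<^sub>R s *\<^sub>R A = (r * s) *\<^sub>R A" by transfer simp
  show "1 *\<^sub>R A = A" by transfer simp
  show "norm A = 0 \<longleftrightarrow> A = 0" by transfer simp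
  show "norm (A + B) \<le> norm A + norm B" by transfer (rule norm_triangle_ineq)
  show "norm (r *\<^sub>R A) = \<bar>r\<bar> * norm A" by transfer simp
qed (simp_all add: dist_bop_def uniformity_bop_def open_bop_def sgn_bop_def)

end

instantiation bop :: (complex_hilbert) real_normed_algebra_1
begin

lift_definition one_bop :: "'a bop" is id_blinfun by simp
lift_definition times_bop :: "'a bop \<Rightarrow> 'a bop \<Rightarrow> 'a bop" is "(o\<^sub>L)" by simp

instance
proof
  fix A B C :: "'a bop" and r :: real
  show "A * B * C = A * (B * C)" by transfer (simp add: blinfun_eqI)
  show "(A + B) * C = A * C + B * C" by transfer (simp add: blinfun_eqI blinfun.add_left)
  show "A * (B + C) = A * B + A * C"
    by transfer (simp add: blinfun_eqI blinfun.add_left blinfun.add_right)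
  show "r *\<^sub>R A * B = r *\<^sub>R (A * B)" by transfer (simp add: blinfun_eqI blinfun.scaleR_left)
  show "A * r *\<^sub>R B = r *\<^sub>R (A * B)"
    by transfer (simp add: blinfun_eqI blinfun.scaleR_left blinfun.scaleR_right)
  show "1 * A = A" by transfer (simp add: blinfun_eqI)
  show "A * 1 = A" by transfer (simp add: blinfun_eqI)
  obtain x :: 'a where x: "x \<noteq> 0" using nontrivial by blast
  show "(0::'a bop) \<noteq> 1"
    using x by transfer (metis id_blinfun.rep_eq zero_blinfun.rep_eq)
  show "norm (A * B) \<le> norm A * norm B" by transfer (rule norm_blinfun_compose)
  show "norm (1::'a bop) = 1"
  proof transfer
    have "norm x \<le> norm (id_blinfun :: 'a \<Rightarrow>\<^sub>L 'a) * norm x"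
      using norm_blinfun[of id_blinfun x] by simp
    then have "1 \<le> norm (id_blinfun :: 'a \<Rightarrow>\<^sub>L 'a)" using x by simp
    moreover have "norm (id_blinfun :: 'a \<Rightarrow>\<^sub>L 'a) \<le> 1"
      by (rule norm_blinfun_bound) simp_all
    ultimately show "norm (id_blinfun :: 'a \<Rightarrow>\<^sub>L 'a) = 1" by simp
  qed
qed

end

instance bop :: (complex_hilbert) banach
proof
  fix X :: "nat \<Rightarrow> 'a bop"
  assume X: "Cauchy X"
  have dist_eq: "dist (blinfun_of_bop A) (blinfun_of_bop B) = dist A B" for A B :: "'a bop"
    unfolding dist_bop_def dist_norm by (simp add: norm_bop.rep_eq minus_bop.rep_eq)
  have "Cauchy (\<lambda>n. blinfun_of_bop (X n))"
    using X unfolding Cauchy_def dist_eq .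
  then obtain L where L: "(\<lambda>n. blinfun_of_bop (X n)) \<longlonglongrightarrow> L"
    using Cauchy_convergent convergent_def by blast
  have ap: "(\<lambda>n. blinfun_apply (blinfun_of_bop (X n)) x) \<longlonglongrightarrow> blinfun_apply L x" for x
    using L by (intro tendsto_intros)
  have "blinfun_apply L (a *\<^sub>C x) = a *\<^sub>C blinfun_apply L x" for a x
  proof (rule LIMSEQ_unique)
    show "(\<lambda>n. blinfun_apply (blinfun_of_bop (X n)) (a *\<^sub>C x)) \<longlonglongrightarrow> blinfun_apply L (a *\<^sub>C x)"
      by (rule ap)
    have "(\<lambda>n. a *\<^sub>C blinfun_apply (blinfun_of_bop (X n)) x) \<longlonglongrightarrow> a *\<^sub>C blinfun_apply L x"
      using continuous_on_tendsto_compose[OF continuous_on_scaleC[of a] ap[of x]] by simp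
    moreover have "blinfun_apply (blinfun_of_bop (X n)) (a *\<^sub>C x)
        = a *\<^sub>C blinfun_apply (blinfun_of_bop (X n)) x" for n
      using blinfun_of_bop[of "X n"] by simp
    ultimately show "(\<lambda>n. blinfun_apply (blinfun_of_bop (X n)) (a *\<^sub>C x)) \<longlonglongrightarrow> a *\<^sub>C blinfun_apply L x"
      by simp
  qed
  then have L_eq: "blinfun_of_bop (Bop L) = L"
    by (simp add: Bop_inverse)
  have "X \<longlonglongrightarrow> Bop L"
    using L unfolding tendsto_iff by (metis (no_types, lifting) L_eq dist_eq eventually_mono)
  then show "convergent X"
    by (rule convergentI)
qed

text \<open>The descriptions below are proper: the adjoint exists uniquely by the Riesz representation
  theorem, the nonnegative square root of a nonnegative operator exists uniquely, and a two-sided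
  inverse is unique. On a complex space \<open>nonneg_op\<close> already forces self-adjointness.\<close>

definition adj :: "'a::complex_hilbert bop \<Rightarrow> 'a bop" where
  "adj A = (THE C :: 'a bop. \<forall>x y. cinner (C x) y = cinner x (A y))"

definition nonneg_op :: "'a::complex_hilbert bop \<Rightarrow> bool" where
  "nonneg_op A \<longleftrightarrow> (\<forall>x. cinner x (A x) \<in> \<real> \<and> 0 \<le> Re (cinner x (A x)))"

definition op_sqrt :: "'a::complex_hilbert bop \<Rightarrow> 'a bop" where
  "op_sqrt A = (THE S. nonneg_op S \<and> S * S = A)"

definition op_inverse :: "'a::complex_hilbert bop \<Rightarrow> 'a bop" where
  "op_inverse A = (THE C. C * A = 1 \<and> A * C = 1)"

definition herm :: "'a::complex_hilbert bop \<Rightarrow> 'a bop" where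
  "herm A = (1 / 2) *\<^sub>R (A + adj A)"

definition semi_dissipative :: "'a::complex_hilbert bop \<Rightarrow> bool" where
  "semi_dissipative A \<longleftrightarrow> nonneg_op (herm (- A))"

definition hc_coercive :: "'a::complex_hilbert bop \<Rightarrow> nat \<Rightarrow> bool" where
  "hc_coercive B m \<longleftrightarrow>
     (\<exists>\<kappa>>0. nonneg_op ((\<Sum>j\<le>m. adj B ^ j * herm B * B ^ j) - \<kappa> *\<^sub>R 1))"

text \<open>Meaningful only if some \<open>m\<close> with \<open>hc_coercive B m\<close> exists.\<close>

definition hc_index :: "'a::complex_hilbert bop \<Rightarrow> nat" where
  "hc_index B = (LEAST m. hc_coercive B m)"

definition hc_inf :: "'a::complex_hilbert bop \<Rightarrow> nat \<Rightarrow> real \<Rightarrow> real" where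
  "hc_inf B m \<delta> =
     (INF y\<in>{y. norm y = 1 \<and> (\<forall>p<m. norm ((op_sqrt (herm B) * B ^ p) y) \<le> \<delta>)}.
        (norm ((op_sqrt (herm B) * B ^ m) y))\<^sup>2)"

definition prop_norm :: "'a::complex_hilbert bop \<Rightarrow> real \<Rightarrow> real" where
  "prop_norm B t = norm (exp (- (t *\<^sub>R B)))"

text \<open>\<open>D j\<close>, \<open>j \<le> n\<close>, are the one-sided Peano derivatives of \<open>f\<close> at \<open>0\<close> up to order \<open>n\<close>.
  These values are uniquely determined by the expansion.\<close>

definition has_peano_derivs :: "(real \<Rightarrow> real) \<Rightarrow> nat \<Rightarrow> (nat \<Rightarrow> real) \<Rightarrow> bool" where
  "has_peano_derivs f n D \<longleftrightarrow>
     (\<lambda>t. f t - (\<Sum>j\<le>n. D j / fact j * t ^ j)) \<in> o[at_right 0](\<lambda>t. t ^ n)"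

definition cayley :: "real \<Rightarrow> 'a::complex_hilbert bop \<Rightarrow> 'a bop" where
  "cayley \<tau> A = op_inverse (1 - (\<tau> / 2) *\<^sub>R A) * (1 + (\<tau> / 2) *\<^sub>R A)"

definition grid_norm :: "'a::complex_hilbert bop \<Rightarrow> real \<Rightarrow> int \<Rightarrow> real" where
  "grid_norm B \<tau> k =
     (if k \<ge> 0 then norm (cayley \<tau> (- B) ^ nat k)
      else 2 - norm (cayley \<tau> (- B) ^ nat (- k)))"

definition even_diff :: "nat \<Rightarrow> (int \<Rightarrow> real) \<Rightarrow> int \<Rightarrow> real" where
  "even_diff q f k = (\<Sum>i\<le>2 * q. (-1) ^ i * real (2 * q choose i) * f (k + int q - int i))"

definition central_diff :: "nat \<Rightarrow> (int \<Rightarrow> real) \<Rightarrow> int \<Rightarrow> real" where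
  "central_diff j f k =
     (if even j then even_diff (j div 2) f k
      else (even_diff (j div 2) f (k + 1) - even_diff (j div 2) f (k - 1)) / 2)"

end

theory Submission
  imports Defs
begin

text \<open>Write \<open>S\<close> for the square root of \<open>herm B\<close>. Since \<open>\<parallel>S x\<parallel>\<^sup>2\<close> is the real part of \<open>\<langle>x, B x\<rangle>\<close>, both
evolutions lose norm at a rate measured by \<open>S\<close>:
\<open>\<parallel>x\<parallel>\<^sup>2 - \<parallel>exp (- t B) x\<parallel>\<^sup>2\<close> is \<open>2 t\<close> times the integral of \<open>\<parallel>S exp (- s t B) x\<parallel>\<^sup>2\<close> over \<open>0 \<le> s \<le> 1\<close>,
and \<open>\<parallel>x\<parallel>\<^sup>2 - \<parallel>D\<^sup>n x\<parallel>\<^sup>2\<close>, where \<open>D\<close> is the Cayley transform with step \<open>t\<close>, is \<open>2 t\<close> times the sum of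
\<open>\<parallel>S R D\<^sup>j x\<parallel>\<^sup>2\<close> over \<open>j < n\<close>, where \<open>R\<close> is the inverse of \<open>1 + t B / 2\<close>
(lemmas \<open>semigroup_defect\<close> and \<open>cayley_defect\<close>). The distance of the propagator norm from \<open>1\<close> is to
leading order half of the smallest such defect over unit vectors.

The defect is a quadratic expression in the vectors \<open>t\<^sup>p S B\<^sup>p x\<close>. Below the index \<open>m\<close> the vectors
\<open>S B\<^sup>p x\<close> with \<open>p < m\<close> can be made simultaneously as small as desired, but then \<open>S B\<^sup>m x\<close> stays away from
zero, so the defect has order \<open>2 m + 1\<close>. Its coefficient is not just given by \<open>\<parallel>S B\<^sup>m x\<parallel>\<^sup>2\<close>, because a
perturbation of \<open>x\<close> by a multiple of \<open>t\<^sup>l B\<^sup>l x\<close> with \<open>l = m - p\<close> changes \<open>t\<^sup>p S B\<^sup>p x\<close> by a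
multiple of \<open>t\<^sup>m S B\<^sup>m x\<close>, and the minimizing perturbation has to be found. This is an extremal problem
for scalar polynomials of degree \<open>m\<close> with prescribed leading coefficient. For the integral over
\<open>[0, 1]\<close> the extremal polynomial is the Legendre polynomial, and the minimum is
\<open>1 / ((2 m + 1)! (2 m choose m))\<close>; for \<open>m + 1\<close> Cayley steps the extremal vector consists of alternating
binomial coefficients, and the minimum is \<open>1 / (2 m choose m)\<close>. The quotient of the two constants is
the factor \<open>(2 m + 1)!\<close> which relates a Taylor coefficient to a derivative, and so the same
\<open>c\<close> governs both sides.

Lemma \<open>norm_asymptotics\<close> turns matching lower and upper bounds for the defect into the asymptotics of
the norm. The bounds are \<open>semigroup_defect_lower\<close> and \<open>semigroup_defect_upper\<close> for the semigroup, and
\<open>cayley_defect_lower\<close> and \<open>cayley_defect_upper\<close> for the Cayley transform. For \<open>k \<le> m\<close> the defect of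
\<open>D\<^sup>k\<close> involves only \<open>S B\<^sup>p x\<close> with \<open>p < m\<close>, hence \<open>\<parallel>D\<^sup>k\<parallel> = 1\<close> for every step size
(\<open>norm_cayley_power_eq_one\<close>). The grid function is therefore constant on \<open>[- m, m]\<close>, and the central
differences see only its first deviation, at \<open>\<plusminus>(m + 1)\<close>.\<close>

section \<open>Operators and the real inner product\<close>

lemma bop_apply_zero [simp]: "bop_apply 0 x = 0" by transfer simp
lemma bop_apply_one [simp]: "bop_apply 1 x = x" by transfer simp
lemma bop_apply_add: "bop_apply (A + C) x = A x + C x" by transfer (simp add: blinfun.add_left)
lemma bop_apply_diff: "bop_apply (A - C) x = A x - C x" by transfer (simp add: blinfun.diff_left)
lemma bop_apply_minus: "bop_apply (- A) x = - A x" by transfer (simp add: blinfun.minus_left)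
lemma bop_apply_scaleR: "bop_apply (r *\<^sub>R A) x = r *\<^sub>R A x"
  by transfer (simp add: blinfun.scaleR_left)
lemma bop_apply_times: "bop_apply (A * C) x = A (C x)" by transfer simp
lemma bop_apply_add_right: "bop_apply A (x + y) = A x + A y" by transfer (simp add: blinfun.add_right)
lemma bop_apply_scaleR_right: "bop_apply A (r *\<^sub>R x) = r *\<^sub>R A x"
  by transfer (simp add: blinfun.scaleR_right)
lemma bop_apply_scaleC: "bop_apply A (a *\<^sub>C x) = a *\<^sub>C A x" by transfer simp
lemma norm_bop_apply: "norm (bop_apply A x) \<le> norm A * norm x" by transfer (rule norm_blinfun)

lemma norm_bop_le: "norm (A :: 'a::complex_hilbert bop) \<le> b" if "0 \<le> b" "\<And>x. norm (bop_apply A x) \<le> b * norm x"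
  using that by transfer (rule norm_blinfun_bound)

lemma bop_eqI: "A = C" if "\<And>x. bop_apply A x = bop_apply C x"
  using that by transfer (simp add: blinfun_eqI)

lemma bounded_bilinear_bop_apply: "bounded_bilinear bop_apply"
  by standard
    (auto simp: bop_apply_add bop_apply_add_right bop_apply_scaleR bop_apply_scaleR_right
      intro!: exI[of _ 1] norm_bop_apply)

interpretation bop_apply: bounded_bilinear bop_apply
  by (rule bounded_bilinear_bop_apply)

definition rinner :: "'a::complex_hilbert \<Rightarrow> 'a \<Rightarrow> real" where
  "rinner x y = Re (cinner x y)"

lemma cinner_add_left: "cinner (x + y) z = cinner x z + cinner y (z :: 'a::complex_hilbert)"
  by (metis cinner_commute cinner_add_right complex_cnj_add)

lemma rinner_commute: "rinner x y = rinner y x"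
  unfolding rinner_def by (subst cinner_commute) simp

lemma cinner_scaleR_right: "cinner x (r *\<^sub>R y) = of_real r * cinner x (y :: 'a::complex_hilbert)"
  by (metis cinner_scaleC_right scaleC_of_real)

lemma rinner_add_right: "rinner x (y + z) = rinner x y + rinner x z"
  by (simp add: rinner_def cinner_add_right)

lemma rinner_scaleR_right: "rinner x (r *\<^sub>R y) = r * rinner x y"
  by (simp add: rinner_def cinner_scaleR_right)

lemma rinner_self: "rinner x x = (norm x)\<^sup>2"
  by (simp add: rinner_def cinner_self flip: of_real_power)

lemma cinner_eq_rinner: "cinner x y = Complex (rinner x y) (- rinner x (\<i> *\<^sub>C y))"
  by (simp add: rinner_def cinner_scaleC_right complex_eq_iff)

lemma quadratic_nonneg_imp_zero:
  fixes c d :: real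
  assumes "\<And>r. 0 \<le> 2 * r * c + r\<^sup>2 * d"
  shows "c = 0"
proof -
  have d: "0 \<le> d" using assms[of 1] assms[of "-1"] by simp
  define e where "e = c / (d + 1)"
  have c: "c = e * (d + 1)" using d by (simp add: e_def)
  have "0 \<le> 2 * (- e) * c + (- e)\<^sup>2 * d" by (rule assms)
  also have "\<dots> = - (e\<^sup>2 * (d + 2))"
    by (simp add: c power2_eq_square algebra_simps)
  finally have "e = 0" using d by (simp add: mult_le_0_iff)
  then show ?thesis by (simp add: c)
qed

text \<open>Stated for semidefinite forms in order to cover both the inner product and the form \<open>\<langle>x, A y\<rangle>\<close> of a
nonnegative operator.\<close>

lemma semidefinite_Cauchy_Schwarz:
  fixes b :: "'v::real_vector \<Rightarrow> 'v \<Rightarrow> real"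
  assumes add: "\<And>x y z. b x (y + z) = b x y + b x z"
    and scale: "\<And>x r y. b x (r *\<^sub>R y) = r * b x y"
    and sym: "\<And>x y. b x y = b y x"
    and nonneg: "\<And>x. 0 \<le> b x x"
  shows "(b x y)\<^sup>2 \<le> b x x * b y y"
proof -
  have expand: "b (x + r *\<^sub>R y) (x + r *\<^sub>R y) = b x x + 2 * r * b x y + r\<^sup>2 * b y y" for r
  proof -
    have "b (x + r *\<^sub>R y) z = b x z + r * b y z" for z
      by (metis add scale sym)
    then show ?thesis
      using sym[of y x] by (simp add: add scale power2_eq_square algebra_simps)
  qed
  show ?thesis
  proof (cases "b y y = 0")
    case True
    have "b x y = 0"
    proof (rule ccontr)
      assume "b x y \<noteq> 0"
      then show False
        using nonneg[of "x + (- (b x x + 1) / (2 * b x y)) *\<^sub>R y"] True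
        unfolding expand by (simp add: field_simps)
    qed
    then show ?thesis using True by simp
  next
    case False
    then have pos: "0 < b y y" using nonneg[of y] by simp
    have "0 \<le> b x x + 2 * (- b x y / b y y) * b x y + (- b x y / b y y)\<^sup>2 * b y y"
      unfolding expand[symmetric] by (rule nonneg)
    also have "\<dots> = b x x - (b x y)\<^sup>2 / b y y"
      using pos by (simp add: power2_eq_square field_simps)
    finally show ?thesis using pos by (simp add: field_simps)
  qed
qed

lemma rinner_Cauchy_Schwarz: "\<bar>rinner x y\<bar> \<le> norm x * norm y"
proof -
  have "(rinner x y)\<^sup>2 \<le> rinner x x * rinner y y"
    by (rule semidefinite_Cauchy_Schwarz)
      (simp_all add: rinner_add_right rinner_scaleR_right rinner_commute rinner_self)
  then have "\<bar>rinner x y\<bar>\<^sup>2 \<le> (norm x * norm y)\<^sup>2"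
    by (simp add: rinner_self power_mult_distrib)
  then show ?thesis
    by (rule power2_le_imp_le) simp
qed

interpretation rinner: bounded_bilinear rinner
proof
  show "rinner (a + a') b = rinner a b + rinner a' b" for a a' b :: 'a
    by (metis rinner_commute rinner_add_right)
  show "rinner (r *\<^sub>R a) b = r *\<^sub>R rinner a b" for r and a b :: 'a
    by (metis rinner_commute rinner_scaleR_right real_scaleR_def)
  show "\<exists>K. \<forall>a b :: 'a. norm (rinner a b) \<le> norm a * norm b * K"
    by (rule exI[of _ 1]) (simp add: rinner_Cauchy_Schwarz)
qed (simp_all add: rinner_add_right rinner_scaleR_right)

lemma norm_add_power2: "(norm (x + y))\<^sup>2 = (norm x)\<^sup>2 + 2 * rinner x y + (norm (y :: 'a::complex_hilbert))\<^sup>2"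
  using rinner_commute[of y x]
  by (simp add: rinner_self[symmetric] rinner.add_left rinner.add_right)

lemma norm_diff_power2: "(norm (x - y))\<^sup>2 = (norm x)\<^sup>2 - 2 * rinner x y + (norm (y :: 'a::complex_hilbert))\<^sup>2"
  using rinner_commute[of y x]
  by (simp add: rinner_self[symmetric] rinner.diff_left rinner.diff_right)

lemma rinner_eqD: "x = y" if "\<And>z. rinner x z = rinner y z"
proof -
  have "rinner (x - y) (x - y) = 0" by (simp add: rinner.diff_left that)
  then show ?thesis by (simp add: rinner_self)
qed

section \<open>Adjoints and Hermitian parts\<close>

text \<open>The representing vector minimizes \<open>\<parallel>u\<parallel>\<^sup>2 - 2 f u\<close>. Minimizing sequences are Cauchy by the
parallelogram law, and at the minimum the first variation vanishes.\<close>

lemma riesz_representation: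
  fixes f :: "'a::complex_hilbert \<Rightarrow> real"
  assumes "bounded_linear f"
  shows "\<exists>u. \<forall>y. rinner u y = f y"
proof -
  interpret f: bounded_linear f by (rule assms)
  obtain K where K: "\<And>x. norm (f x) \<le> norm x * K" using f.bounded by blast
  define J where "J u = (norm u)\<^sup>2 - 2 * f u" for u
  have J_expand: "J (u + y) = J u + 2 * (rinner u y - f y) + (norm y)\<^sup>2" for u y
    by (simp add: J_def norm_add_power2 f.add)
  have "- (K\<^sup>2) \<le> J u" for u
  proof -
    have "f u \<le> norm u * K" using K[of u] by (simp add: abs_le_iff)
    moreover have "0 \<le> (norm u - K)\<^sup>2" by simp
    ultimately show ?thesis by (simp add: J_def power2_diff)
  qed
  then have bdd: "bdd_below (range J)" by (rule bdd_belowI2)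
  define I where "I = (INF u. J u)"
  have I_le: "I \<le> J u" for u unfolding I_def by (rule cINF_lower[OF bdd]) simp
  have "\<exists>u. J u < I + inverse (real (Suc n))" for n
    using cINF_less_iff[OF _ bdd, of "I + inverse (real (Suc n))"] by (auto simp: I_def)
  then obtain u where u: "\<And>n. J (u n) < I + inverse (real (Suc n))" by metis
  have para: "(norm (u i - u j))\<^sup>2 \<le> 2 * (inverse (real (Suc i)) + inverse (real (Suc j)))" for i j
  proof -
    have half: "(norm ((1/2) *\<^sub>R v))\<^sup>2 = (norm v)\<^sup>2 / 4" for v :: 'a
      by (simp add: power_divide)
    have f_half: "f ((1/2) *\<^sub>R v) = f v / 2" for v
      by (simp add: f.scaleR)
    have "4 * J ((1/2) *\<^sub>R (u i + u j)) = (norm (u i + u j))\<^sup>2 - 4 * (f (u i) + f (u j))"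
      by (simp add: J_def half f_half f.add right_diff_distrib power_divide add_divide_distrib del: scaleR_add_right)
    moreover have "(norm (u i - u j))\<^sup>2 + (norm (u i + u j))\<^sup>2 = 2 * (norm (u i))\<^sup>2 + 2 * (norm (u j))\<^sup>2"
      by (simp add: norm_add_power2 norm_diff_power2)
    ultimately have "(norm (u i - u j))\<^sup>2 = 2 * J (u i) + 2 * J (u j) - 4 * J ((1/2) *\<^sub>R (u i + u j))"
      by (simp add: J_def)
    then show ?thesis using u[of i] u[of j] I_le[of "(1/2) *\<^sub>R (u i + u j)"] by simp
  qed
  have "Cauchy u"
  proof (rule metric_CauchyI)
    fix e :: real assume "0 < e"
    then obtain N where N: "inverse (real (Suc N)) < e\<^sup>2 / 4"
      using reals_Archimedean[of "e\<^sup>2 / 4"] by auto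
    have "dist (u i) (u j) < e" if "N \<le> i" "N \<le> j" for i j
    proof -
      have "(norm (u i - u j))\<^sup>2 \<le> 2 * (inverse (real (Suc i)) + inverse (real (Suc j)))"
        by (rule para)
      also have "\<dots> \<le> 2 * (inverse (real (Suc N)) + inverse (real (Suc N)))"
        using that by (intro mult_left_mono add_mono le_imp_inverse_le) auto
      also have "\<dots> < e\<^sup>2" using N by simp
      finally have "(norm (u i - u j))\<^sup>2 < e\<^sup>2" .
      then show ?thesis
        using \<open>0 < e\<close> by (simp add: dist_norm power2_less_imp_less)
    qed
    then show "\<exists>M. \<forall>i\<ge>M. \<forall>j\<ge>M. dist (u i) (u j) < e" by blast
  qed
  then obtain w where w: "u \<longlonglongrightarrow> w" using Cauchy_convergent convergent_def by blast
  have "(\<lambda>n. J (u n)) \<longlonglongrightarrow> J w"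
    unfolding J_def by (intro tendsto_intros w f.tendsto)
  moreover have "(\<lambda>n. I + inverse (real (Suc n))) \<longlonglongrightarrow> I + 0"
    by (intro tendsto_intros LIMSEQ_inverse_real_of_nat)
  ultimately have "J w \<le> I + 0"
    by (rule LIMSEQ_le) (use u less_imp_le in blast)
  then have Jw: "J w \<le> J v" for v using I_le[of v] by simp
  have "rinner w y - f y = 0" for y
  proof (rule quadratic_nonneg_imp_zero[where d = "(norm y)\<^sup>2"])
    fix r
    show "0 \<le> 2 * r * (rinner w y - f y) + r\<^sup>2 * (norm y)\<^sup>2"
      using Jw[of "w + r *\<^sub>R y"]
      by (simp add: J_expand rinner.scaleR_right f.scaleR power_mult_distrib algebra_simps)
  qed
  then show ?thesis by (intro exI[of _ w]) simp
qed

text \<open>The real functional \<open>y \<mapsto> Re \<langle>x, A y\<rangle>\<close> has a Riesz vector, and complex linearity of \<open>A\<close> upgrades the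
identity of real parts to one of complex numbers.\<close>

lemma cinner_adj:
  fixes A :: "'a::complex_hilbert bop"
  shows "cinner (adj A x) y = cinner x (A y)"
proof -
  have "\<exists>u. \<forall>y. rinner u y = rinner x (A y)" for x
    by (rule riesz_representation)
      (intro bounded_linear_compose[OF rinner.bounded_linear_right bop_apply.bounded_linear_right])
  then obtain c where c: "\<And>x y. rinner (c x) y = rinner x (A y)" by metis
  have cc: "cinner (c x) y = cinner x (A y)" for x y
    by (simp add: cinner_eq_rinner c bop_apply_scaleC)
  have lin: "bounded_linear c"
  proof (rule bounded_linear_intro)
    show "c (x + y) = c x + c y" for x y
      by (rule rinner_eqD) (simp add: c rinner.add_left)
    show "c (r *\<^sub>R x) = r *\<^sub>R c x" for r x
      by (rule rinner_eqD) (simp add: c rinner.scaleR_left)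
    show "norm (c x) \<le> norm x * norm A" for x
    proof (cases "c x = 0")
      case False
      have "(norm (c x))\<^sup>2 = rinner x (A (c x))" by (simp add: c flip: rinner_self)
      also have "\<dots> \<le> norm x * (norm A * norm (c x))"
        using rinner_Cauchy_Schwarz[of x "A (c x)"] norm_bop_apply[of A "c x"]
        by (meson abs_le_D1 mult_left_mono norm_ge_zero order_trans)
      finally show ?thesis using False by (simp add: power2_eq_square)
    qed simp
  qed
  have "c (a *\<^sub>C x) = a *\<^sub>C c x" for a x
  proof (rule rinner_eqD)
    fix z
    have "cinner (c (a *\<^sub>C x)) z = cinner (a *\<^sub>C c x) z"
      by (simp add: cc cinner_scaleC_left)
    then show "rinner (c (a *\<^sub>C x)) z = rinner (a *\<^sub>C c x) z" by (simp add: rinner_def)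
  qed
  then have "bop_apply (Bop (Blinfun c)) = c"
    by (simp add: bop_apply.rep_eq Bop_inverse bounded_linear_Blinfun_apply[OF lin] fun_eq_iff)
  then have ex: "\<forall>x y. cinner (bop_apply (Bop (Blinfun c)) x) y = cinner x (A y)" by (simp add: cc)
  have "\<forall>x y. cinner (adj A x) y = cinner x (A y)"
    unfolding adj_def
  proof (rule theI)
    show "\<forall>x y. cinner (bop_apply (Bop (Blinfun c)) x) y = cinner x (A y)" by (rule ex)
    show "C = Bop (Blinfun c)" if "\<forall>x y. cinner (bop_apply C x) y = cinner x (A y)" for C
      by (rule bop_eqI, rule rinner_eqD) (simp add: rinner_def that ex)
  qed
  then show ?thesis by blast
qed

lemma rinner_herm:
  fixes B :: "'a::complex_hilbert bop"
  shows "rinner x (herm B x) = rinner x (B x)"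
proof -
  have "rinner x (adj B x) = rinner x (B x)"
    by (subst rinner_commute) (simp add: rinner_def cinner_adj)
  then show ?thesis
    by (simp add: herm_def bop_apply_scaleR bop_apply_add rinner.add_right rinner.scaleR_right)
qed

lemma nonneg_op_rinner: "nonneg_op A \<Longrightarrow> 0 \<le> rinner x (bop_apply A x)"
  by (simp add: nonneg_op_def rinner_def)

text \<open>Polarization: reality of the quadratic form at \<open>x + y\<close> and at \<open>x + i y\<close> gives the imaginary and the
real part.\<close>

lemma nonneg_op_selfadjoint:
  fixes A :: "'a::complex_hilbert bop"
  assumes "nonneg_op A"
  shows "cinner x (A y) = cinner (A x) y"
proof -
  have im: "Im (cinner z (A z)) = 0" for z
    using assms by (simp add: nonneg_op_def complex_is_Real_iff)
  have "cinner x (A y) = cnj (cinner y (A x))"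
  proof (rule complex_eqI)
    show "Im (cinner x (A y)) = Im (cnj (cinner y (A x)))"
      using im[of "x + y"] im[of x] im[of y]
      by (simp add: bop_apply.add_right cinner_add_left cinner_add_right)
    show "Re (cinner x (A y)) = Re (cnj (cinner y (A x)))"
      using im[of "x + \<i> *\<^sub>C y"] im[of x] im[of y]
      by (simp add: bop_apply.add_right bop_apply_scaleC cinner_add_left cinner_add_right
          cinner_scaleC_left cinner_scaleC_right)
  qed
  then show ?thesis by (metis cinner_commute)
qed

lemma nonneg_op_rinner_selfadjoint: "nonneg_op A \<Longrightarrow> rinner x (bop_apply A y) = rinner (bop_apply A x) y"
  by (simp add: rinner_def nonneg_op_selfadjoint)

lemma nonneg_opI:
  fixes A :: "'a::complex_hilbert bop"
  assumes sym: "\<And>x y. rinner x (A y) = rinner (A x) y" and nonneg: "\<And>x. 0 \<le> rinner x (A x)"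
  shows "nonneg_op A"
proof -
  have "cinner x (A y) = cinner (A x) y" for x y
    by (simp add: cinner_eq_rinner sym flip: bop_apply_scaleC)
  then have "cinner x (A x) = cnj (cinner x (A x))" for x
    by (metis cinner_commute)
  then show ?thesis
    using nonneg by (simp add: nonneg_op_def rinner_def Reals_cnj_iff)
qed

lemma nonneg_op_Cauchy_Schwarz:
  fixes A :: "'a::complex_hilbert bop"
  assumes A: "nonneg_op A"
  shows "(rinner x (A y))\<^sup>2 \<le> rinner x (A x) * rinner y (A y)"
proof (rule semidefinite_Cauchy_Schwarz)
  show "rinner x (A y) = rinner y (A x)" for x y
    by (subst nonneg_op_rinner_selfadjoint[OF A]) (rule rinner_commute)
qed (simp_all add: nonneg_op_rinner[OF A] bop_apply.add_right bop_apply.scaleR_right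
    rinner.add_right rinner.scaleR_right)

lemma norm_nonneg_op_le_one:
  fixes A :: "'a::complex_hilbert bop"
  assumes A: "nonneg_op A" and le: "\<And>x. rinner x (A x) \<le> (norm x)\<^sup>2"
  shows "norm A \<le> 1"
proof (rule norm_bop_le)
  fix x
  have "(rinner (A x) (A x))\<^sup>2 \<le> rinner (A x) (A (A x)) * rinner x (A x)"
    by (rule nonneg_op_Cauchy_Schwarz[OF A])
  also have "\<dots> \<le> (norm (A x))\<^sup>2 * (norm x)\<^sup>2"
    using nonneg_op_rinner[OF A] by (intro mult_mono le) auto
  finally have "(norm (A x))\<^sup>2 \<le> norm (A x) * norm x"
    unfolding rinner_self power_mult_distrib[symmetric] by (rule power2_le_imp_le) simp
  then show "norm (A x) \<le> 1 * norm x"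
    by (cases "A x = 0") (auto simp: power2_eq_square)
qed simp

section \<open>Inverses and square roots\<close>

lemma neumann_inverse:
  fixes X :: "'b::{real_normed_algebra_1,banach}"
  assumes "norm X < 1"
  shows "\<exists>Y. Y * (1 - X) = 1 \<and> (1 - X) * Y = 1"
proof -
  have sum: "summable (\<lambda>n. X ^ n)"
  proof (rule summable_norm_cancel, rule summable_comparison_test')
    show "summable (\<lambda>n. norm X ^ n)" using assms by (simp add: summable_geometric)
  qed (simp add: norm_power_ineq)
  define Y where "Y = (\<Sum>n. X ^ n)"
  have "(\<Sum>n. X ^ Suc n) = Y - 1"
    unfolding Y_def using suminf_split_head[OF sum] by (simp only: power_0)
  moreover have "X * Y = (\<Sum>n. X ^ Suc n)"
    unfolding Y_def by (simp only: suminf_mult[OF sum, symmetric] power_Suc)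
  moreover have "Y * X = (\<Sum>n. X ^ Suc n)"
    unfolding Y_def by (simp only: suminf_mult2[OF sum] power_Suc2)
  ultimately show ?thesis
    by (intro exI[of _ Y]) (simp add: left_diff_distrib right_diff_distrib)
qed

text \<open>Coercivity makes \<open>1 - \<epsilon> A\<close> a strict contraction for small \<open>\<epsilon> > 0\<close>, so \<open>\<epsilon> A\<close> is inverted by a Neumann
series. Applied to \<open>1 + t B / 2\<close>, this makes the Cayley transform available at every step size.\<close>

lemma coercive_op_inverse:
  fixes A :: "'a::complex_hilbert bop"
  assumes coercive: "\<And>x. (norm x)\<^sup>2 \<le> rinner x (A x)"
  shows "op_inverse A * A = 1" "A * op_inverse A = 1"
proof -
  define \<epsilon> where "\<epsilon> = 1 / (1 + (norm A)\<^sup>2)"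
  have \<epsilon>: "0 < \<epsilon>" "\<epsilon> * (norm A)\<^sup>2 \<le> 1" "\<epsilon> \<le> 1"
    by (auto simp: \<epsilon>_def field_simps add_pos_nonneg)
  have bound: "(norm ((1 - \<epsilon> *\<^sub>R A) x))\<^sup>2 \<le> (1 - \<epsilon>) * (norm x)\<^sup>2" for x
  proof -
    have "(norm ((1 - \<epsilon> *\<^sub>R A) x))\<^sup>2 = (norm x)\<^sup>2 - 2 * \<epsilon> * rinner x (A x) + \<epsilon>\<^sup>2 * (norm (A x))\<^sup>2"
      by (simp add: bop_apply_diff bop_apply_scaleR norm_diff_power2 rinner.scaleR_right power_mult_distrib)
    also have "\<dots> \<le> (norm x)\<^sup>2 - 2 * \<epsilon> * (norm x)\<^sup>2 + \<epsilon>\<^sup>2 * (norm A * norm x)\<^sup>2"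
      using coercive[of x] \<epsilon> norm_bop_apply[of A x]
      by (intro add_mono diff_mono mult_left_mono power_mono) auto
    also have "\<dots> = (norm x)\<^sup>2 - 2 * \<epsilon> * (norm x)\<^sup>2 + \<epsilon> * (\<epsilon> * (norm A)\<^sup>2) * (norm x)\<^sup>2"
      by (simp add: power_mult_distrib power2_eq_square)
    also have "\<dots> \<le> (norm x)\<^sup>2 - 2 * \<epsilon> * (norm x)\<^sup>2 + \<epsilon> * 1 * (norm x)\<^sup>2"
      using \<epsilon> by (intro add_left_mono mult_right_mono mult_left_mono) auto
    finally show ?thesis by (simp add: algebra_simps)
  qed
  have "norm (1 - \<epsilon> *\<^sub>R A) \<le> sqrt (1 - \<epsilon>)"
  proof (rule norm_bop_le)
    fix x
    show "norm ((1 - \<epsilon> *\<^sub>R A) x) \<le> sqrt (1 - \<epsilon>) * norm x"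
      using real_le_rsqrt[OF bound[of x]] \<epsilon> by (simp add: real_sqrt_mult)
  qed (use \<epsilon> in simp)
  also have "\<dots> < 1" using \<epsilon> by simp
  finally obtain Y where "Y * (\<epsilon> *\<^sub>R A) = 1" "(\<epsilon> *\<^sub>R A) * Y = 1"
    using neumann_inverse[of "1 - \<epsilon> *\<^sub>R A"] by auto
  then have Y: "(\<epsilon> *\<^sub>R Y) * A = 1" "A * (\<epsilon> *\<^sub>R Y) = 1" by simp_all
  have "op_inverse A * A = 1 \<and> A * op_inverse A = 1"
    unfolding op_inverse_def
  proof (rule theI)
    show "(\<epsilon> *\<^sub>R Y) * A = 1 \<and> A * (\<epsilon> *\<^sub>R Y) = 1" using Y by blast
    show "C = \<epsilon> *\<^sub>R Y" if "C * A = 1 \<and> A * C = 1" for C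
      using that Y by (metis mult.assoc mult_1_left mult_1_right)
  qed
  then show "op_inverse A * A = 1" "A * op_inverse A = 1" by auto
qed

text \<open>These are the Taylor coefficients of \<open>sqrt (1 - z)\<close>.\<close>

definition sqrt_coeff :: "nat \<Rightarrow> real" where
  "sqrt_coeff n = (-1) ^ n * ((1/2) gchoose n)"

text \<open>The alternating sums of binomial coefficients telescope to a single one, whose sign is visible. All
coefficients except the first being nonpositive, this one estimate gives both absolute summability
and the positivity of the square root built from them.\<close>

lemma sqrt_coeff_partial_sum_nonneg: "0 \<le> (\<Sum>k\<le>n. sqrt_coeff k)"
proof -
  have "(\<Sum>k\<le>n. sqrt_coeff k) = (-1) ^ n * ((-1/2) gchoose n)"
    using gbinomial_sum_lower_neg[of "1/2::real" n] by (simp add: sqrt_coeff_def mult.commute)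
  also have "\<dots> = (\<Prod>i<n. (1/2 + real i)) / fact n"
  proof -
    have "(\<Prod>i<n. (1/2 + real i)) = (\<Prod>i<n. (-1) * (-1/2 - real i))"
      by (intro prod.cong) auto
    also have "\<dots> = (-1) ^ n * (\<Prod>i<n. (-1/2 - real i))"
      by (simp only: prod.distrib prod_constant card_lessThan)
    finally show ?thesis by (simp only: gbinomial_prod_rev atLeast0LessThan times_divide_eq_right)
  qed
  also have "\<dots> \<ge> 0" by (intro divide_nonneg_nonneg prod_nonneg) auto
  finally show ?thesis .
qed

lemma sqrt_coeff_nonpos: "sqrt_coeff (Suc n) \<le> 0"
proof -
  have "sqrt_coeff (Suc n) = - ((1/2) / real (Suc n)) * ((-1) ^ n * ((-1/2) gchoose n))"
    using gbinomial_absorption'[of "Suc n" "1/2::real"] by (simp add: sqrt_coeff_def)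
  also have "(-1) ^ n * ((-1/2) gchoose n) = (\<Sum>k\<le>n. sqrt_coeff k)"
    using gbinomial_sum_lower_neg[of "1/2::real" n] by (simp add: sqrt_coeff_def mult.commute)
  finally show ?thesis
    using sqrt_coeff_partial_sum_nonneg[of n] by (simp add: mult_nonpos_nonneg)
qed

lemma sqrt_coeff_abs_partial_sum: "(\<Sum>k\<le>n. \<bar>sqrt_coeff k\<bar>) \<le> 2"
proof -
  have split: "(\<Sum>k\<le>n. g k) = g 0 + (\<Sum>k=1..n. g k)" for g :: "nat \<Rightarrow> real"
    using sum.atLeast_Suc_atMost[of 0 n g] by (simp add: atLeast0AtMost)
  have "(\<Sum>k=1..n. \<bar>sqrt_coeff k\<bar>) = - (\<Sum>k=1..n. sqrt_coeff k)"
    unfolding sum_negf[symmetric]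
    by (intro sum.cong) (use sqrt_coeff_nonpos in \<open>auto simp: Suc_le_eq gr0_conv_Suc\<close>)
  then show ?thesis
    using sqrt_coeff_partial_sum_nonneg[of n] split[of "\<lambda>k. \<bar>sqrt_coeff k\<bar>"] split[of sqrt_coeff]
    by (simp add: sqrt_coeff_def)
qed

lemma sqrt_coeff_summable: "summable (\<lambda>n. \<bar>sqrt_coeff n\<bar>)"
proof (rule summableI_nonneg_bounded)
  show "(\<Sum>i<n. \<bar>sqrt_coeff i\<bar>) \<le> 2" for n
    using sqrt_coeff_abs_partial_sum[of n] sum_mono2[of "{..n}" "{..<n}" "\<lambda>k. \<bar>sqrt_coeff k\<bar>"]
    by fastforce
qed simp

lemma sqrt_coeff_Cauchy_product:
  "(\<Sum>i\<le>n. sqrt_coeff i * sqrt_coeff (n - i)) = (if n = 0 then 1 else if n = 1 then -1 else 0)"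
proof -
  have "(\<Sum>i\<le>n. sqrt_coeff i * sqrt_coeff (n - i))
      = (-1) ^ n * (\<Sum>i=0..n. ((1/2) gchoose i) * ((1/2) gchoose (n - i)))"
    unfolding sum_distrib_left atLeast0AtMost
    by (intro sum.cong) (auto simp: sqrt_coeff_def power_add[symmetric])
  also have "\<dots> = (-1) ^ n * ((1 :: real) gchoose n)"
    using gbinomial_Vandermonde[of "1/2::real" "1/2" n] by simp
  also have "(1 :: real) gchoose n = real (1 choose n)"
    using binomial_gbinomial[of 1 n, where ?'a = real] by simp
  finally show ?thesis by (cases "n \<le> 1") (auto simp: le_Suc_eq)
qed

text \<open>After scaling, \<open>H = c (1 - T)\<close> with \<open>0 \<le> T \<le> 1\<close>, and the power series of \<open>sqrt (1 - z)\<close> converges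
absolutely at \<open>z = T\<close>. Being a limit of polynomials in \<open>H\<close>, the root commutes with everything that
commutes with \<open>H\<close>, which is what the uniqueness proof needs.\<close>

lemma nonneg_op_sqrt_exists:
  fixes H :: "'a::complex_hilbert bop"
  assumes H: "nonneg_op H"
  shows "\<exists>S. nonneg_op S \<and> S * S = H \<and> (\<forall>X. X * H = H * X \<longrightarrow> X * S = S * X)"
proof -
  define c where "c = norm H + 1"
  have c: "0 < c" by (simp add: c_def add_nonneg_pos)
  define T where "T = 1 - (1 / c) *\<^sub>R H"
  have T_apply: "T x = x - (1 / c) *\<^sub>R H x" for x
    by (simp add: T_def bop_apply_diff bop_apply_scaleR)
  have T_sym: "rinner x (T y) = rinner (T x) y" for x y
    by (simp add: T_apply rinner.diff_right rinner.diff_left rinner.scaleR_left rinner.scaleR_right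
        nonneg_op_rinner_selfadjoint[OF H])
  have rT: "rinner x (T x) = (norm x)\<^sup>2 - rinner x (H x) / c" for x
    by (simp add: T_apply rinner.diff_right rinner.scaleR_right rinner_self)
  have "nonneg_op T"
  proof (rule nonneg_opI[OF T_sym])
    fix x
    have "rinner x (H x) \<le> norm x * (norm H * norm x)"
      using rinner_Cauchy_Schwarz[of x "H x"] norm_bop_apply[of H x]
      by (meson abs_le_D1 mult_left_mono norm_ge_zero order_trans)
    also have "\<dots> \<le> c * (norm x)\<^sup>2"
      by (simp add: c_def power2_eq_square algebra_simps)
    finally show "0 \<le> rinner x (T x)"
      using c by (simp add: rT field_simps)
  qed
  then have nT: "norm T \<le> 1"
    by (rule norm_nonneg_op_le_one) (use nonneg_op_rinner[OF H] c in \<open>simp add: rT\<close>)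
  have nTn: "norm (T ^ n) \<le> 1" for n
    using norm_power_ineq[of T n] power_le_one[OF norm_ge_zero nT] by (rule order_trans)
  define f where "f n = sqrt_coeff n *\<^sub>R T ^ n" for n
  have sf: "summable (\<lambda>n. norm (f n))"
    by (rule summable_comparison_test'[OF sqrt_coeff_summable, of 0])
      (use nTn in \<open>auto simp: f_def intro: mult_left_le\<close>)
  note sf' = summable_norm_cancel[OF sf]
  define W where "W = (\<Sum>n. f n)"
  have "W * W = (\<Sum>k. \<Sum>i\<le>k. f i * f (k - i))"
    unfolding W_def by (rule Cauchy_product[OF sf sf])
  also have "\<dots> = (\<Sum>k. (if k = 0 then 1 else if k = 1 then -1 else 0) *\<^sub>R T ^ k)"
    by (simp add: f_def power_add[symmetric] scaleR_sum_left[symmetric] sqrt_coeff_Cauchy_product mult.commute)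
  also have "\<dots> = (\<Sum>k\<in>{0,1}. (if k = 0 then 1 else if k = 1 then -1 else 0) *\<^sub>R T ^ k)"
    by (rule suminf_finite) auto
  also have "\<dots> = (1 / c) *\<^sub>R H" by (simp add: T_def)
  finally have WW: "W * W = (1 / c) *\<^sub>R H" .
  have rW: "(\<lambda>n. sqrt_coeff n * rinner x ((T ^ n) y)) sums rinner x (W y)" for x y
  proof -
    have "bounded_linear (\<lambda>A. rinner x (bop_apply A y))"
      by (intro bounded_linear_compose[OF rinner.bounded_linear_right bop_apply.bounded_linear_left])
    from bounded_linear.sums[OF this summable_sums[OF sf']]
    show ?thesis by (simp add: W_def f_def bop_apply_scaleR rinner.scaleR_right)
  qed
  have Tn_sym: "rinner x ((T ^ n) y) = rinner ((T ^ n) x) y" for n x y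
  proof (induction n arbitrary: x y)
    case (Suc n)
    have "rinner x ((T ^ Suc n) y) = rinner x ((T ^ n) (T y))"
      by (simp only: power_Suc2 bop_apply_times)
    also have "\<dots> = rinner (T ((T ^ n) x)) y" by (simp only: Suc T_sym)
    finally show ?case by (simp only: power_Suc bop_apply_times)
  qed (simp only: power_0 bop_apply_one)
  have W: "nonneg_op W"
  proof (rule nonneg_opI)
    fix x y
    have "rinner y ((T ^ n) x) = rinner x ((T ^ n) y)" for n
      by (subst Tn_sym) (rule rinner_commute)
    then have "rinner x (W y) = rinner y (W x)"
      using sums_unique2[OF rW[of x y]] rW[of y x] by simp
    then show "rinner x (W y) = rinner (W x) y" by (metis rinner_commute)
  next
    show "0 \<le> rinner x (W x)" for x
    proof (rule LIMSEQ_le_const)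
      show "(\<lambda>N. \<Sum>n\<le>N. sqrt_coeff n * rinner x ((T ^ n) x)) \<longlonglongrightarrow> rinner x (W x)"
        using rW[of x x] by (simp add: sums_def_le)
      have "sqrt_coeff n * (norm x)\<^sup>2 \<le> sqrt_coeff n * rinner x ((T ^ n) x)" for n
      proof (cases n)
        case (Suc k)
        have "rinner x ((T ^ n) x) \<le> norm x * (norm (T ^ n) * norm x)"
          using rinner_Cauchy_Schwarz[of x "(T ^ n) x"] norm_bop_apply[of "T ^ n" x]
          by (meson abs_le_D1 mult_left_mono norm_ge_zero order_trans)
        also have "\<dots> \<le> norm x * (1 * norm x)"
          by (intro mult_left_mono mult_right_mono nTn) auto
        finally show ?thesis
          using sqrt_coeff_nonpos[of k] Suc by (intro mult_left_mono_neg) (auto simp: power2_eq_square)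
      qed (simp add: rinner_self)
      then have "(\<Sum>n\<le>N. sqrt_coeff n) * (norm x)\<^sup>2 \<le> (\<Sum>n\<le>N. sqrt_coeff n * rinner x ((T ^ n) x))" for N
        unfolding sum_distrib_right by (rule sum_mono)
      moreover have "0 \<le> (\<Sum>n\<le>N. sqrt_coeff n) * (norm x)\<^sup>2" for N
        by (intro mult_nonneg_nonneg sqrt_coeff_partial_sum_nonneg) simp
      ultimately show "\<exists>N. \<forall>n\<ge>N. 0 \<le> (\<Sum>k\<le>n. sqrt_coeff k * rinner x ((T ^ k) x))"
        by (meson order_trans)
    qed
  qed
  have comm: "X * W = W * X" if "X * H = H * X" for X
  proof -
    have "X * T = T * X" using that by (simp add: T_def algebra_simps)
    then have "X * T ^ n = T ^ n * X" for n by (metis power_commuting_commutes)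
    then show ?thesis
      unfolding W_def suminf_mult[OF sf', symmetric] suminf_mult2[OF sf'] by (simp add: f_def)
  qed
  show ?thesis
  proof (intro exI[of _ "sqrt c *\<^sub>R W"] conjI allI impI)
    show "nonneg_op (sqrt c *\<^sub>R W)"
      using c nonneg_op_rinner[OF W] nonneg_op_rinner_selfadjoint[OF W]
      by (intro nonneg_opI) (simp_all add: bop_apply_scaleR rinner.scaleR_left rinner.scaleR_right)
  qed (use c comm in \<open>simp_all add: WW\<close>)
qed

text \<open>A second root \<open>T\<close> commutes with \<open>H\<close>, hence with \<open>S\<close>, and then \<open>(S + T) (S - T) = 0\<close>. Positivity
forces both \<open>S\<close> and \<open>T\<close> to vanish on the range of \<open>S - T\<close>.\<close>

lemma nonneg_op_sqrt_unique:
  fixes H :: "'a::complex_hilbert bop"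
  assumes S: "nonneg_op S" "S * S = H" and T: "nonneg_op T" "T * T = H"
    and comm: "\<And>X. X * H = H * X \<Longrightarrow> X * S = S * X"
  shows "T = S"
proof (rule bop_eqI)
  fix x
  have TS: "T * S = S * T"
    by (rule comm) (simp add: T(2)[symmetric] mult.assoc)
  define D where "D = S - T"
  define y where "y = D x"
  have "(S + T) * D = 0" by (simp add: D_def algebra_simps TS S T)
  then have "S y + T y = 0"
    by (metis bop_apply_add bop_apply_times bop_apply_zero y_def)
  then have "rinner y (S y) + rinner y (T y) = 0" by (metis rinner.add_right rinner.zero_right)
  then have "rinner y (S y) = 0" "rinner y (T y) = 0"
    using nonneg_op_rinner[OF S(1), of y] nonneg_op_rinner[OF T(1), of y] by auto
  then have "rinner y (D y) = 0" by (simp add: D_def bop_apply_diff rinner.diff_right)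
  have "rinner y (D z) = rinner (D y) z" for z
    by (simp add: D_def bop_apply_diff rinner.diff_right rinner.diff_left
        nonneg_op_rinner_selfadjoint[OF S(1)] nonneg_op_rinner_selfadjoint[OF T(1)])
  then have yy: "(norm y)\<^sup>2 = rinner (D y) x" using y_def rinner_self by metis
  \<comment> \<open>A nonnegative operator annihilates the null vectors of its quadratic form.\<close>
  have null: "A y = 0" if A: "nonneg_op A" and "rinner y (A y) = 0" for A :: "'a bop"
  proof -
    have "(rinner (A y) (A y))\<^sup>2 \<le> rinner (A y) (A (A y)) * rinner y (A y)"
      by (rule nonneg_op_Cauchy_Schwarz[OF A])
    then show ?thesis using that by (simp add: rinner_self)
  qed
  have "D y = 0"
    using null[OF S(1)] null[OF T(1)] \<open>rinner y (S y) = 0\<close> \<open>rinner y (T y) = 0\<close>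
    by (simp add: D_def bop_apply_diff)
  then have "y = 0" using yy by (simp add: rinner.zero_left)
  then show "T x = S x" by (simp add: y_def D_def bop_apply_diff)
qed

lemma op_sqrt:
  assumes "nonneg_op H"
  shows "nonneg_op (op_sqrt H)" "op_sqrt H * op_sqrt H = H"
proof -
  obtain S where S: "nonneg_op S" "S * S = H" "\<And>X. X * H = H * X \<Longrightarrow> X * S = S * X"
    using nonneg_op_sqrt_exists[OF assms] by blast
  have "nonneg_op (op_sqrt H) \<and> op_sqrt H * op_sqrt H = H"
    unfolding op_sqrt_def
    by (rule theI[of _ S]) (use S nonneg_op_sqrt_unique in blast)+
  then show "nonneg_op (op_sqrt H)" "op_sqrt H * op_sqrt H = H" by auto
qed

lemma norm_op_sqrt_apply:
  assumes "nonneg_op H"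
  shows "(norm (op_sqrt H x))\<^sup>2 = rinner x (bop_apply H x)"
proof -
  have "(norm (op_sqrt H x))\<^sup>2 = rinner x ((op_sqrt H * op_sqrt H) x)"
    by (simp add: bop_apply_times nonneg_op_rinner_selfadjoint[OF op_sqrt(1)[OF assms]] rinner_self)
  then show ?thesis by (simp add: op_sqrt(2)[OF assms])
qed

section \<open>From defect bounds to norm asymptotics\<close>

definition near_kernel :: "'a::complex_hilbert bop \<Rightarrow> 'a bop \<Rightarrow> nat \<Rightarrow> real \<Rightarrow> 'a set" where
  "near_kernel S B m \<delta> = {y. norm y = 1 \<and> (\<forall>p<m. norm ((S * B ^ p) y) \<le> \<delta>)}"

text \<open>For \<open>S\<close> the square root of the Hermitian part this is the infimum in the definition of the constant
\<open>c\<close>.\<close>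

definition coupling_inf :: "'a::complex_hilbert bop \<Rightarrow> 'a bop \<Rightarrow> nat \<Rightarrow> real \<Rightarrow> real" where
  "coupling_inf S B m \<delta> = (INF y\<in>near_kernel S B m \<delta>. (norm ((S * B ^ m) y))\<^sup>2)"

lemma coupling_bdd_below: "bdd_below ((\<lambda>y. (norm (bop_apply A y))\<^sup>2) ` Y)"
  by (rule bdd_belowI2[of _ 0]) simp

lemma coupling_inf_le:
  "y \<in> near_kernel S B m \<delta> \<Longrightarrow> coupling_inf S B m \<delta> \<le> (norm ((S * B ^ m) y))\<^sup>2"
  unfolding coupling_inf_def by (rule cINF_lower[OF coupling_bdd_below])

text \<open>The infimum increases as the constraint tightens and is bounded by \<open>\<parallel>S B\<^sup>m\<parallel>\<^sup>2\<close>. Nonemptiness of the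
constraint sets matters, since the infimum over the empty set carries no information.\<close>

lemma coupling_inf_converges:
  fixes S B :: "'a::complex_hilbert bop"
  assumes ne: "\<And>\<delta>. 0 < \<delta> \<Longrightarrow> near_kernel S B m \<delta> \<noteq> {}"
  shows "\<exists>L. (coupling_inf S B m \<longlongrightarrow> L) (at_right 0) \<and> (\<forall>\<delta>>0. coupling_inf S B m \<delta> \<le> L)"
proof -
  let ?f = "coupling_inf S B m"
  have anti: "?f \<delta>' \<le> ?f \<delta>" if "0 < \<delta>" "\<delta> \<le> \<delta>'" for \<delta> \<delta>'
    unfolding coupling_inf_def
    by (rule cINF_superset_mono[OF ne[OF that(1)] coupling_bdd_below])
      (use that in \<open>auto simp: near_kernel_def\<close>)
  have bound: "?f \<delta> \<le> (norm (S * B ^ m))\<^sup>2" if \<delta>: "0 < \<delta>" for \<delta>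
  proof -
    obtain y where y: "y \<in> near_kernel S B m \<delta>" using ne[OF \<delta>] by blast
    have "norm ((S * B ^ m) y) \<le> norm (S * B ^ m)"
      using norm_bop_apply[of "S * B ^ m" y] y by (simp add: near_kernel_def)
    then have "(norm ((S * B ^ m) y))\<^sup>2 \<le> (norm (S * B ^ m))\<^sup>2"
      by (rule power_mono) simp
    with coupling_inf_le[OF y] show ?thesis by (rule order_trans)
  qed
  then have bdd: "bdd_above (?f ` {0<..})" by (intro bdd_aboveI2) auto
  define L where "L = (SUP \<delta>\<in>{0<..}. ?f \<delta>)"
  have le: "?f \<delta> \<le> L" if "0 < \<delta>" for \<delta>
    unfolding L_def by (rule cSUP_upper[OF _ bdd]) (use that in simp)
  have "(?f \<longlongrightarrow> L) (at_right 0)"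
  proof (rule order_tendstoI)
    fix a assume "a < L"
    then obtain \<delta> where \<delta>: "0 < \<delta>" "a < ?f \<delta>"
      unfolding L_def by (subst (asm) less_cSUP_iff[OF _ bdd]) auto
    have "\<forall>\<^sub>F \<delta>' in at_right 0. \<delta>' \<in> {0<..<\<delta>}"
      by (rule eventually_at_right_real[OF \<delta>(1)])
    then show "\<forall>\<^sub>F \<delta>' in at_right 0. a < ?f \<delta>'"
    proof eventually_elim
      case (elim \<delta>')
      then have "?f \<delta> \<le> ?f \<delta>'" by (intro anti) auto
      then show ?case using \<delta>(2) by simp
    qed
  next
    fix a assume "L < a"
    have "\<forall>\<^sub>F \<delta> in at_right 0. (0::real) < \<delta>" by (rule eventually_at_right_less)
    then show "\<forall>\<^sub>F \<delta> in at_right 0. ?f \<delta> < a"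
    proof eventually_elim
      case (elim \<delta>)
      then show ?case using le[of \<delta>] \<open>L < a\<close> by simp
    qed
  qed
  then show ?thesis using le by blast
qed

lemma defect_bound_norm:
  fixes U :: "'a::complex_hilbert bop"
  assumes b: "\<And>x. norm x = 1 \<Longrightarrow> b \<le> 1 - (norm (U x))\<^sup>2"
  shows "b \<le> 1 - (norm U)\<^sup>2"
proof -
  obtain z :: 'a where "z \<noteq> 0" using nontrivial by blast
  then have "norm ((1 / norm z) *\<^sub>R z) = 1" by simp
  from b[OF this] have b1: "b \<le> 1" by (smt (verit) zero_le_power2)
  have "norm U \<le> sqrt (1 - b)"
  proof (rule norm_bop_le)
    fix x
    show "norm (U x) \<le> sqrt (1 - b) * norm x"
    proof (cases "x = 0")
      case False
      then have "norm ((1 / norm x) *\<^sub>R x) = 1" by simp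
      from b[OF this] have "(norm (U x) / norm x)\<^sup>2 \<le> 1 - b"
        by (simp add: bop_apply_scaleR_right)
      then have "norm (U x) / norm x \<le> sqrt (1 - b)" by (rule real_le_rsqrt)
      then show ?thesis using False by (simp add: field_simps)
    qed (simp add: bop_apply.zero_right)
  qed (use b1 in simp)
  then have "(norm U)\<^sup>2 \<le> (sqrt (1 - b))\<^sup>2" by (rule power_mono) simp
  then show ?thesis using b1 by simp
qed

text \<open>For the lower estimate of the defect a small \<open>\<delta>\<close> is fixed. A unit vector either satisfies the constraint
with \<open>\<delta>\<close>, and then the bound of order \<open>m\<close> gives \<open>\<kappa> m\<close> times almost \<open>L\<close>; or it violates the constraint
for some \<open>p < m\<close>, and then the bound of order \<open>p\<close> gives a defect of the larger order \<open>t\<^bsup>2 p + 1\<^esup>\<close>.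
For the upper estimate, near-minimizers with \<open>\<delta> = t\<^bsup>m + 1\<^esup>\<close> are used: this makes the lower coefficients
negligible against \<open>t\<^sup>m S B\<^sup>m y\<close>. The correction from \<open>y\<close> to \<open>x\<close> is where
the extremal polynomial enters. The factor \<open>1 / 2\<close> comes from passing from squared norms to norms.\<close>

lemma norm_asymptotics:
  fixes S B :: "'a::complex_hilbert bop" and U :: "real \<Rightarrow> 'a bop" and \<kappa> :: "nat \<Rightarrow> real"
  assumes ne: "\<And>\<delta>. 0 < \<delta> \<Longrightarrow> near_kernel S B m \<delta> \<noteq> {}"
    and L: "(coupling_inf S B m \<longlongrightarrow> L) (at_right 0)"
    and L_ge: "\<And>\<delta>. 0 < \<delta> \<Longrightarrow> coupling_inf S B m \<delta> \<le> L"
    and \<kappa>: "\<And>p. p \<le> m \<Longrightarrow> 0 < \<kappa> p"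
    and contraction: "\<And>t. 0 < t \<Longrightarrow> norm (U t) \<le> 1"
    and lower: "\<And>p. p \<le> m \<Longrightarrow> \<exists>C\<ge>0. \<forall>t x. 0 < t \<and> t \<le> 1 \<and> norm x = 1 \<longrightarrow>
      \<kappa> p * t ^ (2 * p + 1) * ((norm ((S * B ^ p) x))\<^sup>2 - C * t) \<le> 1 - (norm (U t x))\<^sup>2"
    and upper: "\<exists>C\<ge>0. \<forall>t y. 0 < t \<and> t \<le> 1 \<and> y \<in> near_kernel S B m (t ^ (m + 1)) \<longrightarrow>
      (\<exists>x. 1 - C * t \<le> norm x \<and>
        (norm x)\<^sup>2 - (norm (U t x))\<^sup>2 \<le> \<kappa> m * t ^ (2 * m + 1) * ((norm ((S * B ^ m) y))\<^sup>2 + C * t))"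
  shows "((\<lambda>t. (1 - norm (U t)) / t ^ (2 * m + 1)) \<longlongrightarrow> \<kappa> m * L / 2) (at_right 0)"
proof -
  define d where "d t = 1 - (norm (U t))\<^sup>2" for t
  have d_nonneg: "0 \<le> d t" if "0 < t" for t
    using contraction[OF that] by (simp add: d_def power_le_one)
  have d_le: "d t * (norm x)\<^sup>2 \<le> (norm x)\<^sup>2 - (norm (U t x))\<^sup>2" for t x
  proof -
    have "(norm (U t x))\<^sup>2 \<le> (norm (U t) * norm x)\<^sup>2"
      by (intro power_mono norm_bop_apply) simp
    then show ?thesis by (simp add: d_def power_mult_distrib left_diff_distrib)
  qed
  have pos: "\<forall>\<^sub>F t in at_right 0. (0::real) < t" by (rule eventually_at_right_less)
  have small: "\<forall>\<^sub>F t in at_right 0. t < e" if "0 < e" for e :: real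
    using that eventually_at_right_real[of 0 e] by (auto elim: eventually_mono)
  have lim_pow: "((\<lambda>t::real. t ^ n) \<longlongrightarrow> 0) (at_right 0)" if "0 < n" for n
    using that by (auto intro!: tendsto_eq_intros)
  have lim_d: "((\<lambda>t. d t / t ^ (2 * m + 1)) \<longlongrightarrow> \<kappa> m * L) (at_right 0)"
  proof (rule order_tendstoI)
    fix a assume a: "a < \<kappa> m * L"
    have km: "0 < \<kappa> m" by (rule \<kappa>) simp
    then obtain a' where a': "a < \<kappa> m * a'" "a' < L"
      using a dense[of "a / \<kappa> m" L] by (auto simp: field_simps)
    \<comment> \<open>The gap between \<open>a\<close> and \<open>\<kappa> m * a'\<close> absorbs all error terms.\<close>
    obtain a'' where a'': "a < a''" "a'' < \<kappa> m * a'" using dense[OF a'(1)] by blast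
    have "\<forall>\<^sub>F \<delta> in at_right 0. a' < coupling_inf S B m \<delta>"
      by (rule order_tendstoD(1)[OF L a'(2)])
    then have "\<forall>\<^sub>F \<delta> in at_right 0. a' < coupling_inf S B m \<delta> \<and> 0 < \<delta>"
      using pos by eventually_elim simp
    then obtain \<delta> where \<delta>: "a' < coupling_inf S B m \<delta>" "0 < \<delta>"
      using eventually_happens' trivial_limit_at_right_real by blast
    have "\<forall>p. \<exists>C. p \<le> m \<longrightarrow> (\<forall>t x. 0 < t \<and> t \<le> 1 \<and> norm x = 1 \<longrightarrow>
        \<kappa> p * t ^ (2 * p + 1) * ((norm ((S * B ^ p) x))\<^sup>2 - C * t) \<le> 1 - (norm (U t x))\<^sup>2)"
      using lower by blast
    from choice[OF this] obtain C where C: "\<forall>p. p \<le> m \<longrightarrow> (\<forall>t x. 0 < t \<and> t \<le> 1 \<and> norm x = 1 \<longrightarrow>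
        \<kappa> p * t ^ (2 * p + 1) * ((norm ((S * B ^ p) x))\<^sup>2 - C p * t) \<le> 1 - (norm (U t x))\<^sup>2)" ..
    have C_lower: "\<kappa> p * t ^ (2 * p + 1) * ((norm ((S * B ^ p) x))\<^sup>2 - C p * t) \<le> 1 - (norm (U t x))\<^sup>2"
      if "p \<le> m" "0 < t" "t \<le> 1" "norm x = 1" for p t x
      using C that by blast
    have "((\<lambda>t. \<kappa> m * (a' - C m * t)) \<longlongrightarrow> \<kappa> m * (a' - C m * 0)) (at_right 0)"
      by (intro tendsto_intros)
    then have ev1: "\<forall>\<^sub>F t in at_right 0. a'' < \<kappa> m * (a' - C m * t)"
      by (rule order_tendstoD) (use a'' in simp)
    have ev2: "\<forall>\<^sub>F t in at_right 0. \<forall>p\<in>{..<m}. a'' * t ^ (2 * (m - p)) < \<kappa> p * (\<delta>\<^sup>2 - C p * t)"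
    proof (rule eventually_ball_finite, simp, intro ballI)
      fix p assume p: "p \<in> {..<m}"
      have "((\<lambda>t. \<kappa> p * (\<delta>\<^sup>2 - C p * t) - a'' * t ^ (2 * (m - p))) \<longlongrightarrow> \<kappa> p * (\<delta>\<^sup>2 - C p * 0) - a'' * 0) (at_right 0)"
        using p by (intro tendsto_intros lim_pow) simp
      then have "\<forall>\<^sub>F t in at_right 0. 0 < \<kappa> p * (\<delta>\<^sup>2 - C p * t) - a'' * t ^ (2 * (m - p))"
        by (rule order_tendstoD) (use p \<kappa>[of p] \<delta> in simp)
      then show "\<forall>\<^sub>F t in at_right 0. a'' * t ^ (2 * (m - p)) < \<kappa> p * (\<delta>\<^sup>2 - C p * t)"
        by eventually_elim simp
    qed
    show "\<forall>\<^sub>F t in at_right 0. a < d t / t ^ (2 * m + 1)"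
      using ev1 ev2 pos small[of 1, simplified]
    proof eventually_elim
      case (elim t)
      have "a'' * t ^ (2 * m + 1) \<le> 1 - (norm (U t x))\<^sup>2" if x: "norm x = 1" for x
      proof (cases "x \<in> near_kernel S B m \<delta>")
        case True
        have "a'' * t ^ (2 * m + 1) \<le> \<kappa> m * (a' - C m * t) * t ^ (2 * m + 1)"
          using elim by (intro mult_right_mono) auto
        also have "\<dots> = \<kappa> m * t ^ (2 * m + 1) * (a' - C m * t)" by simp
        also have "\<dots> \<le> \<kappa> m * t ^ (2 * m + 1) * ((norm ((S * B ^ m) x))\<^sup>2 - C m * t)"
          using elim km \<delta> coupling_inf_le[OF True] by (intro mult_left_mono) auto
        also have "\<dots> \<le> 1 - (norm (U t x))\<^sup>2"
          using elim x by (intro C_lower) auto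
        finally show ?thesis .
      next
        case False
        then obtain p where p: "p < m" "\<delta> < norm ((S * B ^ p) x)"
          using x by (auto simp: near_kernel_def not_le)
        have "t ^ (2 * m + 1) = t ^ (2 * (m - p)) * t ^ (2 * p + 1)"
          unfolding power_add[symmetric] by (rule arg_cong[of _ _ "power t"]) (use p in simp)
        then have "a'' * t ^ (2 * m + 1) = a'' * t ^ (2 * (m - p)) * t ^ (2 * p + 1)" by simp
        also have "\<dots> \<le> \<kappa> p * (\<delta>\<^sup>2 - C p * t) * t ^ (2 * p + 1)"
          using elim p by (intro mult_right_mono) (auto intro: less_imp_le)
        also have "\<dots> = \<kappa> p * t ^ (2 * p + 1) * (\<delta>\<^sup>2 - C p * t)" by simp
        also have "\<dots> \<le> \<kappa> p * t ^ (2 * p + 1) * ((norm ((S * B ^ p) x))\<^sup>2 - C p * t)"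
          using elim \<kappa>[of p] p \<delta> by (intro mult_left_mono diff_right_mono power_mono) auto
        also have "\<dots> \<le> 1 - (norm (U t x))\<^sup>2"
          using elim x p by (intro C_lower) auto
        finally show ?thesis .
      qed
      then have "a'' * t ^ (2 * m + 1) \<le> d t" unfolding d_def by (rule defect_bound_norm)
      then have "a'' \<le> d t / t ^ (2 * m + 1)" using elim by (simp add: pos_le_divide_eq)
      then show ?case using a'' by simp
    qed
  next
    fix a assume a: "\<kappa> m * L < a"
    obtain C where C: "0 \<le> C" and C_upper: "\<And>t y. 0 < t \<Longrightarrow> t \<le> 1 \<Longrightarrow> y \<in> near_kernel S B m (t ^ (m + 1)) \<Longrightarrow>
      (\<exists>x. 1 - C * t \<le> norm x \<and>
        (norm x)\<^sup>2 - (norm (U t x))\<^sup>2 \<le> \<kappa> m * t ^ (2 * m + 1) * ((norm ((S * B ^ m) y))\<^sup>2 + C * t))"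
      using upper by blast
    have km: "0 < \<kappa> m" by (rule \<kappa>) simp
    have "((\<lambda>t. \<kappa> m * (L + t + C * t) / (1 - C * t)\<^sup>2) \<longlongrightarrow> \<kappa> m * (L + 0 + C * 0) / (1 - C * 0)\<^sup>2) (at_right 0)"
      by (intro tendsto_intros) simp
    then have "\<forall>\<^sub>F t in at_right 0. \<kappa> m * (L + t + C * t) / (1 - C * t)\<^sup>2 < a"
      by (rule order_tendstoD) (use a in simp)
    moreover have "((\<lambda>t. C * t) \<longlongrightarrow> C * 0) (at_right 0)" by (intro tendsto_intros)
    then have "\<forall>\<^sub>F t in at_right 0. C * t < 1" by (rule order_tendstoD) simp
    ultimately show "\<forall>\<^sub>F t in at_right 0. d t / t ^ (2 * m + 1) < a"
      using pos small[of 1, simplified]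
    proof eventually_elim
      case (elim t)
      have "coupling_inf S B m (t ^ (m + 1)) < L + t"
        using L_ge[of "t ^ (m + 1)"] elim by simp
      then obtain y where y: "y \<in> near_kernel S B m (t ^ (m + 1))" "(norm ((S * B ^ m) y))\<^sup>2 < L + t"
        unfolding coupling_inf_def
        by (subst (asm) cINF_less_iff[OF ne coupling_bdd_below]) (use elim in auto)
      obtain x where x: "1 - C * t \<le> norm x"
        "(norm x)\<^sup>2 - (norm (U t x))\<^sup>2 \<le> \<kappa> m * t ^ (2 * m + 1) * ((norm ((S * B ^ m) y))\<^sup>2 + C * t)"
        using C_upper[OF _ _ y(1)] elim by auto
      have "d t * (1 - C * t)\<^sup>2 \<le> d t * (norm x)\<^sup>2"
        using x elim d_nonneg[of t] by (intro mult_left_mono power_mono) auto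
      also have "\<dots> \<le> \<kappa> m * t ^ (2 * m + 1) * ((norm ((S * B ^ m) y))\<^sup>2 + C * t)"
        using d_le[of t x] x by simp
      also have "\<dots> \<le> \<kappa> m * t ^ (2 * m + 1) * (L + t + C * t)"
        using y km elim by (intro mult_left_mono) auto
      finally have "d t / t ^ (2 * m + 1) \<le> \<kappa> m * (L + t + C * t) / (1 - C * t)\<^sup>2"
        using elim by (simp add: field_simps)
      then show ?case using elim by simp
    qed
  qed
  have "((\<lambda>t. d t / t ^ (2 * m + 1) * t ^ (2 * m + 1)) \<longlongrightarrow> \<kappa> m * L * 0) (at_right 0)"
    by (rule tendsto_mult[OF lim_d lim_pow]) simp
  then have "(d \<longlongrightarrow> \<kappa> m * L * 0) (at_right 0)"
    by (rule Lim_transform_eventually) (use pos in eventually_elim, simp)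
  then have "(d \<longlongrightarrow> 0) (at_right 0)" by simp
  then have "((\<lambda>t. sqrt (1 - d t)) \<longlongrightarrow> sqrt (1 - 0)) (at_right 0)"
    by (intro tendsto_intros)
  then have lim_norm: "((\<lambda>t. norm (U t)) \<longlongrightarrow> 1) (at_right 0)" by (simp add: d_def)
  have "((\<lambda>t. d t / t ^ (2 * m + 1) / (1 + norm (U t))) \<longlongrightarrow> \<kappa> m * L / (1 + 1)) (at_right 0)"
    by (intro tendsto_intros lim_d lim_norm) simp
  moreover have "d t / t ^ (2 * m + 1) / (1 + norm (U t)) = (1 - norm (U t)) / t ^ (2 * m + 1)" for t
  proof -
    have "d t = (1 - norm (U t)) * (1 + norm (U t))"
      by (simp add: d_def power2_eq_square algebra_simps)
    moreover have "1 + norm (U t) \<noteq> 0" by (smt (verit) norm_ge_zero)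
    ultimately show ?thesis by simp
  qed
  ultimately show ?thesis by simp
qed

section \<open>Polynomials in an operator\<close>

definition op_poly :: "real poly \<Rightarrow> 'b::real_normed_algebra_1 \<Rightarrow> 'b" where
  "op_poly p X = (\<Sum>i\<le>degree p. coeff p i *\<^sub>R X ^ i)"

lemma op_poly_altdef: "degree p \<le> n \<Longrightarrow> op_poly p X = (\<Sum>i\<le>n. coeff p i *\<^sub>R X ^ i)"
  unfolding op_poly_def by (rule sum.mono_neutral_left) (auto simp: coeff_eq_0)

lemma op_poly_0 [simp]: "op_poly 0 X = 0" by (simp add: op_poly_def)
lemma op_poly_1 [simp]: "op_poly 1 X = 1" by (simp add: op_poly_def)

lemma op_poly_add: "op_poly (p + q) X = op_poly p X + op_poly q X"
proof -
  define n where "n = max (degree p) (degree q)"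
  have "degree (p + q) \<le> n" "degree p \<le> n" "degree q \<le> n"
    by (auto simp: n_def degree_add_le_max)
  then show ?thesis by (simp add: op_poly_altdef scaleR_add_left sum.distrib)
qed

lemma op_poly_smult: "op_poly (smult a p) X = a *\<^sub>R op_poly p X"
  by (subst op_poly_altdef[OF degree_smult_le]) (simp add: op_poly_def scaleR_sum_right)

lemma op_poly_pCons: "op_poly (pCons a p) X = a *\<^sub>R 1 + X * op_poly p X"
  by (subst op_poly_altdef[OF degree_pCons_le])
    (simp add: op_poly_def sum.atMost_Suc_shift sum_distrib_left del: sum.atMost_Suc)

text \<open>Powers of a single element commute, so evaluation is multiplicative in any algebra. All identities
between products of functions of \<open>B\<close> are thereby reduced to identities between real polynomials.\<close>

lemma op_poly_mult: "op_poly (p * q) X = op_poly p X * op_poly q X"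
  by (induction p) (simp_all add: op_poly_add op_poly_smult op_poly_pCons algebra_simps)

lemma op_poly_power: "op_poly (p ^ n) X = op_poly p X ^ n"
  by (induction n) (simp_all add: op_poly_mult)

text \<open>On vectors of the near kernel with \<open>\<delta> = t\<^bsup>m + 1\<^esup>\<close>, the coefficients of \<open>r\<close> below \<open>m\<close> are suppressed by the
constraint and those above \<open>m\<close> by the power of \<open>t\<close>, so that only \<open>coeff r m\<close> survives. The bound is
uniform in \<open>r\<close>, because the polynomials arising below depend on a continuous parameter; \<open>w\<close> allows for
a further perturbation, such as a Taylor remainder.\<close>

lemma near_kernel_op_poly:
  fixes S B :: "'a::complex_hilbert bop"
  assumes A: "0 \<le> A" and E: "0 \<le> E"
  shows "\<exists>K\<ge>0. \<forall>r t y w. degree r \<le> N \<and> (\<forall>k. \<bar>coeff r k\<bar> \<le> A) \<and> 0 < t \<and> t \<le> 1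
    \<and> y \<in> near_kernel S B m (t ^ (m + 1)) \<and> norm (w - (S * op_poly r (t *\<^sub>R B)) y) \<le> E * t ^ (m + 1)
    \<longrightarrow> (norm w)\<^sup>2 \<le> t ^ (2 * m) * ((coeff r m)\<^sup>2 * (norm ((S * B ^ m) y))\<^sup>2 + K * t)"
proof -
  define M where "M = 1 + (\<Sum>k\<le>N + m. norm (S * B ^ k))"
  have M1: "1 \<le> M" by (simp add: M_def sum_nonneg)
  have M: "norm (S * B ^ k) \<le> M" if "k \<le> N + m" for k
    using member_le_sum[of k "{..N + m}" "\<lambda>k. norm (S * B ^ k)"] that by (simp add: M_def)
  define K1 where "K1 = real (N + m + 1) * (A * M) + E"
  have K1: "0 \<le> K1" using A E M1 by (simp add: K1_def)
  show ?thesis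
  proof (intro exI[of _ "2 * (A * M) * K1 + K1\<^sup>2"] conjI allI impI; (elim conjE)?)
    show "0 \<le> 2 * (A * M) * K1 + K1\<^sup>2" using A M1 K1 by simp
  next
    fix r t y w
    assume deg: "degree r \<le> N" and coeff: "\<forall>k. \<bar>coeff r k\<bar> \<le> A" and t: "0 < t" "t \<le> 1"
      and y: "y \<in> near_kernel S B m (t ^ (m + 1))"
      and w: "norm (w - (S * op_poly r (t *\<^sub>R B)) y) \<le> E * t ^ (m + 1)"
    define h where "h k = (S * B ^ k) y" for k
    have "op_poly r (t *\<^sub>R B) = (\<Sum>k\<le>N + m. (coeff r k * t ^ k) *\<^sub>R B ^ k)"
      using deg by (subst op_poly_altdef[of _ "N + m"]) (simp_all add: scaleR_power mult.commute)
    then have expand: "(S * op_poly r (t *\<^sub>R B)) y = (\<Sum>k\<le>N + m. (coeff r k * t ^ k) *\<^sub>R h k)"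
      by (simp add: h_def sum_distrib_left bop_apply.sum_left bop_apply_scaleR)
    have nh: "norm (h k) \<le> M" if "k \<le> N + m" for k
      using norm_bop_apply[of "S * B ^ k" y] M[OF that] y by (simp add: h_def near_kernel_def)
    have bnd: "norm ((coeff r k * t ^ k) *\<^sub>R h k) \<le> A * M * t ^ (m + 1)" if k: "k \<le> N + m" "k \<noteq> m" for k
    proof -
      have "t ^ k * norm (h k) \<le> M * t ^ (m + 1)"
      proof (cases "k < m")
        case True
        then have "norm (h k) \<le> t ^ (m + 1)" using y by (simp add: near_kernel_def h_def)
        then have "t ^ k * norm (h k) \<le> 1 * t ^ (m + 1)"
          using t by (intro mult_mono power_le_one) auto
        also have "\<dots> \<le> M * t ^ (m + 1)" using M1 t by (intro mult_right_mono) auto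
        finally show ?thesis .
      next
        case False
        then have "t ^ k \<le> t ^ (m + 1)" using k t by (intro power_decreasing) auto
        then have "t ^ k * norm (h k) \<le> t ^ (m + 1) * M" using nh[OF k(1)] t M1 by (intro mult_mono) auto
        then show ?thesis by (simp add: mult.commute)
      qed
      then have "\<bar>coeff r k\<bar> * (t ^ k * norm (h k)) \<le> A * (M * t ^ (m + 1))"
        using coeff A t by - (rule mult_mono, auto)
      then show ?thesis using t by (simp add: abs_mult mult.assoc)
    qed
    have "norm ((S * op_poly r (t *\<^sub>R B)) y - (coeff r m * t ^ m) *\<^sub>R h m)
        = norm (\<Sum>k\<in>{..N + m} - {m}. (coeff r k * t ^ k) *\<^sub>R h k)"
      by (simp add: expand sum_diff1)
    also have "\<dots> \<le> (\<Sum>k\<in>{..N + m} - {m}. A * M * t ^ (m + 1))"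
      by (intro sum_norm_le bnd) auto
    also have "\<dots> \<le> real (N + m + 1) * (A * M * t ^ (m + 1))"
      using A M1 t by (simp add: mult_right_mono)
    finally have "norm ((S * op_poly r (t *\<^sub>R B)) y - (coeff r m * t ^ m) *\<^sub>R h m)
        \<le> real (N + m + 1) * (A * M * t ^ (m + 1))" .
    then have "norm (w - (coeff r m * t ^ m) *\<^sub>R h m) \<le> K1 * t ^ (m + 1)"
      using w norm_triangle_ineq[of "w - (S * op_poly r (t *\<^sub>R B)) y"
          "(S * op_poly r (t *\<^sub>R B)) y - (coeff r m * t ^ m) *\<^sub>R h m"]
      by (simp add: K1_def algebra_simps)
    then have "norm w \<le> norm ((coeff r m * t ^ m) *\<^sub>R h m) + K1 * t ^ (m + 1)"
      using norm_triangle_ineq2[of w "(coeff r m * t ^ m) *\<^sub>R h m"] by simp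
    also have "\<dots> = t ^ m * (\<bar>coeff r m\<bar> * norm (h m) + K1 * t)"
      using t by (simp add: abs_mult algebra_simps)
    finally have "(norm w)\<^sup>2 \<le> (t ^ m * (\<bar>coeff r m\<bar> * norm (h m) + K1 * t))\<^sup>2"
      by (rule power_mono) simp
    also have "\<dots> = t ^ (2 * m) * ((coeff r m)\<^sup>2 * (norm (h m))\<^sup>2
        + (2 * (\<bar>coeff r m\<bar> * norm (h m)) * K1 + K1\<^sup>2 * t) * t)"
      by (simp add: power_mult_distrib power2_sum power_mult power2_eq_square algebra_simps)
    also have "\<dots> \<le> t ^ (2 * m) * ((coeff r m)\<^sup>2 * (norm (h m))\<^sup>2 + (2 * (A * M) * K1 + K1\<^sup>2 * 1) * t)"
      using t K1 coeff nh[of m] A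
      by (intro mult_left_mono add_left_mono mult_right_mono add_mono mult_mono) auto
    finally show "(norm w)\<^sup>2 \<le> t ^ (2 * m) * ((coeff r m)\<^sup>2 * (norm ((S * B ^ m) y))\<^sup>2
        + (2 * (A * M) * K1 + K1\<^sup>2) * t)"
      by (simp add: h_def)
  qed
qed

section \<open>Legendre polynomials on the unit interval\<close>

definition unit_integral :: "real poly \<Rightarrow> real" where
  "unit_integral p = integral {0..1} (poly p)"

lemma has_unit_integral: "(poly p has_integral unit_integral p) {0..1}"
  unfolding unit_integral_def
  by (intro integrable_integral integrable_continuous_interval continuous_intros)

lemma unit_integral_eqI: "(poly p has_integral c) {0..1} \<Longrightarrow> unit_integral p = c"
  unfolding unit_integral_def by (rule integral_unique)

lemma unit_integral_add: "unit_integral (p + q) = unit_integral p + unit_integral q"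
proof (rule unit_integral_eqI)
  have "poly (p + q) = (\<lambda>x. poly p x + poly q x)" by (simp add: fun_eq_iff)
  then show "(poly (p + q) has_integral unit_integral p + unit_integral q) {0..1}"
    by (simp only: has_integral_add[OF has_unit_integral has_unit_integral])
qed

lemma unit_integral_smult: "unit_integral (smult c p) = c * unit_integral p"
proof (rule unit_integral_eqI)
  have "poly (smult c p) = (\<lambda>x. c * poly p x)" by (simp add: fun_eq_iff)
  then show "(poly (smult c p) has_integral c * unit_integral p) {0..1}"
    by (simp only: has_integral_mult_right[OF has_unit_integral])
qed

lemma unit_integral_pderiv: "unit_integral (pderiv p) = poly p 1 - poly p 0"
proof (rule unit_integral_eqI)
  show "(poly (pderiv p) has_integral poly p 1 - poly p 0) {0..1}"
    by (rule fundamental_theorem_of_calculus)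
      (auto intro!: has_field_derivative_at_within[OF poly_DERIV]
        simp flip: has_real_derivative_iff_has_vector_derivative)
qed

lemma unit_integral_by_parts:
  "unit_integral (p * pderiv q) = poly (p * q) 1 - poly (p * q) 0 - unit_integral (pderiv p * q)"
  using unit_integral_pderiv[of "p * q"]
  by (simp add: pderiv_mult unit_integral_add mult.commute)

lemma unit_integral_beta:
  "unit_integral ([:0, 1:] ^ a * [:1, -1:] ^ b) = fact a * fact b / fact (a + b + 1)"
proof (induction b arbitrary: a)
  have antideriv: "pderiv (smult (1 / real (a + 1)) ([:0, 1:] ^ (a + 1))) = [:0, 1:] ^ a" for a
    by (simp only: pderiv_smult Suc_eq_plus1[symmetric] pderiv_power_Suc)
      (simp add: pderiv_pCons one_pCons[symmetric])
  {
    case 0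
    have "unit_integral ([:0, 1:] ^ a) = 1 / real (a + 1)"
      using unit_integral_pderiv[of "smult (1 / real (a + 1)) ([:0, 1:] ^ (a + 1))"]
      unfolding antideriv by (simp add: poly_power)
    then show ?case by (simp add: fact_Suc del: of_nat_Suc)
  next
    case (Suc b)
    have "unit_integral ([:0, 1:] ^ a * [:1, -1:] ^ Suc b)
        = - unit_integral (pderiv ([:1, -1:] ^ Suc b) * smult (1 / real (a + 1)) ([:0, 1:] ^ (a + 1)))"
      using unit_integral_by_parts[of "[:1, -1:] ^ Suc b" "smult (1 / real (a + 1)) ([:0, 1:] ^ (a + 1))"]
      unfolding antideriv by (simp add: mult.commute)
    also have "pderiv ([:1, -1:] ^ Suc b) = smult (- real (b + 1)) ([:1, -1::real:] ^ b)"
      by (simp only: pderiv_power_Suc) (simp add: pderiv_pCons)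
    also have "\<dots> * smult (1 / real (a + 1)) ([:0, 1:] ^ (a + 1))
        = smult (- real (b + 1) / real (a + 1)) ([:0, 1:] ^ (a + 1) * [:1, -1:] ^ b)"
      by (simp add: mult.commute)
    also have "- unit_integral \<dots> = real (b + 1) / real (a + 1) * (fact (a + 1) * fact b / fact (a + 1 + b + 1))"
      unfolding unit_integral_smult Suc.IH by (simp only: minus_divide_left[symmetric] mult_minus_left minus_minus)
    also have "\<dots> = fact a * fact (Suc b) / fact (a + Suc b + 1)"
      by (simp add: fact_Suc field_simps del: of_nat_Suc)
    finally show ?case .
  }
qed

text \<open>The polynomial \<open>(s (1 - s))\<^sup>m\<close>, whose \<open>m\<close>-th derivative is a Legendre polynomial (Rodrigues).\<close>

definition unit_bump :: "nat \<Rightarrow> real poly" where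
  "unit_bump m = ([:0, 1:] * [:1, -1:]) ^ m"

lemma unit_integral_bump: "unit_integral (unit_bump m) = (fact m)\<^sup>2 / fact (2 * m + 1)"
  using unit_integral_beta[of m m]
  by (simp only: unit_bump_def power_mult_distrib power2_eq_square mult_2)

lemma power_dvd_pderiv:
  fixes f :: "real poly"
  assumes "f ^ Suc n dvd g"
  shows "f ^ n dvd pderiv g"
proof -
  obtain h where "g = f ^ Suc n * h" using assms by blast
  then have "pderiv g = f ^ n * (f * pderiv h + smult (real (Suc n)) (h * pderiv f))"
    by (simp only: pderiv_mult pderiv_power_Suc) (simp add: algebra_simps)
  then show ?thesis by simp
qed

lemma bump_derivative_boundary:
  assumes "j < m" "s = 0 \<or> s = 1"
  shows "poly ((pderiv ^^ j) (unit_bump m)) s = 0"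
proof -
  have "([:0, 1:] * [:1, -1:]) ^ (m - j) dvd (pderiv ^^ j) (unit_bump m)" if "j \<le> m"
    using that
  proof (induction j)
    case (Suc j)
    then have "([:0, 1:] * [:1, -1:]) ^ Suc (m - Suc j) dvd (pderiv ^^ j) (unit_bump m)"
      by (simp add: Suc_diff_Suc Suc_le_eq del: power_Suc)
    then show ?case by (simp only: funpow.simps o_apply power_dvd_pderiv)
  qed (simp add: unit_bump_def)
  then obtain h where "(pderiv ^^ j) (unit_bump m) = ([:0, 1:] * [:1, -1:]) ^ (m - j) * h"
    using assms by auto
  then show ?thesis using assms by (auto simp: poly_power)
qed

text \<open>Repeated integration by parts; the boundary terms vanish because the derivatives of the bump of
order below \<open>m\<close> vanish at both ends.\<close>

lemma unit_integral_bump_derivative: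
  "j \<le> m \<Longrightarrow> unit_integral (p * (pderiv ^^ j) (unit_bump m))
    = (-1) ^ j * unit_integral ((pderiv ^^ j) p * unit_bump m)"
proof (induction j arbitrary: p)
  case (Suc j)
  have "unit_integral (p * (pderiv ^^ Suc j) (unit_bump m))
      = - unit_integral (pderiv p * (pderiv ^^ j) (unit_bump m))"
    using unit_integral_by_parts[of p "(pderiv ^^ j) (unit_bump m)"] Suc.prems
    by (simp add: bump_derivative_boundary)
  then show ?case using Suc by (simp add: funpow_swap1)
qed simp

text \<open>The squared \<open>L\<^sup>2\<close> norm over \<open>[0, 1]\<close> of the Legendre polynomial normalized to have leading coefficient
\<open>(-1)\<^sup>m / m!\<close>; it equals \<open>1 / ((2 m + 1)! (2 m choose m))\<close>.\<close>

definition legendre_norm :: "nat \<Rightarrow> real" where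
  "legendre_norm m = (fact m)\<^sup>2 / (fact (2 * m) * fact (2 * m + 1))"

lemma legendre_norm_pos: "0 < legendre_norm m"
  by (simp add: legendre_norm_def)

text \<open>The last property says at once that \<open>P\<close> is orthogonal to all polynomials of lower degree and what its
pairing with a polynomial of degree \<open>m\<close> is. The normalization of the leading coefficient is that of
\<open>s\<^sup>m\<close> in the expansion of \<open>exp (- s)\<close>.\<close>

lemma legendre_polynomial:
  obtains P :: "real poly" where "degree P \<le> m" "coeff P m = (-1) ^ m / fact m"
    "\<And>p. degree p \<le> m \<Longrightarrow> unit_integral (p * P) = (-1) ^ m * fact m * coeff p m * legendre_norm m"
proof
  let ?G = "(pderiv ^^ m) (unit_bump m)"
  let ?P = "smult (1 / fact (2 * m)) ?G"
  have "degree ([:0, 1:] * [:1, -1:] :: real poly) = 2" by simp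
  then have deg: "degree (unit_bump m) = 2 * m"
    by (simp add: unit_bump_def degree_power_eq mult.commute)
  show "degree ?P \<le> m"
  proof (rule degree_le, intro allI impI)
    fix i assume "m < i"
    then show "coeff ?P i = 0" by (simp add: coeff_higher_pderiv coeff_eq_0 deg)
  qed
  have "lead_coeff (unit_bump m) = (-1) ^ m"
    unfolding unit_bump_def lead_coeff_power by simp
  moreover have "pochhammer (real (Suc m)) m = fact (2 * m) / fact m"
  proof -
    have "fact (2 * m) = fact m * (pochhammer (1 + real m) m)"
      using pochhammer_product[of m "2 * m" "1::real"] by (simp add: pochhammer_fact)
    then show ?thesis by (simp add: add.commute)
  qed
  ultimately show "coeff ?P m = (-1) ^ m / fact m"
    by (simp add: coeff_higher_pderiv deg mult_2[symmetric] del: of_nat_Suc)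
  show "unit_integral (p * ?P) = (-1) ^ m * fact m * coeff p m * legendre_norm m" if "degree p \<le> m" for p
  proof -
    have "(pderiv ^^ m) p = [:fact m * coeff p m:]"
    proof (rule poly_eqI)
      fix n
      show "coeff ((pderiv ^^ m) p) n = coeff [:fact m * coeff p m:] n"
        using that by (cases n) (simp_all add: coeff_higher_pderiv coeff_eq_0 pochhammer_fact)
    qed
    then have "unit_integral (p * ?G) = (-1) ^ m * (fact m * coeff p m * unit_integral (unit_bump m))"
      by (simp add: unit_integral_bump_derivative unit_integral_smult)
    then show ?thesis
      by (simp add: unit_integral_smult unit_integral_bump legendre_norm_def)
  qed
qed

section \<open>The defect of the semigroup\<close>

lemma exp_taylor_remainder:
  fixes X :: "'b::{real_normed_algebra_1,banach}"
  shows "norm (exp X - (\<Sum>k\<le>n. X ^ k /\<^sub>R fact k)) \<le> norm X ^ (n + 1) * exp (norm X)"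
proof -
  have s: "summable (\<lambda>k. norm X ^ k /\<^sub>R fact k)" by (rule summable_exp_generic)
  have le: "norm (X ^ (k + (n + 1)) /\<^sub>R fact (k + (n + 1))) \<le> norm X ^ (n + 1) * (norm X ^ k /\<^sub>R fact k)" for k
  proof -
    have "norm (X ^ (k + (n + 1)) /\<^sub>R fact (k + (n + 1))) \<le> norm X ^ (k + (n + 1)) / fact (k + (n + 1))"
      by (simp add: norm_power_ineq divide_inverse mult.commute mult_left_mono del: power_Suc add_Suc_right)
    also have "\<dots> \<le> norm X ^ (k + (n + 1)) / fact k"
      by (intro divide_left_mono fact_mono) (auto simp: fact_mono)
    finally show ?thesis by (simp add: power_add divide_inverse mult_ac)
  qed
  have "exp X - (\<Sum>k\<le>n. X ^ k /\<^sub>R fact k) = (\<Sum>k. X ^ (k + (n + 1)) /\<^sub>R fact (k + (n + 1)))"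
    using exp_first_terms[of X "n + 1"] by (simp add: lessThan_Suc_atMost)
  also have "norm \<dots> \<le> (\<Sum>k. norm X ^ (n + 1) * (norm X ^ k /\<^sub>R fact k))"
    by (rule norm_suminf_le[OF le summable_mult[OF s]])
  also have "\<dots> = norm X ^ (n + 1) * exp (norm X)"
    by (simp only: suminf_mult[OF s] exp_def)
  finally show ?thesis .
qed

definition exp_poly :: "nat \<Rightarrow> real \<Rightarrow> real poly" where
  "exp_poly n s = (\<Sum>k\<le>n. monom ((- s) ^ k / fact k) k)"

lemma coeff_exp_poly: "coeff (exp_poly n s) k = (if k \<le> n then (- s) ^ k / fact k else 0)"
proof -
  have "coeff (exp_poly n s) k = (\<Sum>i\<le>n. if i = k then (- s) ^ i / fact i else 0)"
    by (simp add: exp_poly_def coeff_sum)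
  then show ?thesis by simp
qed

lemma degree_exp_poly: "degree (exp_poly n s) \<le> n"
  by (rule degree_le) (simp add: coeff_exp_poly)

lemma exp_poly_remainder:
  fixes B :: "'a::complex_hilbert bop"
  assumes "0 < t" "t \<le> 1" "0 \<le> s" "s \<le> 1"
  shows "norm (exp (s *\<^sub>R (- (t *\<^sub>R B))) - op_poly (exp_poly n s) (t *\<^sub>R B))
    \<le> norm B ^ (n + 1) * exp (norm B) * t ^ (n + 1)"
proof -
  let ?X = "s *\<^sub>R (- (t *\<^sub>R B))"
  have X: "?X = (- s) *\<^sub>R (t *\<^sub>R B)" by simp
  have "op_poly (exp_poly n s) (t *\<^sub>R B) = (\<Sum>k\<le>n. ?X ^ k /\<^sub>R fact k)"
    unfolding X op_poly_altdef[OF degree_exp_poly] scaleR_power[of "- s"]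
    by (simp add: coeff_exp_poly divide_inverse mult_ac)
  then have "norm (exp ?X - op_poly (exp_poly n s) (t *\<^sub>R B)) \<le> norm ?X ^ (n + 1) * exp (norm ?X)"
    using exp_taylor_remainder[of ?X n] by simp
  also have "\<dots> \<le> (t * norm B) ^ (n + 1) * exp (norm B)"
  proof (intro mult_mono power_mono)
    have "s * (t * norm B) \<le> 1 * (t * norm B)" using assms by (intro mult_right_mono) auto
    then show "norm ?X \<le> t * norm B" using assms by simp
    also have "\<dots> \<le> norm B" using assms by (simp add: mult_left_le_one_le)
    finally show "exp (norm ?X) \<le> exp (norm B)" by simp
  qed (use assms in auto)
  finally show ?thesis by (simp add: power_mult_distrib mult_ac)
qed

text \<open>The integrand is minus the derivative of \<open>\<parallel>exp (- s t B) x\<parallel>\<^sup>2\<close> in \<open>s\<close>. Rescaling time to the unit interval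
makes the integration domain independent of \<open>t\<close>.\<close>

lemma semigroup_defect:
  fixes S B :: "'a::complex_hilbert bop"
  assumes S: "\<And>x. (norm (S x))\<^sup>2 = rinner x (B x)"
  shows "((\<lambda>s. 2 * t * (norm (S (exp (s *\<^sub>R (- (t *\<^sub>R B))) x)))\<^sup>2) has_integral
    (norm x)\<^sup>2 - (norm (exp (- (t *\<^sub>R B)) x))\<^sup>2) {0..1}"
proof -
  let ?A = "- (t *\<^sub>R B)"
  define u where "u s = bop_apply (exp (s *\<^sub>R ?A)) x" for s
  have "(u has_vector_derivative ?A (u s)) (at s within {0..1})" for s
    unfolding u_def bop_apply_times[symmetric]
    by (intro bounded_linear.has_vector_derivative[OF bop_apply.bounded_linear_left]
        has_vector_derivative_at_within[OF exp_scaleR_has_vector_derivative_left])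
  then have "((\<lambda>s. - rinner (u s) (u s)) has_vector_derivative
      - (rinner (u s) (?A (u s)) + rinner (?A (u s)) (u s))) (at s within {0..1})" for s
    by (intro derivative_intros rinner.has_vector_derivative)
  moreover have "- (rinner (u s) (?A (u s)) + rinner (?A (u s)) (u s)) = 2 * t * (norm (S (u s)))\<^sup>2" for s
    using rinner_commute[of "B (u s)" "u s"]
    by (simp add: S bop_apply_minus bop_apply_scaleR rinner.minus_right rinner.minus_left
        rinner.scaleR_left rinner.scaleR_right)
  ultimately have "((\<lambda>s. 2 * t * (norm (S (u s)))\<^sup>2) has_integral - rinner (u 1) (u 1) - - rinner (u 0) (u 0)) {0..1}"
    by (intro fundamental_theorem_of_calculus) auto
  then show ?thesis by (simp add: u_def rinner_self)
qed

lemma semigroup_contraction: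
  fixes S B :: "'a::complex_hilbert bop"
  assumes S: "\<And>x. (norm (S x))\<^sup>2 = rinner x (B x)" and "0 \<le> t"
  shows "norm (exp (- (t *\<^sub>R B))) \<le> 1"
proof (rule norm_bop_le)
  fix x
  have "0 \<le> (norm x)\<^sup>2 - (norm (exp (- (t *\<^sub>R B)) x))\<^sup>2"
    by (rule has_integral_nonneg[OF semigroup_defect[OF S]]) (use assms(2) in simp)
  then have "(norm (exp (- (t *\<^sub>R B)) x))\<^sup>2 \<le> (norm x)\<^sup>2" by simp
  from power2_le_imp_le[OF this] show "norm (exp (- (t *\<^sub>R B)) x) \<le> 1 * norm x" by simp
qed simp

text \<open>Completing the square with \<open>P\<close> the Legendre polynomial of degree \<open>p\<close>,
\<open>\<parallel>f\<parallel>\<^sup>2 \<ge> 2 P \<langle>f, v\<rangle> - P\<^sup>2 \<parallel>v\<parallel>\<^sup>2\<close> for every vector \<open>v\<close>. For \<open>f = S exp (- s t B) x\<close>, orthogonality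
removes the Taylor terms below \<open>p\<close> from the integral of \<open>P \<langle>f, v\<rangle>\<close>, and those above \<open>p\<close> are absorbed
in the error. The choice \<open>v = t\<^sup>p S B\<^sup>p x\<close> is the optimal one.\<close>

lemma semigroup_defect_lower:
  fixes S B :: "'a::complex_hilbert bop"
  assumes S: "\<And>x. (norm (S x))\<^sup>2 = rinner x (B x)"
  shows "\<exists>C\<ge>0. \<forall>t x. 0 < t \<and> t \<le> 1 \<and> norm x = 1 \<longrightarrow>
      2 * legendre_norm p * t ^ (2 * p + 1) * ((norm ((S * B ^ p) x))\<^sup>2 - C * t)
        \<le> 1 - (norm (exp (- (t *\<^sub>R B)) x))\<^sup>2"
proof -
  obtain P where P: "degree P \<le> p" "coeff P p = (-1) ^ p / fact p"
    and P_int: "\<And>r. degree r \<le> p \<Longrightarrow> unit_integral (r * P) = (-1) ^ p * fact p * coeff r p * legendre_norm p"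
    using legendre_polynomial[of p] by blast
  have "compact (poly P ` {0..1})" by (intro compact_continuous_image continuous_intros) simp
  then have "bounded (poly P ` {0..1})" by (rule compact_imp_bounded)
  then obtain A where "\<forall>v\<in>poly P ` {0..1}. \<bar>v\<bar> \<le> A"
    unfolding bounded_real by blast
  then have A: "\<bar>poly P s\<bar> \<le> A" if "s \<in> {0..1}" for s using that by blast
  have A0: "0 \<le> A" using A[of 0] by simp
  define M where "M = norm S * (norm B ^ (p + 1) * exp (norm B))"
  have M0: "0 \<le> M" by (simp add: M_def)
  define N where "N = norm (S * B ^ p)"
  define C where "C = 2 * A * M * N"
  have C0: "0 \<le> C" using A0 M0 by (simp add: C_def N_def)
  show ?thesis
  proof (intro exI[of _ "C / legendre_norm p"] conjI allI impI; (elim conjE)?)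
    show "0 \<le> C / legendre_norm p" using C0 legendre_norm_pos[of p] by (simp add: divide_nonneg_pos)
  next
    fix t :: real and x :: 'a assume t: "0 < t" "t \<le> 1" and x: "norm x = 1"
    define h where "h k = (S * B ^ k) x" for k
    define v where "v = t ^ p *\<^sub>R h p"
    have hp: "norm (h p) \<le> N"
      using norm_bop_apply[of "S * B ^ p" x] x by (simp add: h_def N_def)
    define g where "g = (\<Sum>k\<le>p. monom ((- t) ^ k / fact k * rinner (h k) v) k)"
    have g_deg: "degree g \<le> p"
      unfolding g_def by (intro degree_sum_le) (auto intro: order_trans[OF degree_monom_le])
    have "coeff g p = (\<Sum>k\<le>p. if k = p then (- t) ^ k / fact k * rinner (h k) v else 0)"
      by (simp add: g_def coeff_sum)
    then have g_coeff: "coeff g p = (- t) ^ p / fact p * (t ^ p * (norm (h p))\<^sup>2)"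
      by (simp add: v_def rinner.scaleR_right rinner_self)
    let ?f = "\<lambda>s. S (exp (s *\<^sub>R (- (t *\<^sub>R B))) x)"
    let ?q = "smult 2 (g * P) - smult ((norm v)\<^sup>2) (P * P)"
    have pointwise: "poly ?q s - C * t ^ (2 * p + 1) \<le> (norm (?f s))\<^sup>2" if s: "s \<in> {0..1}" for s
    proof -
      define r where "r = ?f s - (S * op_poly (exp_poly p s) (t *\<^sub>R B)) x"
      have "norm (exp (s *\<^sub>R (- (t *\<^sub>R B))) - op_poly (exp_poly p s) (t *\<^sub>R B))
          \<le> norm B ^ (p + 1) * exp (norm B) * t ^ (p + 1)"
        by (rule exp_poly_remainder) (use t s in auto)
      then have "norm S * norm (exp (s *\<^sub>R (- (t *\<^sub>R B))) - op_poly (exp_poly p s) (t *\<^sub>R B))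
          \<le> norm S * (norm B ^ (p + 1) * exp (norm B) * t ^ (p + 1))"
        by (rule mult_left_mono) simp
      also have "\<dots> = M * t ^ (p + 1)" by (simp only: M_def mult.assoc)
      finally have le_M: "norm S * norm (exp (s *\<^sub>R (- (t *\<^sub>R B))) - op_poly (exp_poly p s) (t *\<^sub>R B))
          \<le> M * t ^ (p + 1)" .
      have "r = (S * (exp (s *\<^sub>R (- (t *\<^sub>R B))) - op_poly (exp_poly p s) (t *\<^sub>R B))) x"
        by (simp add: r_def bop_apply_times bop_apply_diff bop_apply.diff_right)
      then have "norm r \<le> norm S * norm (exp (s *\<^sub>R (- (t *\<^sub>R B))) - op_poly (exp_poly p s) (t *\<^sub>R B))"
        using norm_bop_apply[of "S * (exp (s *\<^sub>R (- (t *\<^sub>R B))) - op_poly (exp_poly p s) (t *\<^sub>R B))" x]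
          norm_mult_ineq[of S "exp (s *\<^sub>R (- (t *\<^sub>R B))) - op_poly (exp_poly p s) (t *\<^sub>R B)"] x
        by simp
      with le_M have r: "norm r \<le> M * t ^ (p + 1)" by (rule order_trans[rotated])
      have v: "norm v \<le> t ^ p * N" using t hp by (simp add: v_def mult_left_mono)
      have "op_poly (exp_poly p s) (t *\<^sub>R B) = (\<Sum>k\<le>p. ((- s) ^ k / fact k * t ^ k) *\<^sub>R B ^ k)"
        by (simp add: op_poly_altdef[OF degree_exp_poly] coeff_exp_poly scaleR_power)
      then have "(S * op_poly (exp_poly p s) (t *\<^sub>R B)) x = (\<Sum>k\<le>p. ((- s) ^ k / fact k * t ^ k) *\<^sub>R h k)"
        by (simp add: h_def sum_distrib_left bop_apply.sum_left bop_apply_scaleR)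
      then have "rinner ((S * op_poly (exp_poly p s) (t *\<^sub>R B)) x) v
          = (\<Sum>k\<le>p. ((- s) ^ k * t ^ k) / fact k * rinner (h k) v)"
        by (simp add: rinner.sum_left rinner.scaleR_left)
      also have "\<dots> = (\<Sum>k\<le>p. ((- t) ^ k * s ^ k) / fact k * rinner (h k) v)"
        by (simp only: power_mult_distrib[symmetric] mult_minus_left mult.commute[of s])
      also have "\<dots> = poly g s"
        unfolding g_def poly_sum poly_monom by (intro sum.cong) auto
      finally have "rinner ((S * op_poly (exp_poly p s) (t *\<^sub>R B)) x) v = poly g s" .
      then have fv: "rinner (?f s) v = poly g s + rinner r v"
        by (simp add: r_def rinner.diff_left)
      have "\<bar>poly P s * rinner r v\<bar> \<le> A * (norm r * norm v)"
        unfolding abs_mult using A[OF s] A0 rinner_Cauchy_Schwarz[of r v] by (intro mult_mono) auto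
      also have "\<dots> \<le> A * ((M * t ^ (p + 1)) * (t ^ p * N))"
        using A0 r v t M0 by (intro mult_left_mono mult_mono) auto
      also have "2 * \<dots> = C * t ^ (2 * p + 1)"
      proof -
        have "t ^ (2 * p + 1) = t ^ (p + 1) * t ^ p"
          unfolding power_add[symmetric] by (rule arg_cong[of _ _ "power t"]) simp
        then show ?thesis by (simp only: C_def mult_ac)
      qed
      finally have err: "2 * \<bar>poly P s * rinner r v\<bar> \<le> C * t ^ (2 * p + 1)" by simp
      have "0 \<le> (norm (?f s - poly P s *\<^sub>R v))\<^sup>2" by simp
      also have "\<dots> = (norm (?f s))\<^sup>2 - 2 * poly P s * (poly g s + rinner r v) + (poly P s)\<^sup>2 * (norm v)\<^sup>2"
        by (simp only: norm_diff_power2 rinner.scaleR_right fv norm_scaleR real_scaleR_def power_mult_distrib power2_abs mult.assoc)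
      finally have "2 * poly P s * poly g s + 2 * (poly P s * rinner r v) - (norm v)\<^sup>2 * (poly P s)\<^sup>2
          \<le> (norm (?f s))\<^sup>2"
        by (simp add: distrib_left mult.assoc mult.commute[of "(norm v)\<^sup>2"])
      moreover have "- (C * t ^ (2 * p + 1)) \<le> 2 * (poly P s * rinner r v)"
        using err by linarith
      moreover have "poly ?q s = 2 * poly P s * poly g s - (norm v)\<^sup>2 * (poly P s)\<^sup>2"
        by (simp add: power2_eq_square)
      ultimately show ?thesis by linarith
    qed
    have "unit_integral ?q = 2 * unit_integral (g * P) - (norm v)\<^sup>2 * unit_integral (P * P)"
      using unit_integral_add[of "smult 2 (g * P)" "smult (- (norm v)\<^sup>2) (P * P)"]
      unfolding unit_integral_smult by (simp only: smult_minus_left add_uminus_conv_diff mult_minus_left)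
    moreover have "unit_integral (g * P) = legendre_norm p * (t ^ (2 * p) * (norm (h p))\<^sup>2)"
    proof -
      have "(-1) ^ p * (- t) ^ p = t ^ p" by (simp flip: power_mult_distrib)
      then have "unit_integral (g * P) = t ^ p * (t ^ p * (norm (h p))\<^sup>2) * legendre_norm p"
        unfolding P_int[OF g_deg] g_coeff by simp
      then show ?thesis by (simp add: power_even_eq power2_eq_square)
    qed
    moreover have "unit_integral (P * P) = legendre_norm p"
      unfolding P_int[OF P(1)] P(2) by simp
    moreover have "(norm v)\<^sup>2 = t ^ (2 * p) * (norm (h p))\<^sup>2"
      by (simp add: v_def power_mult_distrib power_even_eq)
    ultimately have q_int: "unit_integral ?q = legendre_norm p * (t ^ (2 * p) * (norm (h p))\<^sup>2)"
      by (simp only:) (simp add: algebra_simps)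
    have "((\<lambda>s. 2 * t * (poly ?q s - C * t ^ (2 * p + 1))) has_integral
        2 * t * (unit_integral ?q - C * t ^ (2 * p + 1))) {0..1}"
      using has_integral_const_real[of "C * t ^ (2 * p + 1)" 0 1]
      by (intro has_integral_mult_right[OF has_integral_diff[OF has_unit_integral]]) simp
    from has_integral_le[OF this semigroup_defect[OF S, of t x]]
    have "2 * t * (unit_integral ?q - C * t ^ (2 * p + 1)) \<le> 1 - (norm (exp (- (t *\<^sub>R B)) x))\<^sup>2"
      using pointwise t x by (simp add: mult_left_mono)
    moreover have "2 * t * (unit_integral ?q - C * t ^ (2 * p + 1))
        = 2 * legendre_norm p * t ^ (2 * p + 1) * ((norm ((S * B ^ p) x))\<^sup>2 - C / legendre_norm p * t)"
      unfolding q_int using legendre_norm_pos[of p] by (simp add: h_def algebra_simps)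
    ultimately show "2 * legendre_norm p * t ^ (2 * p + 1) * ((norm ((S * B ^ p) x))\<^sup>2 - C / legendre_norm p * t)
        \<le> 1 - (norm (exp (- (t *\<^sub>R B)) x))\<^sup>2" by (simp only:)
  qed
qed

section \<open>Optimal initial vectors for the semigroup\<close>

lemma norm_op_poly_le:
  fixes B :: "'b::real_normed_algebra_1"
  assumes "0 \<le> t" "t \<le> 1"
  shows "norm (op_poly p (t *\<^sub>R B)) \<le> (\<Sum>i\<le>degree p. \<bar>coeff p i\<bar> * norm B ^ i)"
  unfolding op_poly_def
proof (rule sum_norm_le)
  fix i
  have "norm ((t *\<^sub>R B) ^ i) \<le> norm (t *\<^sub>R B) ^ i" by (rule norm_power_ineq)
  also have "\<dots> \<le> norm B ^ i"
    using assms by (intro power_mono) (auto simp: mult_left_le_one_le)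
  finally show "norm (coeff p i *\<^sub>R (t *\<^sub>R B) ^ i) \<le> \<bar>coeff p i\<bar> * norm B ^ i"
    by (simp only: norm_scaleR mult_left_mono abs_ge_zero)
qed

lemma op_poly_near_one:
  fixes B :: "'b::real_normed_algebra_1"
  assumes "coeff p 0 = 1"
  shows "\<exists>C\<ge>0. \<forall>t. 0 < t \<and> t \<le> 1 \<longrightarrow> norm (op_poly p (t *\<^sub>R B) - 1) \<le> C * t"
proof -
  obtain q where p: "p = pCons 1 q" using assms by (metis coeff_pCons_0 pCons_cases)
  let ?c = "\<Sum>i\<le>degree q. \<bar>coeff q i\<bar> * norm B ^ i"
  have "0 \<le> ?c" by (intro sum_nonneg) simp
  moreover have "norm (op_poly p (t *\<^sub>R B) - 1) \<le> norm B * ?c * t" if t: "0 < t" "t \<le> 1" for t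
  proof -
    have "norm (op_poly p (t *\<^sub>R B) - 1) \<le> norm (t *\<^sub>R B) * norm (op_poly q (t *\<^sub>R B))"
      by (simp add: p op_poly_pCons norm_mult_ineq[of "t *\<^sub>R B", simplified])
    also have "\<dots> \<le> norm (t *\<^sub>R B) * ?c"
      using t by (intro mult_left_mono norm_op_poly_le) auto
    finally show ?thesis using t by (simp add: mult_ac)
  qed
  ultimately show ?thesis by (intro exI[of _ "norm B * ?c"]) simp
qed

text \<open>The lower bound is attained to leading order when \<open>S exp (- s t B) x\<close> is close to
\<open>t\<^sup>m P s\<close> times \<open>S B\<^sup>m y\<close>, with \<open>P\<close> the Legendre polynomial. Starting from \<open>y\<close> in the near kernel, this
is achieved by \<open>x = Q (t B) y\<close>, where the coefficients of \<open>Q\<close> are chosen such that the coefficient of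
\<open>u\<^sup>m\<close> in \<open>exp (- s u) Q u\<close> is \<open>P s\<close>. The leading coefficient of \<open>P\<close> makes \<open>Q 0 = 1\<close>, so \<open>x\<close> is close
to \<open>y\<close>.\<close>

lemma semigroup_defect_upper:
  fixes S B :: "'a::complex_hilbert bop"
  assumes S: "\<And>x. (norm (S x))\<^sup>2 = rinner x (B x)"
  shows "\<exists>C\<ge>0. \<forall>t y. 0 < t \<and> t \<le> 1 \<and> y \<in> near_kernel S B m (t ^ (m + 1)) \<longrightarrow>
      (\<exists>x. 1 - C * t \<le> norm x \<and> (norm x)\<^sup>2 - (norm (exp (- (t *\<^sub>R B)) x))\<^sup>2
        \<le> 2 * legendre_norm m * t ^ (2 * m + 1) * ((norm ((S * B ^ m) y))\<^sup>2 + C * t))"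
proof -
  obtain P where P: "degree P \<le> m" "coeff P m = (-1) ^ m / fact m"
    and P_int: "\<And>r. degree r \<le> m \<Longrightarrow> unit_integral (r * P) = (-1) ^ m * fact m * coeff r m * legendre_norm m"
    using legendre_polynomial[of m] by blast
  \<comment> \<open>The factor \<open>(-1) ^ (m - l) * fact (m - l)\<close> cancels the Taylor coefficient of \<open>exp (- s)\<close> which
    \<open>coeff Q l\<close> meets in the product.\<close>
  define Q where "Q = (\<Sum>l\<le>m. monom ((-1) ^ (m - l) * fact (m - l) * coeff P (m - l)) l)"
  have Q_coeff: "coeff Q l = (if l \<le> m then (-1) ^ (m - l) * fact (m - l) * coeff P (m - l) else 0)" for l
  proof -
    have "coeff Q l = (\<Sum>i\<le>m. if i = l then (-1) ^ (m - i) * fact (m - i) * coeff P (m - i) else 0)"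
      by (simp add: Q_def coeff_sum)
    then show ?thesis by simp
  qed
  have Q_deg: "degree Q \<le> m" by (rule degree_le) (simp add: Q_coeff)
  have "coeff Q 0 = 1" by (simp add: Q_coeff P power_mult_distrib[symmetric])
  then obtain C where C: "0 \<le> C" "\<And>t. 0 < t \<Longrightarrow> t \<le> 1 \<Longrightarrow> norm (op_poly Q (t *\<^sub>R B) - 1) \<le> C * t"
    using op_poly_near_one[of Q B] by blast
  define A where "A = (\<Sum>l\<le>m. \<bar>coeff Q l\<bar>)"
  have A0: "0 \<le> A" by (simp add: A_def sum_nonneg)
  define E where "E = norm S * (norm B ^ (m + 1) * exp (norm B)) * (1 + C)"
  have E0: "0 \<le> E" using C by (simp add: E_def)
  obtain K where K: "0 \<le> K" and K_bound: "\<And>r t y w. degree r \<le> m + m \<Longrightarrow> (\<And>k. \<bar>coeff r k\<bar> \<le> A) \<Longrightarrow>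
      0 < t \<Longrightarrow> t \<le> 1 \<Longrightarrow> y \<in> near_kernel S B m (t ^ (m + 1)) \<Longrightarrow>
      norm (w - (S * op_poly r (t *\<^sub>R B)) y) \<le> E * t ^ (m + 1) \<Longrightarrow>
      (norm w)\<^sup>2 \<le> t ^ (2 * m) * ((coeff r m)\<^sup>2 * (norm ((S * B ^ m) y))\<^sup>2 + K * t)"
    using near_kernel_op_poly[OF A0 E0, where N = "m + m" and S = S and B = B and m = m] by blast
  define C' where "C' = C + K / legendre_norm m"
  have C': "C \<le> C'" "K / legendre_norm m \<le> C'" "0 \<le> C'"
    using C K legendre_norm_pos[of m] by (auto simp: C'_def divide_nonneg_pos add_nonneg_nonneg)
  show ?thesis
  proof (intro exI[of _ C'] conjI allI impI; (elim conjE)?)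
    show "0 \<le> C'" by (rule C')
  next
    fix t :: real and y assume t: "0 < t" "t \<le> 1" and y: "y \<in> near_kernel S B m (t ^ (m + 1))"
    then have ny: "norm y = 1" by (simp add: near_kernel_def)
    define x where "x = op_poly Q (t *\<^sub>R B) y"
    have "norm ((op_poly Q (t *\<^sub>R B) - 1) y) \<le> C * t"
      using norm_bop_apply[of "op_poly Q (t *\<^sub>R B) - 1" y] C(2)[OF t] ny by simp
    then have xy: "norm (x - y) \<le> C * t" by (simp add: x_def bop_apply_diff)
    have "1 - norm (x - y) \<le> norm x"
      using norm_triangle_ineq2[of y "y - x"] ny by (simp add: norm_minus_commute)
    moreover have "C * t \<le> C' * t" using t C' by (intro mult_right_mono) auto
    ultimately have nx: "1 - C' * t \<le> norm x" using xy by simp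
    have "norm x \<le> 1 + C * t"
      using norm_triangle_ineq[of y "x - y"] xy ny by simp
    also have "\<dots> \<le> 1 + C" using t C by (simp add: mult_left_le)
    finally have nx2: "norm x \<le> 1 + C" .
    let ?h = "(norm ((S * B ^ m) y))\<^sup>2"
    let ?f = "\<lambda>s. S (exp (s *\<^sub>R (- (t *\<^sub>R B))) x)"
    have pointwise: "(norm (?f s))\<^sup>2 \<le> t ^ (2 * m) * (?h * poly (P * P) s + K * t)" if s: "s \<in> {0..1}" for s
    proof -
      let ?r = "exp_poly m s * Q"
      have "coeff ?r m = (\<Sum>i\<le>m. coeff P i * s ^ i)"
        unfolding coeff_mult
      proof (rule sum.cong)
        fix i assume i: "i \<in> {..m}"
        have "(- s) ^ i = (-1) ^ i * s ^ i" by (rule power_minus)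
        then have "coeff (exp_poly m s) i * coeff Q (m - i) = ((-1) ^ i * (-1) ^ i) * (coeff P i * s ^ i)"
          using i by (simp add: coeff_exp_poly Q_coeff)
        also have "(-1) ^ i * (-1) ^ i = (1 :: real)" by (simp flip: power_mult_distrib)
        finally show "coeff (exp_poly m s) i * coeff Q (m - i) = coeff P i * s ^ i" by simp
      qed simp
      also have "\<dots> = poly P s"
        unfolding poly_altdef using P(1) by (intro sum.mono_neutral_right) (auto simp: coeff_eq_0)
      finally have r_m: "coeff ?r m = poly P s" .
      have r_le: "\<bar>coeff ?r k\<bar> \<le> A" for k
      proof -
        have "\<bar>coeff ?r k\<bar> \<le> (\<Sum>i\<le>k. \<bar>coeff (exp_poly m s) i * coeff Q (k - i)\<bar>)"
          unfolding coeff_mult by (rule sum_abs)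
        also have "\<dots> \<le> (\<Sum>i\<le>k. \<bar>coeff Q (k - i)\<bar>)"
        proof (rule sum_mono)
          fix i
          have "\<bar>(- s) ^ i\<bar> / fact i \<le> 1 / 1"
            using s by (intro frac_le) (auto simp: power_abs power_le_one)
          then have "\<bar>coeff (exp_poly m s) i\<bar> \<le> 1" by (simp add: coeff_exp_poly)
          then show "\<bar>coeff (exp_poly m s) i * coeff Q (k - i)\<bar> \<le> \<bar>coeff Q (k - i)\<bar>"
            by (simp add: abs_mult mult_left_le_one_le)
        qed
        also have "\<dots> = (\<Sum>i\<le>k. \<bar>coeff Q i\<bar>)"
          using sum.nat_diff_reindex[of "\<lambda>i. \<bar>coeff Q i\<bar>" "Suc k"] by (simp add: lessThan_Suc_atMost)
        also have "\<dots> \<le> (\<Sum>i\<le>k + m. \<bar>coeff Q i\<bar>)" by (rule sum_mono2) auto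
        also have "\<dots> = A"
          unfolding A_def by (rule sum.mono_neutral_right) (auto simp: Q_coeff)
        finally show ?thesis .
      qed
      let ?\<Delta> = "exp (s *\<^sub>R (- (t *\<^sub>R B))) - op_poly (exp_poly m s) (t *\<^sub>R B)"
      have "?f s - (S * op_poly ?r (t *\<^sub>R B)) y = (S * ?\<Delta>) x"
        by (simp add: x_def op_poly_mult bop_apply_times bop_apply_diff bop_apply.diff_right)
      also have "norm \<dots> \<le> norm (S * ?\<Delta>) * norm x" by (rule norm_bop_apply)
      also have "\<dots> \<le> (norm S * (norm B ^ (m + 1) * exp (norm B) * t ^ (m + 1))) * (1 + C)"
      proof (intro mult_mono nx2)
        have "norm ?\<Delta> \<le> norm B ^ (m + 1) * exp (norm B) * t ^ (m + 1)"
          by (rule exp_poly_remainder) (use t s in auto)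
        then show "norm (S * ?\<Delta>) \<le> norm S * (norm B ^ (m + 1) * exp (norm B) * t ^ (m + 1))"
          by (intro order_trans[OF norm_mult_ineq] mult_left_mono) auto
      qed (use t in auto)
      also have "\<dots> = E * t ^ (m + 1)" by (simp add: E_def mult_ac)
      finally have "norm (?f s - (S * op_poly ?r (t *\<^sub>R B)) y) \<le> E * t ^ (m + 1)" .
      moreover have "degree ?r \<le> m + m"
        by (rule order_trans[OF degree_mult_le]) (intro add_mono degree_exp_poly Q_deg)
      ultimately have "(norm (?f s))\<^sup>2 \<le> t ^ (2 * m) * ((coeff ?r m)\<^sup>2 * ?h + K * t)"
        by (intro K_bound r_le t y)
      then show ?thesis unfolding r_m by (simp add: power2_eq_square mult_ac)
    qed
    have PP: "unit_integral (P * P) = legendre_norm m"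
      unfolding P_int[OF P(1)] P(2) by simp
    have "((\<lambda>s. 2 * t * (t ^ (2 * m) * (?h * poly (P * P) s + K * t))) has_integral
        2 * t * (t ^ (2 * m) * (?h * unit_integral (P * P) + K * t))) {0..1}"
      using has_integral_const_real[of "K * t" 0 1]
      by (intro has_integral_mult_right[OF has_integral_mult_right[OF has_integral_add[OF
              has_integral_mult_right[OF has_unit_integral]]]]) (simp only: content_real, simp)
    from has_integral_le[OF semigroup_defect[OF S, of t x] this]
    have "(norm x)\<^sup>2 - (norm (exp (- (t *\<^sub>R B)) x))\<^sup>2 \<le> 2 * t * (t ^ (2 * m) * (?h * legendre_norm m + K * t))"
      using pointwise t unfolding PP by (simp add: mult_left_mono)
    also have "\<dots> = 2 * legendre_norm m * t ^ (2 * m + 1) * (?h + K / legendre_norm m * t)"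
      using legendre_norm_pos[of m] by (simp add: field_simps)
    also have "\<dots> \<le> 2 * legendre_norm m * t ^ (2 * m + 1) * (?h + C' * t)"
      using t C' legendre_norm_pos[of m] by (intro mult_left_mono add_left_mono mult_right_mono) auto
    finally show "\<exists>x. 1 - C' * t \<le> norm x \<and> (norm x)\<^sup>2 - (norm (exp (- (t *\<^sub>R B)) x))\<^sup>2
        \<le> 2 * legendre_norm m * t ^ (2 * m + 1) * (?h + C' * t)"
      using nx by blast
  qed
qed

section \<open>Binomial expansions and Krawtchouk matrices\<close>

lemma coeff_one_minus_X_power: "coeff ([:1, -1:] ^ p) i = (-1) ^ i * real (p choose i)"
proof (induction p arbitrary: i)
  case (Suc p)
  then show ?case by (cases i) (simp_all add: algebra_simps)
qed (simp add: coeff_pCons split: nat.split)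

lemma one_minus_power_expand:
  fixes D :: "'b::real_normed_algebra_1"
  shows "(1 - D) ^ p = (\<Sum>j\<le>p. (real (p choose j) * (-1) ^ j) *\<^sub>R D ^ j)"
proof -
  have deg: "degree ([:1, -1 :: real:] ^ p) \<le> p"
    by (rule order_trans[OF degree_power_le]) simp
  have "op_poly ([:1, -1:] ^ p) D = (\<Sum>j\<le>p. (real (p choose j) * (-1) ^ j) *\<^sub>R D ^ j)"
    unfolding op_poly_altdef[OF deg] coeff_one_minus_X_power by (simp only: mult.commute)
  then show ?thesis by (simp add: op_poly_power op_poly_pCons)
qed

lemma norm_power_minus_one_le:
  fixes R :: "'b::real_normed_algebra_1"
  assumes "norm R \<le> 1"
  shows "norm (R ^ n - 1) \<le> real n * norm (R - 1)"
proof (induction n)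
  case (Suc n)
  have "R ^ Suc n - 1 = R * (R ^ n - 1) + (R - 1)" by (simp add: algebra_simps)
  also have "norm \<dots> \<le> norm R * norm (R ^ n - 1) + norm (R - 1)"
    by (intro order_trans[OF norm_triangle_ineq] add_right_mono norm_mult_ineq)
  also have "\<dots> \<le> 1 * (real n * norm (R - 1)) + norm (R - 1)"
    using assms Suc by (intro add_right_mono mult_mono) auto
  finally show ?case by (simp add: algebra_simps)
qed simp

lemma degree_cayley_factors: "degree ([:1, 1 :: real:] ^ a * [:1, -1:] ^ b) \<le> a + b"
proof -
  have "degree ([:1, 1 :: real:] ^ a) \<le> a" "degree ([:1, -1 :: real:] ^ b) \<le> b"
    by (rule order_trans[OF degree_power_le], simp)+
  then show ?thesis by (intro order_trans[OF degree_mult_le] add_mono)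
qed

lemma op_poly_pcompose_linear: "op_poly (pcompose p [:0, c:]) X = op_poly p (c *\<^sub>R X)"
proof -
  have deg: "degree (pcompose p [:0, c:]) \<le> degree p"
    by (rule degree_le) (simp add: coeff_pcompose_linear coeff_eq_0)
  show ?thesis
    unfolding op_poly_altdef[OF deg] by (simp add: coeff_pcompose_linear op_poly_def scaleR_power mult.commute)
qed

text \<open>The Krawtchouk matrix of order \<open>m\<close>. Up to powers of \<open>1 + t B / 2\<close>, the steps of the Cayley transform
are the polynomials \<open>(1 + s)\<^bsup>m - k\<^esup> (1 - s)\<^sup>k\<close> in \<open>s = t B / 2\<close>.\<close>

definition krawtchouk :: "nat \<Rightarrow> nat \<Rightarrow> nat \<Rightarrow> real" where
  "krawtchouk m k i = coeff ([:1, 1:] ^ (m - k) * [:1, -1:] ^ k) i"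

text \<open>With \<open>z = (1 - s) / (1 + s)\<close> the left-hand side is \<open>(1 + s)\<^sup>m\<close> times the generating polynomial at \<open>z\<close>,
and \<open>1 + z\<close>, \<open>1 - z\<close> are \<open>2 / (1 + s)\<close>, \<open>2 s / (1 + s)\<close>. The extra factor \<open>[:1, 1:]\<close> in the proof
makes the identity trivial at the exceptional point \<open>s = -1\<close>.\<close>

lemma krawtchouk_generating:
  assumes k: "k \<le> m"
  shows "(\<Sum>i\<le>m. smult (krawtchouk m k i) ([:1, 1:] ^ (m - i) * [:1, -1:] ^ i)) = monom (2 ^ m) k"
    (is "?l = ?r")
proof -
  have "poly ((?l - ?r) * [:1, 1:]) s = 0" for s
  proof (cases "1 + s = 0")
    case False
    define z where "z = (1 - s) / (1 + s)"
    have z: "(1 + s) * z = 1 - s" "(1 + s) * (1 + z) = 2" "(1 + s) * (1 - z) = 2 * s"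
      using False by (simp_all add: z_def field_simps)
    have "poly ?l s = (\<Sum>i\<le>m. krawtchouk m k i * ((1 + s) ^ (m - i) * (1 - s) ^ i))"
      by (simp add: poly_sum poly_power)
    also have "\<dots> = (\<Sum>i\<le>m. (1 + s) ^ m * (krawtchouk m k i * z ^ i))"
    proof (rule sum.cong)
      fix i assume "i \<in> {..m}"
      then have "(1 + s) ^ m = (1 + s) ^ (m - i) * (1 + s) ^ i" by (simp flip: power_add)
      then show "krawtchouk m k i * ((1 + s) ^ (m - i) * (1 - s) ^ i) = (1 + s) ^ m * (krawtchouk m k i * z ^ i)"
        by (simp flip: z(1) add: power_mult_distrib)
    qed simp
    also have "\<dots> = (1 + s) ^ m * poly ([:1, 1:] ^ (m - k) * [:1, -1:] ^ k) z"
    proof -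
      have "degree ([:1, 1 :: real:] ^ (m - k) * [:1, -1:] ^ k) \<le> m"
        using degree_cayley_factors[of "m - k" k] k by simp
      then have "poly ([:1, 1:] ^ (m - k) * [:1, -1:] ^ k) z = (\<Sum>i\<le>m. krawtchouk m k i * z ^ i)"
        unfolding poly_altdef krawtchouk_def by (intro sum.mono_neutral_left) (auto simp: coeff_eq_0)
      then show ?thesis by (simp only: sum_distrib_left)
    qed
    also have "\<dots> = ((1 + s) ^ (m - k) * (1 + s) ^ k) * ((1 + z) ^ (m - k) * (1 - z) ^ k)"
      using k by (simp add: poly_power flip: power_add)
    also have "\<dots> = ((1 + s) * (1 + z)) ^ (m - k) * ((1 + s) * (1 - z)) ^ k"
      by (simp only: power_mult_distrib mult_ac)
    also have "\<dots> = 2 ^ (m - k) * 2 ^ k * s ^ k" by (simp only: z power_mult_distrib mult.assoc)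
    also have "\<dots> = poly ?r s" using k by (simp add: poly_monom flip: power_add)
    finally show ?thesis by simp
  next
    case True
    then have "poly [:1, 1:] s = 0" by simp
    then show ?thesis by (simp only: poly_mult mult_zero_right)
  qed
  then have "(?l - ?r) * [:1, 1:] = 0" using poly_all_0_iff_0 by blast
  then have "?l - ?r = 0" unfolding mult_eq_0_iff by simp
  then show ?thesis by (simp only: right_minus_eq)
qed

text \<open>Comparing coefficients in the previous identity shows that the matrix is its own inverse up to the
factor \<open>2\<^sup>m\<close>.\<close>

lemma krawtchouk_involution:
  assumes "k \<le> m"
  shows "(\<Sum>i\<le>m. krawtchouk m k i * krawtchouk m i r) = (if r = k then 2 ^ m else 0)"
  using arg_cong[OF krawtchouk_generating[OF assms], of "\<lambda>p. coeff p r"]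
  by (simp add: coeff_sum krawtchouk_def[of m _ r])

lemma sum_choose_square: "(\<Sum>j\<le>m. (real (m choose j))\<^sup>2) = real (2 * m choose m)"
  unfolding choose_square_sum[symmetric] by simp

text \<open>The counterpart of the Legendre construction: the vector of alternating binomial coefficients is, up to
scaling, the one of least Euclidean norm among those obtainable as
\<open>j \<mapsto> coeff ([:1, 1:] ^ (m - j) * [:1, -1:] ^ j * q) m\<close> with \<open>coeff q 0 = 1\<close>. Reaching it is a
linear system for the coefficients of \<open>q\<close> with the Krawtchouk matrix, solved by
\<open>krawtchouk_involution\<close>. That the solution satisfies \<open>coeff q 0 = 1\<close> is the identity
\<open>\<Sum> (m choose j)\<^sup>2 = (2 m choose m)\<close>.\<close>

lemma cayley_optimal_polynomial:
  "\<exists>q. degree q \<le> m \<and> coeff q 0 = 1 \<and> (\<forall>j\<le>m. coeff ([:1, 1:] ^ (m - j) * [:1, -1:] ^ j * q) m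
    = 2 ^ m * ((-1) ^ j * real (m choose j) / real (2 * m choose m)))"
proof -
  define a where "a j = (-1) ^ j * real (m choose j) / real (2 * m choose m)" for j
  define c where "c k = (\<Sum>i\<le>m. krawtchouk m k i * a i)" for k
  define q where "q = (\<Sum>l\<le>m. monom (c (m - l)) l)"
  have q_coeff: "coeff q l = (if l \<le> m then c (m - l) else 0)" for l
  proof -
    have "coeff q l = (\<Sum>i\<le>m. if i = l then c (m - i) else 0)"
      by (simp add: q_def coeff_sum)
    then show ?thesis by simp
  qed
  have "degree q \<le> m" by (rule degree_le) (simp add: q_coeff)
  moreover have "coeff q 0 = 1"
  proof -
    have "c m = (\<Sum>i\<le>m. (real (m choose i))\<^sup>2 / real (2 * m choose m))"
      unfolding c_def
    proof (rule sum.cong)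
      fix i
      have "(-1) ^ i * (-1) ^ i = (1 :: real)" by (simp flip: power_mult_distrib)
      then show "krawtchouk m m i * a i = (real (m choose i))\<^sup>2 / real (2 * m choose m)"
        by (simp add: krawtchouk_def coeff_one_minus_X_power a_def power2_eq_square mult_ac)
    qed simp
    then show ?thesis by (simp add: q_coeff sum_choose_square flip: sum_divide_distrib)
  qed
  moreover have "coeff ([:1, 1:] ^ (m - j) * [:1, -1:] ^ j * q) m = 2 ^ m * a j" if j: "j \<le> m" for j
  proof -
    have "coeff ([:1, 1:] ^ (m - j) * [:1, -1:] ^ j * q) m = (\<Sum>k\<le>m. krawtchouk m j k * c k)"
      unfolding coeff_mult[of "[:1, 1:] ^ (m - j) * [:1, -1:] ^ j"]
      by (intro sum.cong) (auto simp: q_coeff krawtchouk_def)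
    also have "\<dots> = (\<Sum>k\<le>m. \<Sum>i\<le>m. krawtchouk m j k * krawtchouk m k i * a i)"
      by (simp add: c_def sum_distrib_left mult.assoc)
    also have "\<dots> = (\<Sum>i\<le>m. \<Sum>k\<le>m. krawtchouk m j k * krawtchouk m k i * a i)"
      by (rule sum.swap)
    also have "\<dots> = (\<Sum>i\<le>m. (if i = j then 2 ^ m else 0) * a i)"
      by (simp only: sum_distrib_right[symmetric] krawtchouk_involution[OF j])
    also have "\<dots> = (\<Sum>i\<le>m. if i = j then 2 ^ m * a i else 0)"
      by (intro sum.cong) auto
    also have "\<dots> = 2 ^ m * a j" using j by simp
    finally show ?thesis .
  qed
  ultimately show ?thesis unfolding a_def by blast
qed

section \<open>The defect of the Cayley transform\<close>

definition resolvent :: "'a::complex_hilbert bop \<Rightarrow> real \<Rightarrow> 'a bop" where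
  "resolvent B t = op_inverse (1 + (t / 2) *\<^sub>R B)"

context
  fixes S B :: "'a::complex_hilbert bop"
  assumes S: "\<And>x. (norm (bop_apply S x))\<^sup>2 = rinner x (B x)"
begin

lemma shift_coercive: "0 < t \<Longrightarrow> (norm x)\<^sup>2 \<le> rinner x ((1 + (t / 2) *\<^sub>R B) x)"
  by (simp add: bop_apply_add bop_apply_scaleR rinner.add_right rinner.scaleR_right rinner_self flip: S)

lemma resolvent_inverse:
  assumes "0 < t"
  shows "resolvent B t * (1 + (t / 2) *\<^sub>R B) = 1" "(1 + (t / 2) *\<^sub>R B) * resolvent B t = 1"
  unfolding resolvent_def by (intro coercive_op_inverse shift_coercive assms)+

lemma norm_le_shift:
  assumes "0 < t"
  shows "norm x \<le> norm ((1 + (t / 2) *\<^sub>R B) x)"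
proof (cases "x = 0")
  case False
  have "(norm x)\<^sup>2 \<le> norm x * norm ((1 + (t / 2) *\<^sub>R B) x)"
    using shift_coercive[OF assms, of x] rinner_Cauchy_Schwarz[of x "(1 + (t / 2) *\<^sub>R B) x"] by linarith
  then show ?thesis using False by (simp add: power2_eq_square)
qed simp

lemma norm_le_shift_power: "0 < t \<Longrightarrow> norm x \<le> norm (((1 + (t / 2) *\<^sub>R B) ^ n) x)"
proof (induction n)
  case (Suc n)
  then show ?case
    using norm_le_shift[of t "((1 + (t / 2) *\<^sub>R B) ^ n) x"] by (simp add: bop_apply_times)
qed simp

lemma norm_resolvent: "0 < t \<Longrightarrow> norm (resolvent B t) \<le> 1"
proof (rule norm_bop_le)
  fix x assume "0 < t"
  then show "norm (resolvent B t x) \<le> 1 * norm x"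
    using norm_le_shift[of t "resolvent B t x"]
    by (simp add: resolvent_inverse flip: bop_apply_times)
qed simp

lemma cayley_eq:
  assumes "0 < t"
  shows "cayley t (- B) = 2 *\<^sub>R resolvent B t - 1"
    and "cayley t (- B) = (1 - (t / 2) *\<^sub>R B) * resolvent B t"
proof -
  let ?R = "resolvent B t" and ?X = "(t / 2) *\<^sub>R B"
  have RX: "?R * ?X = 1 - ?R" and XR: "?X * ?R = 1 - ?R"
    using resolvent_inverse[OF assms] unfolding distrib_left distrib_right mult_1_left mult_1_right
    by (metis add_diff_cancel_left')+
  have two: "2 *\<^sub>R ?R = ?R + ?R" by (rule scaleR_2)
  have "cayley t (- B) = ?R * (1 - ?X)"
    by (simp add: cayley_def resolvent_def)
  also have "\<dots> = ?R - ?R * ?X" by (simp only: right_diff_distrib mult_1_right)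
  finally show 1: "cayley t (- B) = 2 *\<^sub>R ?R - 1" by (simp only: RX two) simp
  have "(1 - ?X) * ?R = ?R - ?X * ?R" by (simp only: left_diff_distrib mult_1_left)
  then show "cayley t (- B) = (1 - ?X) * ?R" unfolding 1 two by (simp only: XR) simp
qed

text \<open>In terms of \<open>w = R x\<close> one has \<open>x = w + X w\<close> and \<open>D x = w - X w\<close> for \<open>X = t B / 2\<close>, and the difference of the
squared norms is four times the inner product of \<open>w\<close> and \<open>X w\<close>.\<close>

lemma cayley_step_defect:
  assumes t: "0 < t"
  shows "(norm x)\<^sup>2 - (norm (cayley t (- B) x))\<^sup>2 = 2 * t * (norm ((S * resolvent B t) x))\<^sup>2"
proof -
  define w where "w = resolvent B t x"
  define X where "X = (t / 2) *\<^sub>R B"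
  have x: "x = w + X w"
    using resolvent_inverse(2)[OF t] unfolding w_def X_def
    by (metis bop_apply_add bop_apply_one bop_apply_times)
  have "cayley t (- B) x = w - X w"
    by (simp add: cayley_eq(2)[OF t] bop_apply_times bop_apply_diff w_def X_def)
  then have "(norm x)\<^sup>2 - (norm (cayley t (- B) x))\<^sup>2 = 4 * rinner w (X w)"
    using x by (simp add: norm_add_power2 norm_diff_power2)
  also have "\<dots> = 2 * t * (norm (S w))\<^sup>2"
    by (simp add: X_def bop_apply_scaleR rinner.scaleR_right S)
  finally show ?thesis by (simp add: w_def bop_apply_times)
qed

lemma cayley_defect:
  assumes t: "0 < t"
  shows "(norm x)\<^sup>2 - (norm ((cayley t (- B) ^ n) x))\<^sup>2
    = 2 * t * (\<Sum>j<n. (norm ((S * resolvent B t * cayley t (- B) ^ j) x))\<^sup>2)"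
proof (induction n)
  case (Suc n)
  then show ?case
    using cayley_step_defect[OF t, of "(cayley t (- B) ^ n) x"]
    by (simp add: bop_apply_times distrib_left)
qed simp

lemma cayley_power_contraction:
  assumes t: "0 < t"
  shows "norm (cayley t (- B) ^ n) \<le> 1"
proof (rule norm_bop_le)
  fix x
  have "0 \<le> 2 * t * (\<Sum>j<n. (norm ((S * resolvent B t * cayley t (- B) ^ j) x))\<^sup>2)"
    using t by (intro mult_nonneg_nonneg sum_nonneg) auto
  then have "(norm ((cayley t (- B) ^ n) x))\<^sup>2 \<le> (norm x)\<^sup>2"
    unfolding cayley_defect[OF t, symmetric] by simp
  from power2_le_imp_le[OF this] show "norm ((cayley t (- B) ^ n) x) \<le> 1 * norm x" by simp
qed simp

text \<open>Composing with a power of \<open>1 + t B / 2\<close> clears all inverses. Vectors of the form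
\<open>(1 + t B / 2)\<^sup>n z\<close> thus allow exact polynomial computations at every step size.\<close>

lemma cayley_shift_power:
  assumes t: "0 < t" and j: "j < n"
  shows "resolvent B t * cayley t (- B) ^ j * (1 + (t / 2) *\<^sub>R B) ^ n
    = op_poly ([:1, 1:] ^ (n - 1 - j) * [:1, -1:] ^ j) ((t / 2) *\<^sub>R B)"
proof -
  define X where "X = (t / 2) *\<^sub>R B"
  define R where "R = resolvent B t"
  define V where "V = 1 + X"
  have RV: "R * V = 1" and VR: "V * R = 1"
    using resolvent_inverse[OF t] by (simp_all add: R_def V_def X_def)
  have D: "cayley t (- B) = (1 - X) * R" using cayley_eq(2)[OF t] by (simp add: X_def R_def)
  have XR: "X * R = R * X"
    using RV VR unfolding V_def distrib_left distrib_right mult_1_left mult_1_right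
    by (metis add_left_cancel)
  have comm: "(1 - X) ^ i * R = R * (1 - X) ^ i" for i
    by (rule power_commuting_commutes) (simp add: XR algebra_simps)
  have Dj: "cayley t (- B) ^ i = (1 - X) ^ i * R ^ i" for i
  proof (induction i)
    case (Suc i)
    have "cayley t (- B) ^ Suc i = (1 - X) * (R * (1 - X) ^ i) * R ^ i"
      by (simp only: power_Suc Suc) (simp add: D mult.assoc)
    then show ?case by (simp add: comm[symmetric] mult.assoc)
  qed simp
  have "V ^ n = V ^ Suc j * V ^ (n - 1 - j)"
    unfolding power_add[symmetric] by (rule arg_cong[of _ _ "power V"]) (use j in simp)
  then have "R * cayley t (- B) ^ j * V ^ n = ((1 - X) ^ j * R ^ Suc j) * (V ^ Suc j * V ^ (n - 1 - j))"
    by (simp add: Dj comm[symmetric] mult.assoc[symmetric])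
  also have "\<dots> = (1 - X) ^ j * (R ^ Suc j * V ^ Suc j) * V ^ (n - 1 - j)"
    by (simp only: mult.assoc)
  also have "R ^ Suc j * V ^ Suc j = 1" by (rule left_right_inverse_power[OF RV])
  also have "(1 - X) ^ j * 1 * V ^ (n - 1 - j) = op_poly ([:1, -1:] ^ j * [:1, 1:] ^ (n - 1 - j)) X"
    by (simp add: op_poly_mult op_poly_power op_poly_pCons V_def)
  finally show ?thesis by (simp only: X_def R_def V_def mult.commute[of "[:1, -1:] ^ j"])
qed

text \<open>Differences of consecutive Cayley steps act like \<open>t B\<close>: \<open>1 - D = t B R\<close>. A difference of order \<open>p\<close>
therefore isolates \<open>t\<^sup>p B\<^sup>p\<close>.\<close>

lemma one_minus_cayley_power:
  assumes t: "0 < t"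
  shows "resolvent B t * (1 - cayley t (- B)) ^ p = t ^ p *\<^sub>R (B ^ p * resolvent B t ^ (p + 1))"
proof -
  define R where "R = resolvent B t"
  have VR: "R + (t / 2) *\<^sub>R (B * R) = 1" "R + (t / 2) *\<^sub>R (R * B) = 1"
    using resolvent_inverse[OF t] by (simp_all add: R_def distrib_left distrib_right)
  then have "(t / 2) *\<^sub>R (B * R) = (t / 2) *\<^sub>R (R * B)" by (metis add_left_cancel)
  then have BR: "B * R = R * B" using t by simp
  have "1 - cayley t (- B) = 2 *\<^sub>R (1 - R)"
    by (simp add: cayley_eq(1)[OF t] R_def scaleR_diff_right scaleR_2)
  also have "1 - R = (t / 2) *\<^sub>R (B * R)" using VR(1) by (metis add_diff_cancel_left')
  finally have D: "1 - cayley t (- B) = t *\<^sub>R (B * R)" by simp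
  have comm: "B ^ i * R = R * B ^ i" for i by (rule power_commuting_commutes[OF BR])
  have pow: "(B * R) ^ i = B ^ i * R ^ i" for i
  proof (induction i)
    case (Suc i)
    have "(B * R) ^ Suc i = B * (R * B ^ i) * R ^ i" by (simp add: Suc mult.assoc)
    then show ?case by (simp add: comm[symmetric] mult.assoc)
  qed simp
  have "R * (1 - cayley t (- B)) ^ p = t ^ p *\<^sub>R (R * B ^ p * R ^ p)"
    by (simp add: D scaleR_power pow mult.assoc)
  also have "R * B ^ p * R ^ p = B ^ p * R ^ (p + 1)"
    by (simp add: comm[symmetric] mult.assoc)
  finally show ?thesis by (simp add: R_def)
qed

text \<open>The alternating binomial combination of the first \<open>p + 1\<close> terms \<open>S R D\<^sup>j x\<close> is exactly
\<open>t\<^sup>p S B\<^sup>p R\<^bsup>p + 1\<^esup> x\<close>, and the Cauchy-Schwarz inequality gives the constant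
\<open>\<Sum> (p choose j)\<^sup>2 = (2 p choose p)\<close>. The factor \<open>R\<^bsup>p + 1\<^esup>\<close> differs from \<open>1\<close> by \<open>O(t)\<close>.\<close>

lemma cayley_defect_lower:
  assumes p: "p \<le> m"
  shows "\<exists>C\<ge>0. \<forall>t x. 0 < t \<and> t \<le> 1 \<and> norm x = 1 \<longrightarrow>
      2 / real (2 * p choose p) * t ^ (2 * p + 1) * ((norm ((S * B ^ p) x))\<^sup>2 - C * t)
        \<le> 1 - (norm ((cayley t (- B) ^ (m + 1)) x))\<^sup>2"
proof -
  define N where "N = norm (S * B ^ p)"
  define C where "C = 2 * N\<^sup>2 * (real (p + 1) * norm B)"
  show ?thesis
  proof (intro exI[of _ C] conjI allI impI; (elim conjE)?)
    show "0 \<le> C" by (simp add: C_def)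
  next
    fix t :: real and x :: 'a assume t: "0 < t" "t \<le> 1" and x: "norm x = 1"
    define R where "R = resolvent B t"
    define D where "D = cayley t (- B)"
    define w where "w j = (S * R * D ^ j) x" for j
    have nR: "norm R \<le> 1" unfolding R_def by (rule norm_resolvent[OF t(1)])
    have nb: "0 < real (2 * p choose p)" by simp
    have "t ^ p *\<^sub>R (S * B ^ p * R ^ (p + 1)) = S * (R * (1 - D) ^ p)"
      unfolding R_def D_def one_minus_cayley_power[OF t(1)] by (simp add: mult.assoc)
    also have "\<dots> = (\<Sum>j\<le>p. (real (p choose j) * (-1) ^ j) *\<^sub>R (S * R * D ^ j))"
      unfolding one_minus_power_expand by (simp add: sum_distrib_left mult.assoc)
    finally have "t ^ p *\<^sub>R (S * B ^ p * R ^ (p + 1)) x = (\<Sum>j\<le>p. (real (p choose j) * (-1) ^ j) *\<^sub>R w j)"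
      by (simp add: w_def bop_apply.sum_left flip: bop_apply_scaleR)
    then have "t ^ p * norm ((S * B ^ p * R ^ (p + 1)) x) = norm (\<Sum>j\<le>p. (real (p choose j) * (-1) ^ j) *\<^sub>R w j)"
      using t by (metis norm_scaleR abs_of_pos zero_less_power)
    also have "\<dots> \<le> (\<Sum>j\<le>p. real (p choose j) * norm (w j))"
      by (intro sum_norm_le) (simp add: abs_mult power_abs)
    finally have "(t ^ p * norm ((S * B ^ p * R ^ (p + 1)) x))\<^sup>2 \<le> (\<Sum>j\<le>p. real (p choose j) * norm (w j))\<^sup>2"
      using t by (intro power_mono) auto
    also have "\<dots> \<le> (\<Sum>j\<le>p. (real (p choose j))\<^sup>2) * (\<Sum>j\<le>p. (norm (w j))\<^sup>2)"
      by (rule Cauchy_Schwarz_ineq_sum)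
    also have "(\<Sum>j\<le>p. (real (p choose j))\<^sup>2) = real (2 * p choose p)"
      by (rule sum_choose_square)
    also have "(\<Sum>j\<le>p. (norm (w j))\<^sup>2) \<le> (\<Sum>j<m + 1. (norm (w j))\<^sup>2)"
      by (rule sum_mono2) (use p in auto)
    finally have main: "t ^ (2 * p) * (norm ((S * B ^ p * R ^ (p + 1)) x))\<^sup>2
        \<le> real (2 * p choose p) * (\<Sum>j<m + 1. (norm (w j))\<^sup>2)"
      by (simp add: power_mult_distrib power_even_eq mult_left_mono)
    have close: "(norm ((S * B ^ p) x))\<^sup>2 - C * t \<le> (norm ((S * B ^ p * R ^ (p + 1)) x))\<^sup>2"
    proof -
      let ?a = "norm ((S * B ^ p) x)" and ?b = "norm ((S * B ^ p * R ^ (p + 1)) x)"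
      have a: "?a \<le> N" using norm_bop_apply[of "S * B ^ p" x] x by (simp add: N_def)
      have "norm (R ^ (p + 1)) \<le> 1"
        using norm_power_ineq[of R "p + 1"] power_le_one[OF norm_ge_zero nR] by (rule order_trans)
      then have "norm (S * B ^ p * R ^ (p + 1)) \<le> N * 1"
        unfolding N_def by (intro order_trans[OF norm_mult_ineq] mult_left_mono) auto
      then have b: "?b \<le> N" using norm_bop_apply[of "S * B ^ p * R ^ (p + 1)" x] x by simp
      have "R - 1 = - ((t / 2) *\<^sub>R (B * R))"
        using resolvent_inverse(2)[OF t(1)] by (simp add: R_def distrib_right algebra_simps)
      then have "norm (R - 1) \<le> t / 2 * (norm B * norm R)"
        using t norm_mult_ineq[of B R] by (simp add: mult_left_mono)
      also have "\<dots> \<le> t * (norm B * 1)"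
        using t nR by (intro mult_mono) auto
      finally have "norm (R ^ (p + 1) - 1) \<le> real (p + 1) * (t * norm B)"
        by (intro order_trans[OF norm_power_minus_one_le[OF nR]] mult_left_mono) auto
      then have "norm (S * B ^ p * (R ^ (p + 1) - 1)) \<le> N * (real (p + 1) * (t * norm B))"
        unfolding N_def by (intro order_trans[OF norm_mult_ineq] mult_left_mono) auto
      then have d: "norm ((S * B ^ p * R ^ (p + 1)) x - (S * B ^ p) x) \<le> N * (real (p + 1) * (t * norm B))"
        using norm_bop_apply[of "S * B ^ p * (R ^ (p + 1) - 1)" x] x
        by (simp add: right_diff_distrib bop_apply_diff)
      have "?a - ?b \<le> N * (real (p + 1) * (t * norm B))"
        using d norm_triangle_ineq2[of "(S * B ^ p) x" "(S * B ^ p * R ^ (p + 1)) x"]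
        by (simp add: norm_minus_commute)
      then have "(?a - ?b) * (?a + ?b) \<le> (N * (real (p + 1) * (t * norm B))) * (N + N)"
        using a b t by (cases "0 \<le> ?a - ?b")
          (auto intro!: mult_mono intro: order_trans[OF mult_nonpos_nonneg] simp: N_def)
      then show ?thesis by (simp add: C_def power2_eq_square algebra_simps)
    qed
    have "t ^ (2 * p) * ((norm ((S * B ^ p) x))\<^sup>2 - C * t) \<le> real (2 * p choose p) * (\<Sum>j<m + 1. (norm (w j))\<^sup>2)"
      using t by (intro order_trans[OF mult_left_mono[OF close] main]) simp
    then have "t ^ (2 * p) * ((norm ((S * B ^ p) x))\<^sup>2 - C * t) / real (2 * p choose p) \<le> (\<Sum>j<m + 1. (norm (w j))\<^sup>2)"
      by (subst pos_divide_le_eq[OF nb]) (simp only: mult.commute)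
    then have "2 * t * (t ^ (2 * p) * ((norm ((S * B ^ p) x))\<^sup>2 - C * t) / real (2 * p choose p))
        \<le> 2 * t * (\<Sum>j<m + 1. (norm (w j))\<^sup>2)"
      using t by (intro mult_left_mono) auto
    also have "\<dots> = 1 - (norm ((D ^ (m + 1)) x))\<^sup>2"
      using cayley_defect[OF t(1), of x "m + 1"] x unfolding w_def D_def R_def by simp
    finally show "2 / real (2 * p choose p) * t ^ (2 * p + 1) * ((norm ((S * B ^ p) x))\<^sup>2 - C * t)
        \<le> 1 - (norm ((cayley t (- B) ^ (m + 1)) x))\<^sup>2"
      by (simp add: D_def mult_ac)
  qed
qed

text \<open>With \<open>x = (1 + t B / 2)\<^bsup>m + 1\<^esup> q (t B / 2) y\<close> all terms of the defect are polynomials in \<open>t B\<close> applied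
to \<open>y\<close>, and \<open>q\<close> from \<open>cayley_optimal_polynomial\<close> makes their coefficients of order \<open>m\<close> equal to
\<open>(-1)\<^sup>j (m choose j) / (2 m choose m)\<close>, whose squares sum to \<open>1 / (2 m choose m)\<close>. The factor \<open>2\<^sup>m\<close>
there compensates the substitution \<open>s = t B / 2\<close>.\<close>

lemma cayley_defect_upper:
  "\<exists>C\<ge>0. \<forall>t y. 0 < t \<and> t \<le> 1 \<and> y \<in> near_kernel S B m (t ^ (m + 1)) \<longrightarrow>
      (\<exists>x. 1 - C * t \<le> norm x \<and> (norm x)\<^sup>2 - (norm ((cayley t (- B) ^ (m + 1)) x))\<^sup>2
        \<le> 2 / real (2 * m choose m) * t ^ (2 * m + 1) * ((norm ((S * B ^ m) y))\<^sup>2 + C * t))"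
proof -
  define b where "b = real (2 * m choose m)"
  have b: "0 < b" by (simp add: b_def)
  define a where "a j = (-1) ^ j * real (m choose j) / b" for j
  have a_sq: "(\<Sum>j<m + 1. (a j)\<^sup>2) = 1 / b"
  proof -
    have "(\<Sum>j<m + 1. (a j)\<^sup>2) = (\<Sum>j\<le>m. (real (m choose j))\<^sup>2) / b\<^sup>2"
      by (simp add: a_def power_divide power_mult_distrib power_even_eq[symmetric] sum_divide_distrib lessThan_Suc_atMost)
    also have "(\<Sum>j\<le>m. (real (m choose j))\<^sup>2) = b"
      unfolding b_def sum_choose_square ..
    finally show ?thesis using b by (simp add: power2_eq_square)
  qed
  obtain q where q: "degree q \<le> m" "coeff q 0 = 1"
    and q_opt: "\<And>j. j \<le> m \<Longrightarrow> coeff ([:1, 1:] ^ (m - j) * [:1, -1:] ^ j * q) m = 2 ^ m * a j"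
    using cayley_optimal_polynomial[of m] unfolding a_def b_def by auto
  define r where "r j = pcompose ([:1, 1:] ^ (m - j) * [:1, -1:] ^ j * q) [:0, 1 / 2:]" for j
  have r_m: "coeff (r j) m = a j" if "j \<le> m" for j
    unfolding r_def coeff_pcompose_linear q_opt[OF that] by (simp add: power_divide)
  have r_deg: "degree (r j) \<le> m + m" if "j \<le> m" for j
  proof -
    have "degree ([:1, 1:] ^ (m - j) * [:1, -1:] ^ j * q) \<le> (m - j + j) + m"
      by (intro order_trans[OF degree_mult_le] add_mono degree_cayley_factors q(1))
    then show ?thesis using that by (simp add: r_def degree_pcompose)
  qed
  define A where "A = (\<Sum>j\<le>m. \<Sum>k\<le>m + m. \<bar>coeff (r j) k\<bar>)"
  have A0: "0 \<le> A" unfolding A_def by (intro sum_nonneg) auto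
  have r_le: "\<bar>coeff (r j) k\<bar> \<le> A" if "j \<le> m" for j k
  proof (cases "k \<le> m + m")
    case True
    then have "\<bar>coeff (r j) k\<bar> \<le> (\<Sum>k\<le>m + m. \<bar>coeff (r j) k\<bar>)"
      by (intro member_le_sum) auto
    also have "\<dots> \<le> A"
      unfolding A_def by (rule member_le_sum) (use that in \<open>auto intro: sum_nonneg\<close>)
    finally show ?thesis .
  next
    case False
    then show ?thesis using r_deg[OF that] A0 by (simp add: coeff_eq_0)
  qed
  obtain K where K: "0 \<le> K" and K_bound: "\<And>r t y w. degree r \<le> m + m \<Longrightarrow> (\<And>k. \<bar>coeff r k\<bar> \<le> A) \<Longrightarrow>
      0 < t \<Longrightarrow> t \<le> 1 \<Longrightarrow> y \<in> near_kernel S B m (t ^ (m + 1)) \<Longrightarrow>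
      norm (w - (S * op_poly r (t *\<^sub>R B)) y) \<le> 0 * t ^ (m + 1) \<Longrightarrow>
      (norm w)\<^sup>2 \<le> t ^ (2 * m) * ((coeff r m)\<^sup>2 * (norm ((S * B ^ m) y))\<^sup>2 + K * t)"
    using near_kernel_op_poly[OF A0 order_refl, where N = "m + m" and S = S and B = B and m = m] by blast
  define e where "e = pcompose ([:1, 1:] ^ (m + 1) * q) [:0, 1 / 2:]"
  have "coeff e 0 = 1"
  proof -
    have "coeff e 0 = poly ([:1, 1:] ^ (m + 1) * q) 0"
      by (simp only: e_def coeff_pcompose_linear power_0 mult_1_left poly_0_coeff_0)
    also have "\<dots> = coeff q 0" by (simp only: poly_mult poly_power) (simp add: poly_0_coeff_0)
    finally show ?thesis using q(2) by simp
  qed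
  then obtain C where C: "0 \<le> C" "\<And>t. 0 < t \<Longrightarrow> t \<le> 1 \<Longrightarrow> norm (op_poly e (t *\<^sub>R B) - 1) \<le> C * t"
    using op_poly_near_one[of e B] by blast
  define C' where "C' = C + real (m + 1) * K * b"
  have C': "C \<le> C'" "real (m + 1) * K * b \<le> C'" "0 \<le> C'"
    using C K b by (auto simp: C'_def)
  show ?thesis
  proof (intro exI[of _ C'] conjI allI impI; (elim conjE)?)
    show "0 \<le> C'" by (rule C')
  next
    fix t :: real and y assume t: "0 < t" "t \<le> 1" and y: "y \<in> near_kernel S B m (t ^ (m + 1))"
    then have ny: "norm y = 1" by (simp add: near_kernel_def)
    define x where "x = op_poly e (t *\<^sub>R B) y"
    have "norm ((op_poly e (t *\<^sub>R B) - 1) y) \<le> C * t"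
      using norm_bop_apply[of "op_poly e (t *\<^sub>R B) - 1" y] C(2)[OF t] ny by simp
    then have xy: "norm (x - y) \<le> C * t" by (simp add: x_def bop_apply_diff)
    have "1 - norm (x - y) \<le> norm x"
      using norm_triangle_ineq2[of y "y - x"] ny by (simp add: norm_minus_commute)
    moreover have "C * t \<le> C' * t" using t C' by (intro mult_right_mono) auto
    ultimately have nx: "1 - C' * t \<le> norm x" using xy by simp
    let ?h = "(norm ((S * B ^ m) y))\<^sup>2"
    let ?X = "(t / 2) *\<^sub>R B"
    have half: "(1 / 2) *\<^sub>R (t *\<^sub>R B) = ?X" by simp
    have x_eq: "x = ((1 + ?X) ^ (m + 1) * op_poly q ?X) y"
      unfolding x_def e_def op_poly_pcompose_linear half op_poly_mult op_poly_power
      by (simp add: op_poly_pCons)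
    have w: "(norm ((S * resolvent B t * cayley t (- B) ^ j) x))\<^sup>2 \<le> t ^ (2 * m) * ((a j)\<^sup>2 * ?h + K * t)"
      if j: "j \<in> {..<m + 1}" for j
    proof -
      have jm: "j \<le> m" using j by simp
      have "(S * resolvent B t * cayley t (- B) ^ j) x
          = (S * (resolvent B t * cayley t (- B) ^ j * (1 + ?X) ^ (m + 1)) * op_poly q ?X) y"
        unfolding x_eq by (simp only: bop_apply_times)
      also have "resolvent B t * cayley t (- B) ^ j * (1 + ?X) ^ (m + 1)
          = op_poly ([:1, 1:] ^ (m - j) * [:1, -1:] ^ j) ?X"
        using cayley_shift_power[OF t(1), of j "m + 1"] jm by simp
      also have "S * op_poly ([:1, 1:] ^ (m - j) * [:1, -1:] ^ j) ?X * op_poly q ?X = S * op_poly (r j) (t *\<^sub>R B)"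
        unfolding r_def op_poly_pcompose_linear half by (simp only: op_poly_mult mult.assoc)
      finally show ?thesis
        using K_bound[OF r_deg[OF jm] r_le[OF jm] t y, of "(S * resolvent B t * cayley t (- B) ^ j) x"]
        unfolding r_m[OF jm] by simp
    qed
    have "(norm x)\<^sup>2 - (norm ((cayley t (- B) ^ (m + 1)) x))\<^sup>2
        \<le> 2 * t * (\<Sum>j<m + 1. t ^ (2 * m) * ((a j)\<^sup>2 * ?h + K * t))"
      unfolding cayley_defect[OF t(1)] using t by (intro mult_left_mono sum_mono w) auto
    also have "(\<Sum>j<m + 1. t ^ (2 * m) * ((a j)\<^sup>2 * ?h + K * t)) = t ^ (2 * m) * (1 / b * ?h + real (m + 1) * (K * t))"
      unfolding sum_distrib_left[symmetric] sum.distrib sum_distrib_right[symmetric] a_sq by simp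
    also have "2 * t * \<dots> = 2 / b * t ^ (2 * m + 1) * (?h + real (m + 1) * K * b * t)"
      using b by (simp add: field_simps)
    also have "\<dots> \<le> 2 / b * t ^ (2 * m + 1) * (?h + C' * t)"
      using t C' b by (intro mult_left_mono add_left_mono mult_right_mono) auto
    finally show "\<exists>x. 1 - C' * t \<le> norm x \<and> (norm x)\<^sup>2 - (norm ((cayley t (- B) ^ (m + 1)) x))\<^sup>2
        \<le> 2 / real (2 * m choose m) * t ^ (2 * m + 1) * (?h + C' * t)"
      using nx unfolding b_def by blast
  qed
qed

text \<open>On \<open>x = (1 + t B / 2)\<^sup>k y\<close> the defect of \<open>D\<^sup>k\<close> involves polynomials of degree \<open>k - 1 < m\<close> only, so for \<open>y\<close>
in the near kernel it is \<open>O(\<delta>\<^sup>2)\<close> with a constant depending on \<open>t\<close> but not on \<open>y\<close>; and \<open>x\<close> is not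
shorter than \<open>y\<close>.\<close>

lemma norm_cayley_power_eq_one:
  assumes ne: "\<And>\<delta>. 0 < \<delta> \<Longrightarrow> near_kernel S B m \<delta> \<noteq> {}" and t: "0 < t" and k: "k \<le> m"
  shows "norm (cayley t (- B) ^ k) = 1"
proof (rule ccontr)
  let ?X = "(t / 2) *\<^sub>R B"
  let ?D = "cayley t (- B)"
  define p where "p j = ([:1, 1:] ^ (k - 1 - j) * [:1, -1:] ^ j :: real poly)" for j
  define c where "c j = (\<Sum>i\<le>k - 1. \<bar>coeff (p j) i\<bar> * (t / 2) ^ i)" for j
  define C where "C = 2 * t * (\<Sum>j<k. (c j)\<^sup>2)"
  have C0: "0 \<le> C" using t by (simp add: C_def sum_nonneg)
  define a where "a = 1 - (norm (?D ^ k))\<^sup>2"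
  assume "norm (?D ^ k) \<noteq> 1"
  then have "norm (?D ^ k) < 1" using cayley_power_contraction[OF t, of k] by simp
  then have a: "0 < a" unfolding a_def using power_less_one_iff[of "norm (?D ^ k)" 2] by simp
  \<comment> \<open>Chosen such that the defect \<open>C * \<delta>\<^sup>2\<close> lies below the gap \<open>a\<close>.\<close>
  define \<delta> where "\<delta> = sqrt (a / (C + 1))"
  have \<delta>: "0 < \<delta>" using a C0 by (simp add: \<delta>_def)
  obtain y where "y \<in> near_kernel S B m \<delta>" using ne[OF \<delta>] by blast
  then have ny: "norm y = 1" and y: "\<And>i. i < m \<Longrightarrow> norm ((S * B ^ i) y) \<le> \<delta>"
    by (auto simp: near_kernel_def)
  define x where "x = ((1 + ?X) ^ k) y"
  have nx: "1 \<le> norm x" using norm_le_shift_power[OF t, of y k] ny by (simp add: x_def)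
  have w: "(norm ((S * resolvent B t * ?D ^ j) x))\<^sup>2 \<le> (c j)\<^sup>2 * \<delta>\<^sup>2" if "j \<in> {..<k}" for j
  proof -
    have j: "j < k" using that by simp
    have "degree (p j) \<le> k - 1"
      using degree_cayley_factors[of "k - 1 - j" j] j by (simp add: p_def)
    then have "op_poly (p j) ?X = (\<Sum>i\<le>k - 1. (coeff (p j) i * (t / 2) ^ i) *\<^sub>R B ^ i)"
      by (simp add: op_poly_altdef scaleR_power)
    moreover have "(S * resolvent B t * ?D ^ j) x = (S * op_poly (p j) ?X) y"
      using cayley_shift_power[OF t j] by (simp add: x_def p_def mult.assoc flip: bop_apply_times)
    ultimately have "(S * resolvent B t * ?D ^ j) x = (\<Sum>i\<le>k - 1. (coeff (p j) i * (t / 2) ^ i) *\<^sub>R (S * B ^ i) y)"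
      by (simp add: sum_distrib_left bop_apply.sum_left bop_apply_scaleR)
    also have "norm \<dots> \<le> (\<Sum>i\<le>k - 1. (\<bar>coeff (p j) i\<bar> * (t / 2) ^ i) * \<delta>)"
    proof (rule sum_norm_le)
      fix i assume "i \<in> {..k - 1}"
      then have "norm ((S * B ^ i) y) \<le> \<delta>" using j k by (intro y) auto
      then show "norm ((coeff (p j) i * (t / 2) ^ i) *\<^sub>R (S * B ^ i) y) \<le> (\<bar>coeff (p j) i\<bar> * (t / 2) ^ i) * \<delta>"
        unfolding norm_scaleR using t by (intro mult_mono) (auto simp: abs_mult)
    qed
    also have "\<dots> = c j * \<delta>" by (simp add: c_def sum_distrib_right)
    finally show ?thesis by (subst power_mult_distrib[symmetric]) (intro power_mono, auto)
  qed
  have "a * 1 \<le> a * (norm x)\<^sup>2" using a nx by (intro mult_left_mono) auto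
  also have "\<dots> \<le> (norm x)\<^sup>2 - (norm ((?D ^ k) x))\<^sup>2"
  proof -
    have "(norm ((?D ^ k) x))\<^sup>2 \<le> (norm (?D ^ k) * norm x)\<^sup>2"
      by (intro power_mono norm_bop_apply) simp
    then show ?thesis by (simp add: a_def power_mult_distrib left_diff_distrib)
  qed
  also have "\<dots> \<le> 2 * t * (\<Sum>j<k. (c j)\<^sup>2 * \<delta>\<^sup>2)"
    unfolding cayley_defect[OF t] using t by (intro mult_left_mono sum_mono w) auto
  also have "\<dots> = C * (a / (C + 1))"
  proof -
    have \<delta>_sq: "\<delta>\<^sup>2 = a / (C + 1)" using a C0 by (simp add: \<delta>_def)
    show ?thesis unfolding sum_distrib_right[symmetric] \<delta>_sq by (simp only: C_def mult.assoc)
  qed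
  also have "\<dots> < a" using a C0 by (simp add: field_simps)
  finally show False by simp
qed

end

section \<open>Central differences of the grid function\<close>

lemma even_diff_minus_one:
  "even_diff q f k = even_diff q (\<lambda>_. 1) k
    + (\<Sum>i\<le>2 * q. (-1) ^ i * real (2 * q choose i) * (f (k + int q - int i) - 1))"
  by (simp add: even_diff_def right_diff_distrib sum_subtractf)

lemma even_diff_one: "even_diff q (\<lambda>_. 1) k = (if q = 0 then 1 else 0)"
  using choose_alternating_sum[of "2 * q", where ?'a = real] by (auto simp: even_diff_def)

lemma even_diff_locally_one:
  assumes "\<And>i. \<bar>i - k\<bar> \<le> int q \<Longrightarrow> f i = 1"
  shows "even_diff q f k = (if q = 0 then 1 else 0)"
proof -
  have "f (k + int q - int i) = 1" if "i \<le> 2 * q" for i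
    using that by (intro assms) linarith
  then show ?thesis by (subst even_diff_minus_one) (simp add: even_diff_one)
qed

lemma central_diff_locally_one:
  assumes one: "\<And>i. \<bar>i\<bar> \<le> int m \<Longrightarrow> f i = 1" and j: "j \<le> 2 * m"
  shows "central_diff j f 0 = (if j = 0 then 1 else 0)"
proof (cases "even j")
  case True
  then obtain q where q: "j = 2 * q" by blast
  have "even_diff q f 0 = (if q = 0 then 1 else 0)"
    by (rule even_diff_locally_one) (use one q j in auto)
  then show ?thesis using q by (simp add: central_diff_def)
next
  case False
  then obtain q where q: "j = 2 * q + 1" using oddE by blast
  have "even_diff q f 1 = (if q = 0 then 1 else 0)" "even_diff q f (- 1) = (if q = 0 then 1 else 0)"
    by (rule even_diff_locally_one, rule one, use q j in linarith)+
  then show ?thesis using q by (simp add: central_diff_def)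
qed

text \<open>The two even differences have stencils \<open>[1 - m, m + 1]\<close> and \<open>[- m - 1, m - 1]\<close>, and each meets only one
point where \<open>f\<close> differs from \<open>1\<close>. By the reflection rule both deviations contribute equally, which
cancels the factor \<open>1 / 2\<close>.\<close>

lemma central_diff_step:
  assumes one: "\<And>i. \<bar>i\<bar> \<le> int m \<Longrightarrow> f i = 1" and odd: "f (- int (m + 1)) = 2 - f (int (m + 1))"
  shows "central_diff (2 * m + 1) f 0 = f (int (m + 1)) - 1"
proof -
  have "(\<Sum>i\<le>2 * m. (-1) ^ i * real (2 * m choose i) * (f (1 + int m - int i) - 1))
      = (\<Sum>i\<in>{0}. (-1) ^ i * real (2 * m choose i) * (f (1 + int m - int i) - 1))"
    by (rule sum.mono_neutral_right) (auto intro!: one)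
  then have plus: "even_diff m f 1 = even_diff m (\<lambda>_. 1) 1 + (f (int (m + 1)) - 1)"
    by (subst even_diff_minus_one) (simp add: add.commute)
  have "(\<Sum>i\<le>2 * m. (-1) ^ i * real (2 * m choose i) * (f (- 1 + int m - int i) - 1))
      = (\<Sum>i\<in>{2 * m}. (-1) ^ i * real (2 * m choose i) * (f (- 1 + int m - int i) - 1))"
    by (rule sum.mono_neutral_right) (auto intro!: one)
  also have "\<dots> = f (- int (m + 1)) - 1"
  proof -
    have "- 1 + int m - int (2 * m) = - int (m + 1)" by simp
    then show ?thesis by (simp only: sum.insert sum.empty finite.emptyI empty_iff not_False_eq_True)
      (simp add: power_mult)
  qed
  finally have minus: "even_diff m f (- 1) = even_diff m (\<lambda>_. 1) (- 1) + (f (- int (m + 1)) - 1)"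
    by (subst even_diff_minus_one) simp
  show ?thesis
    unfolding central_diff_def using plus minus odd by (simp add: even_diff_one)
qed

section \<open>The hypocoercivity index\<close>

lemma cinner_adj_power:
  fixes A :: "'a::complex_hilbert bop"
  shows "cinner x ((adj A ^ n) y) = cinner ((A ^ n) x) y"
proof (induction n arbitrary: x)
  case (Suc n)
  have "cinner x ((adj A ^ Suc n) y) = cinner (A x) ((adj A ^ n) y)"
    by (simp add: bop_apply_times) (metis cinner_adj cinner_commute)
  also have "\<dots> = cinner ((A ^ n * A) x) y" by (simp add: Suc bop_apply_times)
  finally show ?case by (simp only: power_Suc2)
qed simp

lemma cinner_zero_right: "cinner x (0 :: 'a::complex_hilbert) = 0"
  using cinner_scaleR_right[of x 0 0] by simp

lemma cinner_sum_right: "cinner x (\<Sum>i\<in>I. g i) = (\<Sum>i\<in>I. cinner x (g i :: 'a::complex_hilbert))"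
  by (induction I rule: infinite_finite_induct) (simp_all add: cinner_zero_right cinner_add_right)

text \<open>The quadratic form of \<open>adj B ^ j * herm B * B ^ j\<close> at \<open>x\<close> is \<open>\<parallel>S B\<^sup>j x\<parallel>\<^sup>2\<close>.\<close>

lemma hc_coercive_iff:
  fixes B :: "'a::complex_hilbert bop"
  assumes H: "nonneg_op (herm B)"
  shows "hc_coercive B n \<longleftrightarrow>
    (\<exists>\<kappa>>0. \<forall>x. \<kappa> * (norm x)\<^sup>2 \<le> (\<Sum>j\<le>n. (norm ((op_sqrt (herm B) * B ^ j) x))\<^sup>2))"
proof -
  let ?S = "op_sqrt (herm B)"
  let ?G = "\<Sum>j\<le>n. adj B ^ j * herm B * B ^ j"
  have S_sq: "cinner z (herm B z) = of_real ((norm (?S z))\<^sup>2)" for z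
  proof -
    have "cinner z (herm B z) = cinner z (?S (?S z))"
      by (simp only: bop_apply_times[symmetric] op_sqrt(2)[OF H])
    then show ?thesis
      by (simp only: nonneg_op_selfadjoint[OF op_sqrt(1)[OF H]] cinner_self)
  qed
  have "cinner x ((?G - \<kappa> *\<^sub>R 1) x)
      = of_real ((\<Sum>j\<le>n. (norm ((?S * B ^ j) x))\<^sup>2) - \<kappa> * (norm x)\<^sup>2)" for \<kappa> x
  proof -
    have "cinner x ((?G - \<kappa> *\<^sub>R 1) x) + of_real \<kappa> * cinner x x = cinner x (?G x)"
      by (simp add: bop_apply_diff bop_apply_scaleR flip: cinner_scaleR_right cinner_add_right)
    also have "\<dots> = (\<Sum>j\<le>n. of_real ((norm ((?S * B ^ j) x))\<^sup>2))"
      by (simp only: bop_apply.sum_left cinner_sum_right bop_apply_times cinner_adj_power S_sq)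
    finally show ?thesis by (simp add: cinner_self algebra_simps)
  qed
  then have "nonneg_op (?G - \<kappa> *\<^sub>R 1) \<longleftrightarrow>
      (\<forall>x. \<kappa> * (norm x)\<^sup>2 \<le> (\<Sum>j\<le>n. (norm ((?S * B ^ j) x))\<^sup>2))" for \<kappa>
    unfolding nonneg_op_def by (simp only: Reals_of_real Re_complex_of_real simp_thms) simp
  then show ?thesis unfolding hc_coercive_def by simp
qed

text \<open>Failure of coercivity with constant \<open>\<delta>\<^sup>2\<close> at \<open>m - 1\<close> yields the vector. For \<open>m = 0\<close> there is no
constraint, and any unit vector will do.\<close>

lemma near_kernel_nonempty:
  fixes B :: "'a::complex_hilbert bop"
  assumes H: "nonneg_op (herm B)" and noncoercive: "\<And>n. n < m \<Longrightarrow> \<not> hc_coercive B n" and \<delta>: "0 < \<delta>"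
  shows "near_kernel (op_sqrt (herm B)) B m \<delta> \<noteq> {}"
proof (cases m)
  case 0
  obtain z :: 'a where "z \<noteq> 0" using nontrivial by blast
  then have "norm ((1 / norm z) *\<^sub>R z) = 1" by simp
  then show ?thesis unfolding near_kernel_def 0 by blast
next
  case (Suc n)
  let ?S = "op_sqrt (herm B)"
  have "\<not> hc_coercive B n" by (rule noncoercive) (simp add: Suc)
  then obtain x where x: "(\<Sum>j\<le>n. (norm ((?S * B ^ j) x))\<^sup>2) < \<delta>\<^sup>2 * (norm x)\<^sup>2"
    using \<delta> unfolding hc_coercive_iff[OF H] by (auto simp: not_le dest: spec[of _ "\<delta>\<^sup>2"])
  have x0: "x \<noteq> 0" using x by (auto simp: bop_apply.zero_right)
  define y where "y = (1 / norm x) *\<^sub>R x"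
  have "norm y = 1" using x0 by (simp add: y_def)
  moreover have "norm ((?S * B ^ p) y) \<le> \<delta>" if "p < m" for p
  proof -
    have "(norm ((?S * B ^ p) x))\<^sup>2 \<le> (\<Sum>j\<le>n. (norm ((?S * B ^ j) x))\<^sup>2)"
      by (rule member_le_sum) (use that Suc in auto)
    then have "(norm ((?S * B ^ p) x))\<^sup>2 \<le> (\<delta> * norm x)\<^sup>2" using x by (simp add: power_mult_distrib)
    then have "norm ((?S * B ^ p) x) \<le> \<delta> * norm x" by (rule power2_le_imp_le) (use \<delta> in simp)
    then show ?thesis using x0 by (simp add: y_def bop_apply_scaleR_right field_simps)
  qed
  ultimately show ?thesis unfolding near_kernel_def by blast
qed

section \<open>The Peano derivative and the finite difference quotient\<close>

theorem theorem5p1: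
  fixes B :: "'a::complex_hilbert bop" and m :: nat
  assumes separable: "separable_space (euclidean :: 'a topology)"
    and semi_diss: "semi_dissipative (- B)"
    and index_exists: "\<exists>n. hc_coercive B n"
    and m_def: "m = hc_index B"
  shows "\<exists>D L c. has_peano_derivs (prop_norm B) (2 * m + 1) D
    \<and> (hc_inf B m \<longlongrightarrow> L) (at_right 0)
    \<and> c = 1 / (fact (2 * m + 1) * real (2 * m choose m)) * L
    \<and> (\<forall>\<tau>>0. central_diff (2 * m + 1) (grid_norm B \<tau>) 0 / \<tau> ^ (2 * m + 1)
           = (grid_norm B \<tau> (int (m + 1)) - 1) / \<tau> ^ (2 * m + 1))
    \<and> ((\<lambda>\<tau>. (grid_norm B \<tau> (int (m + 1)) - 1) / \<tau> ^ (2 * m + 1)) \<longlongrightarrow> D (2 * m + 1)) (at_right 0)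
    \<and> D (2 * m + 1) = - fact (2 * m + 1) * c
    \<and> (\<forall>j\<le>2 * m. D j = (if j = 0 then 1 else 0)
         \<and> (\<forall>\<tau>>0. central_diff j (grid_norm B \<tau>) 0 = D j))"
proof -
  define S where "S = op_sqrt (herm B)"
  have H: "nonneg_op (herm B)" using semi_diss by (simp add: semi_dissipative_def)
  have S: "(norm (S x))\<^sup>2 = rinner x (B x)" for x
    unfolding S_def norm_op_sqrt_apply[OF H] rinner_herm ..
  have ne: "near_kernel S B m \<delta> \<noteq> {}" if "0 < \<delta>" for \<delta>
    unfolding S_def
  proof (rule near_kernel_nonempty[OF H _ that])
    show "\<not> hc_coercive B n" if "n < m" for n
      by (rule not_less_Least) (use that in \<open>simp only: m_def hc_index_def\<close>)
  qed
  have inf_eq: "hc_inf B m = coupling_inf S B m"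
    by (simp add: fun_eq_iff hc_inf_def coupling_inf_def near_kernel_def S_def)
  obtain L where L: "(coupling_inf S B m \<longlongrightarrow> L) (at_right 0)" and L_ge: "\<And>\<delta>. 0 < \<delta> \<Longrightarrow> coupling_inf S B m \<delta> \<le> L"
    using coupling_inf_converges[OF ne] by blast
  define b where "b = real (2 * m choose m)"
  have b: "0 < b" by (simp add: b_def)
  define c where "c = 1 / (fact (2 * m + 1) * b) * L"
  define D where "D j = (if j = 0 then 1 else if j = 2 * m + 1 then - fact (2 * m + 1) * c else 0)" for j
  have "((\<lambda>t. (1 - norm (exp (- (t *\<^sub>R B)))) / t ^ (2 * m + 1)) \<longlongrightarrow> 2 * legendre_norm m * L / 2) (at_right 0)"
  proof (rule norm_asymptotics[OF ne L L_ge, where \<kappa> = "\<lambda>p. 2 * legendre_norm p"])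
    show "norm (exp (- (t *\<^sub>R B))) \<le> 1" if "0 < t" for t
      by (rule semigroup_contraction[OF S]) (use that in simp)
  qed (rule semigroup_defect_lower[OF S] semigroup_defect_upper[OF S] | simp add: legendre_norm_pos)+
  moreover have "2 * legendre_norm m * L / 2 = c"
  proof -
    have "b = fact (2 * m) / (fact m * fact (2 * m - m))"
      unfolding b_def by (rule binomial_fact) simp
    also have "2 * m - m = m" by simp
    finally show ?thesis by (simp only: legendre_norm_def c_def power2_eq_square) (simp add: mult_ac)
  qed
  ultimately have lim_exp: "((\<lambda>t. (1 - prop_norm B t) / t ^ (2 * m + 1)) \<longlongrightarrow> c) (at_right 0)"
    by (simp add: prop_norm_def)
  have "((\<lambda>t. (1 - norm (cayley t (- B) ^ (m + 1))) / t ^ (2 * m + 1)) \<longlongrightarrow> 2 / real (2 * m choose m) * L / 2) (at_right 0)"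
  proof (rule norm_asymptotics[OF ne L L_ge, where \<kappa> = "\<lambda>p. 2 / real (2 * p choose p)"])
    show "\<exists>C\<ge>0. \<forall>t x. 0 < t \<and> t \<le> 1 \<and> norm x = 1 \<longrightarrow>
      2 / real (2 * p choose p) * t ^ (2 * p + 1) * ((norm ((S * B ^ p) x))\<^sup>2 - C * t)
        \<le> 1 - (norm ((cayley t (- B) ^ (m + 1)) x))\<^sup>2" if "p \<le> m" for p
      by (rule cayley_defect_lower[OF S that])
    show "\<exists>C\<ge>0. \<forall>t y. 0 < t \<and> t \<le> 1 \<and> y \<in> near_kernel S B m (t ^ (m + 1)) \<longrightarrow>
      (\<exists>x. 1 - C * t \<le> norm x \<and> (norm x)\<^sup>2 - (norm ((cayley t (- B) ^ (m + 1)) x))\<^sup>2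
        \<le> 2 / real (2 * m choose m) * t ^ (2 * m + 1) * ((norm ((S * B ^ m) y))\<^sup>2 + C * t))"
      by (rule cayley_defect_upper[OF S])
    show "norm (cayley t (- B) ^ (m + 1)) \<le> 1" if "0 < t" for t
      by (rule cayley_power_contraction[OF S that])
  qed simp_all
  then have lim_cayley: "((\<lambda>t. (1 - grid_norm B t (int (m + 1))) / t ^ (2 * m + 1)) \<longlongrightarrow> L / b) (at_right 0)"
    by (simp add: grid_norm_def b_def nat_add_distrib)
  have grid_one: "grid_norm B \<tau> i = 1" if "0 < \<tau>" "\<bar>i\<bar> \<le> int m" for \<tau> i
  proof -
    have "norm (cayley \<tau> (- B) ^ nat \<bar>i\<bar>) = 1"
      by (rule norm_cayley_power_eq_one[OF S ne that(1)]) (use that in auto)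
    then show ?thesis by (cases "0 \<le> i") (simp_all add: grid_norm_def)
  qed
  have grid_odd: "grid_norm B \<tau> (- int (m + 1)) = 2 - grid_norm B \<tau> (int (m + 1))" for \<tau>
    by (simp add: grid_norm_def add.commute)
  have D_top: "D (2 * m + 1) = - (L / b)" by (simp add: D_def c_def)
  have "has_peano_derivs (prop_norm B) (2 * m + 1) D"
    unfolding has_peano_derivs_def
  proof (rule smalloI_tendsto)
    have sum: "(\<Sum>j\<le>2 * m + 1. D j / fact j * t ^ j) = 1 - c * t ^ (2 * m + 1)" for t :: real
    proof -
      have "(\<Sum>j\<le>2 * m + 1. D j / fact j * t ^ j) = (\<Sum>j\<in>{0, 2 * m + 1}. D j / fact j * t ^ j)"
        by (rule sum.mono_neutral_right) (auto simp: D_def)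
      then show ?thesis by (simp add: D_def)
    qed
    have "((\<lambda>t. c - (1 - prop_norm B t) / t ^ (2 * m + 1)) \<longlongrightarrow> c - c) (at_right 0)"
      by (intro tendsto_intros lim_exp)
    moreover have "\<forall>\<^sub>F t :: real in at_right 0. 0 < t" by (rule eventually_at_right_less)
    then have "\<forall>\<^sub>F t in at_right 0. c - (1 - prop_norm B t) / t ^ (2 * m + 1)
        = (prop_norm B t - (\<Sum>j\<le>2 * m + 1. D j / fact j * t ^ j)) / t ^ (2 * m + 1)"
      by eventually_elim (unfold sum, simp add: diff_divide_distrib)
    ultimately have "((\<lambda>t. (prop_norm B t - (\<Sum>j\<le>2 * m + 1. D j / fact j * t ^ j)) / t ^ (2 * m + 1))
        \<longlongrightarrow> c - c) (at_right 0)"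
      by (rule Lim_transform_eventually)
    then show "((\<lambda>t. (prop_norm B t - (\<Sum>j\<le>2 * m + 1. D j / fact j * t ^ j)) / t ^ (2 * m + 1)) \<longlongrightarrow> 0) (at_right 0)"
      by (simp only: diff_self)
    have "\<forall>\<^sub>F t :: real in at_right 0. 0 < t" by (rule eventually_at_right_less)
    then show "\<forall>\<^sub>F t :: real in at_right 0. t ^ (2 * m + 1) \<noteq> 0"
      by eventually_elim simp
  qed
  moreover have "((\<lambda>\<tau>. (grid_norm B \<tau> (int (m + 1)) - 1) / \<tau> ^ (2 * m + 1)) \<longlongrightarrow> D (2 * m + 1)) (at_right 0)"
    unfolding D_top using tendsto_minus[OF lim_cayley] by (simp only: minus_divide_left minus_diff_eq)
  moreover have "\<forall>\<tau>>0. central_diff (2 * m + 1) (grid_norm B \<tau>) 0 = grid_norm B \<tau> (int (m + 1)) - 1"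
  proof (intro allI impI)
    fix \<tau> :: real assume \<tau>: "0 < \<tau>"
    show "central_diff (2 * m + 1) (grid_norm B \<tau>) 0 = grid_norm B \<tau> (int (m + 1)) - 1"
      by (rule central_diff_step) (simp only: grid_one[OF \<tau>], rule grid_odd)
  qed
  moreover have "D j = (if j = 0 then 1 else 0) \<and> (\<forall>\<tau>>0. central_diff j (grid_norm B \<tau>) 0 = D j)"
    if "j \<le> 2 * m" for j
  proof -
    have "central_diff j (grid_norm B \<tau>) 0 = (if j = 0 then 1 else 0)" if "0 < \<tau>" for \<tau>
      by (rule central_diff_locally_one[OF _ \<open>j \<le> 2 * m\<close>]) (simp only: grid_one[OF that])
    moreover have "D j = (if j = 0 then 1 else 0)" using that by (simp add: D_def)
    ultimately show ?thesis by simp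
  qed
  moreover have "D (2 * m + 1) = - fact (2 * m + 1) * c" by (simp add: D_def)
  moreover have "(hc_inf B m \<longlongrightarrow> L) (at_right 0)" unfolding inf_eq by (rule L)
  moreover have "c = 1 / (fact (2 * m + 1) * real (2 * m choose m)) * L" by (simp only: c_def b_def)
  ultimately show ?thesis
    by (intro exI[of _ D] exI[of _ L] exI[of _ c] conjI allI impI) (simp_all only:)
qed

end
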